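(* Let $T=T_{(p_k,(a_j^{(k)})_{j=1}^{p_k})_{k=0}^\infty}$ be the rank one transformation with cutting parameters $(p_k)_{k\ge 0}$ and spacer parameters $((a_j^{(k)})_{j=1}^{p_k})_{k\ge 0}$, and let $h_k$ be the height of its $k$-th stack. Put $s_k(0)=0$ and $s_k(j)=a_1^{(k)}+\cdots+a_j^{(k)}$ for $1\le j\le p_k$. Assume that for every $k$: (i) $a_{j+1}^{(k)}\ge 2 s_k(j)$ for $j=0,\dots,p_k-1$; (ii) $\dfrac{s_k(p_k)}{h_k}<\dfrac12$. Then the spectrum of $T$ is singular.
   Context: Rank one transformations by cutting and stacking. Parameters: integers $p_k\ge 2$ and integers $a_j^{(k)}\ge 0$ for $k\ge 0$, $1\le j\le p_k$. Start with the stack consisting of the single level $B_0=$ the unit interval with Lebesgue measure, so $h_0=1$. Given the stack of height $h_k$ (an ordered tower of $h_k$ disjoint intervals, called levels, of equal length), divide it vertically into $p_k$ columns of equal width. Above the $j$-th column put $a_j^{(k)}$ spacers (new disjoint intervals of the same width, taken outside what has been used so far), $1\le j\le p_k$. Then stack the columns from left to right, placing column $j+1$ on top of the spacers above column $j$. This gives a new stack of height $h_{k+1}=p_kh_k+\sum_{j=1}^{p_k}a_j^{(k)}$. At each stage the partially defined map sends each level except the top one by translation onto the level directly above it. In the limit these maps define an invertible measure preserving transformation $T$ on a measure space $(X,\mathcal B,\nu)$, where $X$ is the union of all levels and $\nu$ is Lebesgue measure; $\nu$ is finite or $\sigma$-finite. Let $\lambda$ be normalized Lebesgue measure on the circle group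 $\mathbb T$. "The spectrum of $T$ is singular" means that the maximal spectral type of the unitary operator $Uf=f\circ T$ on $L^2(X,\nu)$ is singular with respect to $\lambda$. Equivalently, for every $f\in L^2(X,\nu)$ the measure $\sigma_f$ on $\mathbb T$ with Fourier coefficients $\hat\sigma_f(n)=\langle U^nf,f\rangle$, $n\in\mathbb Z$, is singular with respect to $\lambda$. *)

theory Defs
  imports "HOL-Analysis.Analysis"
begin

section \<open>Cutting and stacking\<close>

text \<open>
  The parameters are \<open>p k\<close> (number of columns) and \<open>a k j\<close> for \<open>1 \<le> j \<le> p k\<close> (number of spacers
  above the \<open>j\<close>-th column); values of \<open>a k\<close> outside \<open>{1..p k}\<close> are never used.
\<close>

definition spacer_sum :: "(nat \<Rightarrow> nat \<Rightarrow> nat) \<Rightarrow> nat \<Rightarrow> nat \<Rightarrow> nat" where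
  "spacer_sum a k j = (\<Sum>i=1..j. a k i)"

primrec height :: "(nat \<Rightarrow> nat) \<Rightarrow> (nat \<Rightarrow> nat \<Rightarrow> nat) \<Rightarrow> nat \<Rightarrow> nat" where
  "height p a 0 = 1"
| "height p a (Suc k) = p k * height p a k + (\<Sum>j=1..p k. a k j)"

definition width :: "(nat \<Rightarrow> nat) \<Rightarrow> nat \<Rightarrow> real" where
  "width p k = 1 / (\<Prod>i<k. real (p i))"

text \<open>
  \<open>b k i\<close> is the left endpoint of the \<open>i\<close>-th level of stack \<open>k\<close>, counted from the bottom,
  \<open>i < height p a k\<close>. Intervals are half-open.
\<close>

definition level :: "(nat \<Rightarrow> nat) \<Rightarrow> (nat \<Rightarrow> nat \<Rightarrow> real) \<Rightarrow> nat \<Rightarrow> nat \<Rightarrow> real set" where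
  "level p b k i = {b k i ..< b k i + width p k}"

text \<open>
  In stack \<open>Suc k\<close>, the \<open>j\<close>-th column (now counted from 0) of stack \<open>k\<close> starts at position
  \<open>j * height p a k + spacer_sum a k j\<close>, on top of the \<open>j\<close> previous columns and their spacers.
  The positions of stack \<open>Suc k\<close> that lie in no column are the spacers; their location in the
  line is free except for the disjointness requirement at \<open>Suc k\<close>. As the columns exhaust the
  levels of stack \<open>k\<close>, this also puts the new spacers outside everything used before.
\<close>

definition cutting_and_stacking ::
    "(nat \<Rightarrow> nat) \<Rightarrow> (nat \<Rightarrow> nat \<Rightarrow> nat) \<Rightarrow> (nat \<Rightarrow> nat \<Rightarrow> real) \<Rightarrow> bool" where
  "cutting_and_stacking p a b \<longleftrightarrow>
     b 0 0 = 0 \<and>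
     (\<forall>k. \<forall>j<p k. \<forall>i<height p a k.
        b (Suc k) (j * height p a k + spacer_sum a k j + i) = b k i + real j * width p (Suc k)) \<and>
     (\<forall>k. disjoint_family_on (level p b k) {..<height p a k})"

definition rank_one_space ::
    "(nat \<Rightarrow> nat) \<Rightarrow> (nat \<Rightarrow> nat \<Rightarrow> nat) \<Rightarrow> (nat \<Rightarrow> nat \<Rightarrow> real) \<Rightarrow> real measure" where
  "rank_one_space p a b = restrict_space lborel (\<Union>k. \<Union>i<height p a k. level p b k i)"

text \<open>
  Since the levels are half-open, every point of the space lies below the top level of some stack,
  so these conditions determine \<open>T\<close> on the whole space. The map is injective there, and its
  image omits exactly one point, the left endpoint of the initial level.
\<close>

definition rank_one_transformation ::
    "(nat \<Rightarrow> nat) \<Rightarrow> (nat \<Rightarrow> nat \<Rightarrow> nat) \<Rightarrow> (nat \<Rightarrow> nat \<Rightarrow> real) \<Rightarrow> (real \<Rightarrow> real) \<Rightarrow> bool" where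
  "rank_one_transformation p a b T \<longleftrightarrow>
     cutting_and_stacking p a b \<and>
     (\<forall>k i. Suc i < height p a k \<longrightarrow>
        (\<forall>x\<in>level p b k i. T x = x + (b k (Suc i) - b k i)))"


section \<open>Spectral measures and singular spectrum\<close>

definition circle_space :: "complex measure" where
  "circle_space = restrict_space borel (sphere 0 1)"

definition circle_lebesgue :: "complex measure" where
  "circle_lebesgue =
     distr (restrict_space lborel {0..<1}) circle_space (\<lambda>t. cis (2 * pi * t))"

definition mutually_singular :: "'a measure \<Rightarrow> 'a measure \<Rightarrow> bool" where
  "mutually_singular M N \<longleftrightarrow>
     sets M = sets N \<and> (\<exists>A\<in>sets M. emeasure M A = 0 \<and> emeasure N (space N - A) = 0)"

text \<open>
  Integer iterates of a map that is invertible modulo a null set; where \<open>T\<close> has no preimage in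
  \<open>space M\<close>, \<open>inv_into\<close> takes an arbitrary value.
\<close>

definition int_iterate :: "'a measure \<Rightarrow> ('a \<Rightarrow> 'a) \<Rightarrow> int \<Rightarrow> 'a \<Rightarrow> 'a" where
  "int_iterate M T n =
     (if n \<ge> 0 then T ^^ nat n else (inv_into (space M) T) ^^ nat (- n))"

definition L2_function :: "'a measure \<Rightarrow> ('a \<Rightarrow> complex) \<Rightarrow> bool" where
  "L2_function M f \<longleftrightarrow> f \<in> borel_measurable M \<and> integrable M (\<lambda>x. (cmod (f x))\<^sup>2)"

definition is_spectral_measure ::
    "'a measure \<Rightarrow> ('a \<Rightarrow> 'a) \<Rightarrow> ('a \<Rightarrow> complex) \<Rightarrow> complex measure \<Rightarrow> bool" where
  "is_spectral_measure M T f \<sigma> \<longleftrightarrow>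
     sets \<sigma> = sets circle_space \<and> finite_measure \<sigma> \<and>
     (\<forall>n::int. (LINT z|\<sigma>. z powi (- n)) = (LINT x|M. f (int_iterate M T n x) * cnj (f x)))"

text \<open>
  A finite measure on the circle is determined by its Fourier coefficients, so the \<open>\<sigma>\<close> below is
  the spectral measure of \<open>f\<close>.
\<close>

definition singular_spectrum :: "'a measure \<Rightarrow> ('a \<Rightarrow> 'a) \<Rightarrow> bool" where
  "singular_spectrum M T \<longleftrightarrow>
     (\<forall>f. L2_function M f \<longrightarrow>
        (\<exists>\<sigma>. is_spectral_measure M T f \<sigma> \<and> mutually_singular \<sigma> circle_lebesgue))"


section \<open>Existence of the construction\<close>

lemma cutting_step_exists:
  fixes c :: "nat \<Rightarrow> real" and s :: "nat \<Rightarrow> nat"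
  assumes p: "p > 0" and w: "w > 0" and s: "mono s"
    and disj: "disjoint_family_on (\<lambda>i. {c i ..< c i + w}) {..<h}"
  shows "\<exists>c'. (\<forall>j<p. \<forall>i<h. c' (j * h + s j + i) = c i + real j * (w / real p)) \<and>
              disjoint_family (\<lambda>n. {c' n ..< c' n + w / real p})"
proof -
  define v where "v = w / real p"
  have v: "v > 0" and pv: "real p * v = w" using p w by (auto simp: v_def)
  have off_mono: "j * h + s j + h \<le> j' * h + s j'" if "j < j'" for j j'
  proof -
    have "Suc j * h \<le> j' * h" using that by (intro mult_le_mono1) auto
    moreover have "s j \<le> s j'" using s that by (auto simp: mono_def)
    ultimately show ?thesis by simp
  qed
  have off_inj: "j = j' \<and> i = i'"
    if "j * h + s j + i = j' * h + s j' + i'" "i < h" "i' < h" for i j i' j'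
    using off_mono[of j j'] off_mono[of j' j] that by (cases j j' rule: linorder_cases) auto
  define Q where "Q n ji \<longleftrightarrow> fst ji < p \<and> snd ji < h \<and> n = fst ji * h + s (fst ji) + snd ji"
    for n and ji :: "nat \<times> nat"
  define R where "R = (\<Sum>i<h. \<bar>c i\<bar>) + w"
  have R: "c i + w \<le> R" if "i < h" for i
  proof -
    have "c i \<le> \<bar>c i\<bar>" by simp
    also have "\<dots> \<le> (\<Sum>i<h. \<bar>c i\<bar>)" using that by (intro member_le_sum) auto
    finally show ?thesis by (simp add: R_def)
  qed
  define c' where "c' n = (if \<exists>ji. Q n ji then
      (let ji = (SOME ji. Q n ji) in c (snd ji) + real (fst ji) * v) else R + real n * v)" for n
  have col: "c' n = c i + real j * v" if "Q n (j, i)" for n i j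
  proof -
    have "Q n (SOME ji. Q n ji)" using that by (rule someI)
    hence "(SOME ji. Q n ji) = (j, i)"
      using that off_inj[of "fst (SOME ji. Q n ji)" "snd (SOME ji. Q n ji)" j i]
      unfolding Q_def fst_conv snd_conv by (intro prod_eqI) simp_all
    thus ?thesis using that by (auto simp: c'_def)
  qed
  have sub: "{c i + real j * v ..< c i + real j * v + v} \<subseteq> {c i ..< c i + w}" if "j < p" for i j
  proof -
    have "(real j + 1) * v \<le> real p * v" using that v by (intro mult_right_mono) auto
    moreover have "0 \<le> real j * v" using v by simp
    ultimately show ?thesis using pv by (auto simp: algebra_simps)
  qed
  have sep: "{r + real j * v ..< r + real j * v + v} \<inter> {r + real j' * v ..< r + real j' * v + v} = {}"
    if "j \<noteq> j'" for r :: real and j j' :: nat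
  proof -
    have "(real i + 1) * v \<le> real i' * v" if "i < i'" for i i' :: nat
      using that v by (intro mult_right_mono) auto
    from this[of j j'] this[of j' j] show ?thesis
      using that by (cases j j' rule: linorder_cases) (auto simp: algebra_simps)
  qed
  let ?I = "\<lambda>n. {c' n ..< c' n + v}"
  have mixed: "?I n \<inter> ?I m = {}" if "Q n (j, i)" "\<nexists>ji. Q m ji" for n m i j
  proof -
    have "j < p" "i < h" using that(1) by (auto simp: Q_def)
    hence "?I n \<subseteq> {c i ..< c i + w}" unfolding col[OF that(1)] by (intro sub)
    moreover have "R \<le> c' m" using that(2) v by (simp add: c'_def)
    ultimately show ?thesis using R[OF \<open>i < h\<close>] by force
  qed
  have "?I n \<inter> ?I m = {}" if nm: "n \<noteq> m" for n m
  proof (cases "\<exists>ji. Q n ji")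
    case n: True
    then obtain j i where ji: "Q n (j, i)" by auto
    show ?thesis
    proof (cases "\<exists>ji. Q m ji")
      case True
      then obtain j' i' where ji': "Q m (j', i')" by auto
      show ?thesis
      proof (cases "i = i'")
        case True
        hence "j \<noteq> j'" using nm ji ji' by (auto simp: Q_def)
        thus ?thesis using sep[of j j' "c i"] col[OF ji] col[OF ji'] True by simp
      next
        case False
        hence "{c i ..< c i + w} \<inter> {c i' ..< c i' + w} = {}"
          using disj ji ji' by (intro disjoint_family_onD[OF disj]) (auto simp: Q_def)
        moreover have "?I n \<subseteq> {c i ..< c i + w}" "?I m \<subseteq> {c i' ..< c i' + w}"
          unfolding col[OF ji] col[OF ji'] using sub ji ji' by (auto simp only: Q_def fst_conv)
        ultimately show ?thesis by blast
      qed
    next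
      case False
      thus ?thesis using mixed[OF ji] by blast
    qed
  next
    case n: False
    show ?thesis
    proof (cases "\<exists>ji. Q m ji")
      case True
      thus ?thesis using mixed n by (metis Int_commute prod.collapse)
    next
      case False
      thus ?thesis using sep[OF nm, of R] n by (simp add: c'_def)
    qed
  qed
  moreover have "c' (j * h + s j + i) = c i + real j * v" if "j < p" "i < h" for i j
    using that by (intro col) (simp add: Q_def)
  ultimately show ?thesis
    unfolding disjoint_family_on_def v_def[symmetric] by (intro exI[of _ c']) blast
qed

lemma width_Suc: "width p (Suc k) = width p k / real (p k)"
  by (simp add: width_def)

lemma width_pos: "(\<And>k. p k > 0) \<Longrightarrow> width p k > 0"
  by (auto simp: width_def intro!: divide_pos_pos prod_pos)

lemma cutting_and_stacking_exists:
  assumes p: "\<And>k. p k \<ge> 2"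
  shows "\<exists>b. cutting_and_stacking p a b"
proof -
  have p0: "p k > 0" for k using p[of k] by simp
  let ?P = "\<lambda>k c. (k = 0 \<longrightarrow> c 0 = 0) \<and>
              disjoint_family_on (\<lambda>i. {c i ..< c i + width p k}) {..<height p a k}"
  let ?Q = "\<lambda>k c c'. \<forall>j<p k. \<forall>i<height p a k.
       c' (j * height p a k + spacer_sum a k j + i) = c i + real j * width p (Suc k)"
  have "\<exists>b. \<forall>k. ?P k (b k) \<and> ?Q k (b k) (b (Suc k))"
  proof (rule dependent_nat_choice[where P = ?P and Q = ?Q])
    show "\<exists>c. ?P 0 c"
      by (intro exI[of _ "\<lambda>_. 0"]) (auto simp: disjoint_family_on_def)
  next
    fix c k assume c: "?P k c"
    have w: "width p k > 0" by (rule width_pos) (rule p0)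
    have "mono (spacer_sum a k)"
      by (auto simp: mono_def spacer_sum_def intro!: sum_mono2)
    from cutting_step_exists[OF p0[of k] w this conjunct2[OF c]]
    obtain c' where Q: "?Q k c c'"
      and "disjoint_family (\<lambda>n. {c' n ..< c' n + width p (Suc k)})"
      unfolding width_Suc by (elim exE conjE)
    hence "?P (Suc k) c'"
      using disjoint_family_on_mono[OF subset_UNIV] by (intro conjI impI) simp_all
    from conjI[OF this Q] show "\<exists>c'. ?P (Suc k) c' \<and> ?Q k c c'"
      by (rule exI[of _ c'])
  qed
  then obtain b where b: "\<forall>k. ?P k (b k) \<and> ?Q k (b k) (b (Suc k))" ..
  have 0: "b 0 0 = 0" using b[THEN spec, of 0, THEN conjunct1, THEN conjunct1] by (rule mp) (rule refl)
  have 1: "?Q k (b k) (b (Suc k))" for k by (rule conjunct2[OF b[THEN spec, of k]])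
  have 2: "disjoint_family_on (level p b k) {..<height p a k}" for k
    using b[THEN spec, of k, THEN conjunct1, THEN conjunct2] unfolding level_def[abs_def] .
  have "cutting_and_stacking p a b"
    unfolding cutting_and_stacking_def
    using 0 1 2 by (intro conjI) (assumption, rule allI, assumption, rule allI, assumption)
  thus ?thesis by (rule exI[of _ b])
qed

lemma rank_one_transformation_exists:
  assumes p: "\<And>k. p k \<ge> 2" and cs: "cutting_and_stacking p a b"
  shows "\<exists>T. rank_one_transformation p a b T"
proof -
  have p0: "p k > 0" for k using p[of k] by simp
  have disj: "i = i'"
    if "x \<in> level p b k i" "x \<in> level p b k i'" "i < height p a k" "i' < height p a k" for x k i i'
    using cs that unfolding cutting_and_stacking_def disjoint_family_on_def by blast
  let ?D = "\<lambda>x k i. Suc i < height p a k \<and> x \<in> level p b k i"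
  have lift: "\<exists>i'. ?D x (k + m) i' \<and> b (k + m) (Suc i') - b (k + m) i' = b k (Suc i) - b k i"
    if "?D x k i" for x k i m
  proof (induction m)
    case 0
    show ?case using that by auto
  next
    case (Suc m)
    define l where "l = k + m"
    obtain i' where i': "?D x l i'" and eq: "b l (Suc i') - b l i' = b k (Suc i) - b k i"
      using Suc by (auto simp: l_def)
    define v where "v = width p (Suc l)"
    have v: "v > 0" using width_pos[OF p0] by (simp add: v_def)
    have pv: "width p l = real (p l) * v" using p0[of l] by (simp add: v_def width_Suc)
    define j where "j = nat \<lfloor>(x - b l i') / v\<rfloor>"
    have x: "0 \<le> (x - b l i') / v" "(x - b l i') / v < real (p l)"
      using i' v by (auto simp: level_def pv divide_simps)
    have j: "j < p l" and j1: "real j \<le> (x - b l i') / v" and j2: "(x - b l i') / v < real j + 1"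
      using x unfolding j_def by linarith+
    let ?o = "j * height p a l + spacer_sum a l j"
    have col: "b (Suc l) (?o + r) = b l r + real j * v" if "r < height p a l" for r
      using cs j that unfolding cutting_and_stacking_def v_def by blast
    have c1: "b (Suc l) (?o + i') = b l i' + real j * v" and
         c2: "b (Suc l) (Suc (?o + i')) = b l (Suc i') + real j * v"
      using col[of i'] col[of "Suc i'"] i' by auto
    have "x \<in> level p b (Suc l) (?o + i')"
      using j1 j2 v unfolding level_def c1 v_def[symmetric] by (auto simp: field_simps)
    moreover have "Suc (?o + i') < height p a (Suc l)"
    proof -
      have "Suc j * height p a l \<le> p l * height p a l" using j by (intro mult_le_mono1) auto
      moreover have "spacer_sum a l j \<le> (\<Sum>j=1..p l. a l j)"
        using j unfolding spacer_sum_def by (intro sum_mono2) auto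
      ultimately show ?thesis using i' by simp
    qed
    ultimately have "?D x (Suc l) (?o + i') \<and>
        b (Suc l) (Suc (?o + i')) - b (Suc l) (?o + i') = b k (Suc i) - b k i"
      using c1 c2 eq by simp
    thus ?case unfolding l_def by auto
  qed
  have consistent: "b k (Suc i) - b k i = b k' (Suc i') - b k' i'"
    if D: "?D x k i" "?D x k' i'" for x k i k' i'
  proof -
    obtain r where r: "?D x (k + k') r"
        "b (k + k') (Suc r) - b (k + k') r = b k (Suc i) - b k i"
      using lift[OF D(1), of k'] by auto
    obtain r' where r': "?D x (k + k') r'"
        "b (k + k') (Suc r') - b (k + k') r' = b k' (Suc i') - b k' i'"
      using lift[OF D(2), of k] by (auto simp: add.commute)
    have "r = r'" using disj[of x "k + k'" r r'] r r' by auto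
    thus ?thesis using r r' by simp
  qed
  define T where "T x = (let ki = (SOME ki. ?D x (fst ki) (snd ki)) in
      x + (b (fst ki) (Suc (snd ki)) - b (fst ki) (snd ki)))" for x
  have "T x = x + (b k (Suc i) - b k i)" if "?D x k i" for x k i
  proof -
    have "?D x (fst (k, i)) (snd (k, i))" using that by simp
    hence "?D x (fst (SOME ki. ?D x (fst ki) (snd ki))) (snd (SOME ki. ?D x (fst ki) (snd ki)))"
      by (rule someI[where P = "\<lambda>ki. ?D x (fst ki) (snd ki)"])
    from consistent[OF this that] show ?thesis by (simp add: T_def Let_def)
  qed
  hence "rank_one_transformation p a b T" using cs by (simp add: rank_one_transformation_def)
  thus ?thesis by (rule exI[of _ T])
qed

end

theory Submission
  imports Defs "HOL-Probability.Levy"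
begin

text \<open>
  Write \<open>P\<^sub>k(z) = (\<Sum>j<p k. z ^ (j * h\<^sub>k + s\<^sub>k(j))) / \<surd>(p k)\<close>, where \<open>h\<^sub>k\<close> is the height of stack \<open>k\<close> and \<open>s\<^sub>k\<close>
  its spacer sum. The base of stack \<open>k\<close> is the union of the \<open>p k\<close> levels of stack \<open>k + 1\<close> at the
  positions \<open>j * h\<^sub>k + s\<^sub>k(j)\<close>, and all levels of a stack are translates of its base under \<open>T\<close>. So, up
  to a constant, the spectral measure \<open>\<sigma>\<^sub>k\<close> of the base of stack \<open>k\<close> satisfies
  \<open>\<sigma>\<^sub>k = \<bar>P\<^sub>k\<bar>\<^sup>2 \<sigma>\<^sub>k\<^sub>+\<^sub>1\<close>: it is a generalized Riesz product. Three facts then give the theorem.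

  \<^item> There is a constant \<open>c < 1\<close> such that every trigonometric polynomial \<open>g \<ge> 0\<close> admits arbitrarily
    large \<open>k\<close> with \<open>\<integral> g * \<bar>P\<^sub>k\<bar> \<le> c * \<integral> g\<close>, integrals with respect to Lebesgue measure on the circle
    (\<open>riesz_L1_contraction\<close>). Choosing indices one after the other, and approximating the product of
    the moduli found so far by a trigonometric polynomial, one gets finite sets \<open>K\<close> of indices for
    which \<open>Q = (\<Prod>k\<in>K. \<bar>P\<^sub>k\<bar>)\<close> has arbitrarily small integral (\<open>riesz_products_vanish\<close>).

  \<^item> The Fourier coefficients of \<open>\<sigma>\<^sub>n\<close> are nonnegative, as those of \<open>\<bar>P\<^sub>k\<bar>\<^sup>2\<close> are, so leaving out factors
    of a Riesz product does not increase its mass. Hence \<open>\<sigma>\<^sub>m = Q\<^sup>2 \<tau>\<close> with a measure \<open>\<tau>\<close> of mass at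
    most 1, and \<open>\<sigma>\<^sub>m {Q < \<delta>} \<le> \<delta>\<^sup>2\<close> (\<open>base_spectrum_bound\<close>), while \<open>{Q \<ge> \<delta>}\<close> has Lebesgue measure at
    most \<open>\<integral> Q / \<delta>\<close>. So \<open>\<sigma>\<^sub>m\<close> is concentrated on sets of arbitrarily small Lebesgue measure.

  \<^item> Functions that are constant on the levels of one stack and vanish off it are dense in \<open>L\<^sup>2\<close>
    (\<open>L2_approximable\<close>). The spectral measure of such a function has a bounded density with respect to
    some \<open>\<sigma>\<^sub>k\<close>, and spectral measures depend continuously on the function.

  The first fact is where the hypotheses on the spacers enter. They imply \<open>s\<^sub>k(j+1) \<ge> 3 * s\<^sub>k(j)\<close> and
  \<open>s\<^sub>k(j) < h\<^sub>k / 6\<close> for \<open>j < p k\<close>. By the second inequality, a sum of up to three frequencies of \<open>P\<^sub>k\<close> minus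
  up to three others is far from 0 unless the multiples of \<open>h\<^sub>k\<close> in it cancel. Suppose first that
  \<open>p k\<close> tends to infinity. Let \<open>d\<close> be the degree of \<open>g\<close>. The columns with \<open>s\<^sub>k(j) = 0\<close> form a
  Dirichlet kernel in \<open>z ^ h\<^sub>k\<close>, whose \<open>L\<^sup>1\<close> norm is \<open>o(\<surd>p k)\<close>; those with \<open>0 < s\<^sub>k(j) \<le> 3 * d\<close> are at most
  \<open>3 * d\<close> in number; and for the sum over the other \<open>N\<close> columns, lacunarity makes the moments of order
  2, 4 and 6 with respect to \<open>g\<close> equal, up to the factor \<open>\<integral> g\<close>, to those of a sum of \<open>N\<close> independent
  uniform phases. These moments exclude that the modulus is nearly constant, which gives an \<open>L\<^sup>1\<close> norm of at most \<open>63/64 * \<surd>N\<close> times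
  the integral of \<open>g\<close>. If \<open>p k\<close> does not tend to infinity, it takes some value infinitely often, and
  for this value the two extreme frequencies of \<open>\<bar>P\<^sub>k\<bar>\<^sup>2\<close> already keep \<open>\<bar>P\<^sub>k\<bar>\<close> away from being constant.

  The spectral measures themselves come from Herglotz' theorem, which is derived here from Helly's
  selection theorem on the line.
\<close>

section \<open>Trigonometric polynomials on the circle\<close>

abbreviation unit_circle :: "complex set" where
  "unit_circle \<equiv> sphere 0 1"

text \<open>
  The second argument is a trigonometric polynomial with frequencies in \<open>S\<close>; only its values on the
  circle matter. The inductive form reduces statements that are linear in the function to monomials.
\<close>

inductive trig :: "int set \<Rightarrow> (complex \<Rightarrow> complex) \<Rightarrow> bool" for S where
  trig_zero: "(\<And>z. z \<in> unit_circle \<Longrightarrow> F z = 0) \<Longrightarrow> trig S F"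
| trig_step: "trig S G \<Longrightarrow> n \<in> S \<Longrightarrow> (\<And>z. z \<in> unit_circle \<Longrightarrow> F z = G z + c * z powi n) \<Longrightarrow> trig S F"

lemma trig_cong: "trig S F \<Longrightarrow> (\<And>z. z \<in> unit_circle \<Longrightarrow> F z = G z) \<Longrightarrow> trig S G"
proof (induction arbitrary: G rule: trig.induct)
  case (trig_zero F)
  then show ?case by (metis trig.trig_zero)
next
  case (trig_step H n F c)
  have "trig S H" using trig_step.IH by simp
  then show ?case
    using trig_step.hyps trig_step.prems by (intro trig.trig_step[of S H n G c]) auto
qed

lemma trig_mono: "trig S F \<Longrightarrow> S \<subseteq> S' \<Longrightarrow> trig S' F"
proof (induction rule: trig.induct)
  case (trig_zero F)
  then show ?case by (intro trig.trig_zero)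
next
  case (trig_step H n F c)
  show ?case
    by (rule trig.trig_step[OF trig_step.IH[OF trig_step.prems] subsetD[OF trig_step.prems trig_step.hyps(2)]
          trig_step.hyps(3)])
qed

lemma trig_add: "trig S F \<Longrightarrow> trig S G \<Longrightarrow> trig S (\<lambda>z. F z + G z)"
proof (induction rule: trig.induct)
  case (trig_zero F)
  from \<open>trig S G\<close> show ?case by (rule trig_cong) (simp only: trig_zero.hyps add_0)
next
  case (trig_step H n F c)
  show ?case
    by (rule trig.trig_step[OF trig_step.IH[OF trig_step.prems] trig_step.hyps(2), of _ c])
       (simp only: trig_step.hyps(3) ac_simps)
qed

lemma trig_monom: "n \<in> S \<Longrightarrow> trig S (\<lambda>z. c * z powi n)"
  by (rule trig_step[OF trig_zero[of "\<lambda>_. 0"]]) auto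

lemma trig_sum: "(\<And>i. i \<in> I \<Longrightarrow> trig S (F i)) \<Longrightarrow> trig S (\<lambda>z. \<Sum>i\<in>I. F i z)"
  by (induction I rule: infinite_finite_induct) (simp_all add: trig_zero trig_add)

lemma trig_mult_monom:
  "trig S F \<Longrightarrow> (\<And>i. i \<in> S \<Longrightarrow> i + n \<in> S') \<Longrightarrow> trig S' (\<lambda>z. F z * (c * z powi n))"
proof (induction rule: trig.induct)
  case (trig_zero F)
  show ?case by (rule trig.trig_zero) (simp only: trig_zero.hyps mult_zero_left)
next
  case (trig_step H m F c')
  have *: "z powi (m + n) = z powi m * z powi n" if "z \<in> unit_circle" for z :: complex
    using that by (intro power_int_add) auto
  show ?case
    by (rule trig.trig_step[OF trig_step.IH[OF trig_step.prems] trig_step.prems[OF trig_step.hyps(2)],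
          of _ "c * c'"]) (simp_all only: trig_step.hyps(3) * algebra_simps)
qed

lemma trig_mult:
  assumes "trig S F" "trig S' G" "\<And>i j. i \<in> S \<Longrightarrow> j \<in> S' \<Longrightarrow> i + j \<in> S''"
  shows "trig S'' (\<lambda>z. F z * G z)"
  using assms(2,3)
proof (induction rule: trig.induct)
  case (trig_zero G)
  show ?case by (rule trig.trig_zero) (simp only: trig_zero.hyps mult_zero_right)
next
  case (trig_step H n G c)
  have "trig S'' (\<lambda>z. F z * (c * z powi n))"
    by (rule trig_mult_monom[OF assms(1) trig_step.prems[OF _ trig_step.hyps(2)]])
  from trig_add[OF trig_step.IH[OF trig_step.prems] this] show ?case
    by (rule trig_cong) (simp_all only: trig_step.hyps(3) distrib_left)
qed

lemma cnj_powi: "z \<in> unit_circle \<Longrightarrow> cnj (z powi n) = z powi (- n)"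
proof -
  assume z: "z \<in> unit_circle"
  have "cnj z = inverse z"
    using z by (metis dist_0_norm mem_sphere complex_cnj_cancel_iff complex_div_cnj
        divide_inverse mult_1 norm_one of_real_1 power_one div_by_1)
  thus ?thesis
    by (simp add: power_int_minus power_int_inverse)
qed

lemma circle_powi_add: "z \<in> unit_circle \<Longrightarrow> z powi (m + n) = z powi m * z powi n" for z :: complex
  by (rule power_int_add) auto

lemma circle_norm_powi: "z \<in> unit_circle \<Longrightarrow> cmod (z powi n) = 1"
  by (simp add: norm_power_int)

lemma circle_norm_sum_sq:
  assumes z: "z \<in> unit_circle"
  shows "complex_of_real ((cmod (\<Sum>j\<in>J. z powi e j))\<^sup>2) = (\<Sum>i\<in>J. \<Sum>j\<in>J. z powi (e i - e j))"
proof -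
  have "z powi (e i - e j) = z powi e i * cnj (z powi e j)" for i j
    using circle_powi_add[OF z, of "e i" "- e j"] by (simp only: cnj_powi[OF z] diff_conv_add_uminus)
  thus ?thesis by (simp only: complex_norm_square cnj_sum sum_product)
qed

lemma trig_cnj:
  "trig S F \<Longrightarrow> (\<And>i. i \<in> S \<Longrightarrow> - i \<in> S') \<Longrightarrow> trig S' (\<lambda>z. cnj (F z))"
proof (induction rule: trig.induct)
  case (trig_zero F)
  show ?case by (rule trig.trig_zero) (simp only: trig_zero.hyps complex_cnj_zero)
next
  case (trig_step H n F c)
  show ?case
    by (rule trig.trig_step[OF trig_step.IH[OF trig_step.prems] trig_step.prems[OF trig_step.hyps(2)],
          of _ "cnj c"]) (simp_all only: trig_step.hyps(3) cnj_powi complex_cnj_add complex_cnj_mult)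
qed

lemma trig_const: "0 \<in> S \<Longrightarrow> trig S (\<lambda>_. c)"
  using trig_monom[of 0 S c] by simp

lemma trig_UNIV_mult: "trig UNIV F \<Longrightarrow> trig UNIV G \<Longrightarrow> trig UNIV (\<lambda>z. F z * G z)"
  by (erule (1) trig_mult) simp

lemma trig_cmult: "trig S F \<Longrightarrow> trig S (\<lambda>z. c * F z)"
  using trig_mult_monom[of S F 0 S c] by (simp add: mult.commute)

lemma trig_bounded_freq: "trig UNIV F \<Longrightarrow> \<exists>d::nat. trig {- int d..int d} F"
proof (induction rule: trig.induct)
  case (trig_zero F)
  show ?case by (intro exI trig.trig_zero) (simp only: trig_zero.hyps)
next
  case (trig_step H n F c)
  then obtain d where "trig {- int d..int d} H" by auto
  hence "trig {- int (max d (nat \<bar>n\<bar>))..int (max d (nat \<bar>n\<bar>))} H"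
    by (rule trig_mono) auto
  moreover have "n \<in> {- int (max d (nat \<bar>n\<bar>))..int (max d (nat \<bar>n\<bar>))}" by auto
  ultimately have "trig {- int (max d (nat \<bar>n\<bar>))..int (max d (nat \<bar>n\<bar>))} F"
    by (rule trig.trig_step) (rule trig_step.hyps(3))
  thus ?case by blast
qed

lemma continuous_on_powi: "continuous_on unit_circle (\<lambda>z::complex. z powi n)"
  by (intro continuous_intros) auto

lemma trig_continuous: "trig S F \<Longrightarrow> continuous_on unit_circle F"
proof (induction rule: trig.induct)
  case (trig_zero F)
  show ?case
    by (rule continuous_on_cong[THEN iffD2, OF refl _ continuous_on_const[of _ 0]])
       (simp only: trig_zero.hyps)
next
  case (trig_step H n F c)
  have "continuous_on unit_circle (\<lambda>z. H z + c * z powi n)"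
    by (intro continuous_intros trig_step continuous_on_powi)
  then show ?case
    by (rule continuous_on_cong[THEN iffD2, OF refl _, rotated]) (simp only: trig_step.hyps(3))
qed

text \<open>
  A real linear functional on the plane has the form \<open>Re (2 * \<zeta> * z)\<close>, and \<open>cnj z = 1 / z\<close> on the
  circle.
\<close>

lemma trig_of_real_polynomial_function:
  "real_polynomial_function f \<Longrightarrow> trig UNIV (\<lambda>z. complex_of_real (f z))"
proof (induction rule: real_polynomial_function.induct)
  case (linear f)
  interpret bounded_linear f by (fact linear)
  let ?\<zeta> = "(f 1 - \<i> * f \<i>) / 2"
  have "trig UNIV (\<lambda>z. ?\<zeta> * z powi 1 + cnj ?\<zeta> * z powi (- 1))"
    by (intro trig_add trig_monom) auto
  then show ?case
  proof (rule trig_cong)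
    fix z assume z: "z \<in> unit_circle"
    have "f z = f (Re z *\<^sub>R 1 + Im z *\<^sub>R \<i>)"
      by (rule arg_cong[where f = f]) (simp add: complex_eq_iff)
    also have "\<dots> = Re z * f 1 + Im z * f \<i>" by (simp add: add scale)
    finally have fz: "f z = Re z * f 1 + Im z * f \<i>" .
    have "z powi (- 1) = cnj z" using cnj_powi[OF z, of 1] by (simp only: power_int_1_right)
    then show "?\<zeta> * z powi 1 + cnj ?\<zeta> * z powi (- 1) = complex_of_real (f z)"
      by (simp only: fz power_int_1_right) (simp add: complex_eq_iff algebra_simps diff_divide_distrib)
  qed
next
  case (const c)
  then show ?case by (intro trig_const) auto
next
  case (add f g)
  then show ?case by (simp add: trig_add)
next
  case (mult f g)
  then show ?case by (simp add: trig_UNIV_mult)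
qed

text \<open>
  On the circle, a polynomial in \<open>Re z\<close> and \<open>Im z\<close> is a trigonometric polynomial, so this is the
  Stone-Weierstrass theorem.
\<close>

lemma trig_approximation:
  fixes f :: "complex \<Rightarrow> real"
  assumes "continuous_on unit_circle f" "e > 0"
  obtains g where "trig UNIV (\<lambda>z. complex_of_real (g z))" "\<And>z. z \<in> unit_circle \<Longrightarrow> \<bar>f z - g z\<bar> < e"
  using Stone_Weierstrass_real_polynomial_function[OF compact_sphere assms]
    trig_of_real_polynomial_function by metis

section \<open>Finite measures on the circle\<close>

locale circle_measure = finite_measure \<mu> for \<mu> :: "complex measure" +
  assumes sets_circle: "sets \<mu> = sets circle_space"
begin

lemma space_circle: "space \<mu> = unit_circle"
  using sets_eq_imp_space_eq[OF sets_circle] by (simp add: circle_space_def space_restrict_space)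

lemma continuous_integrable:
  fixes F :: "complex \<Rightarrow> 'b::{banach, second_countable_topology}"
  assumes "continuous_on unit_circle F"
  shows "integrable \<mu> F"
proof -
  have "F \<in> borel_measurable circle_space"
    unfolding circle_space_def by (rule borel_measurable_continuous_on_restrict) fact
  hence m: "F \<in> borel_measurable \<mu>"
    by (simp add: measurable_cong_sets[OF sets_circle refl])
  have "bounded (F ` unit_circle)"
    by (intro compact_imp_bounded compact_continuous_image assms compact_sphere)
  then obtain B where "\<And>z. z \<in> unit_circle \<Longrightarrow> norm (F z) \<le> B"
    by (auto simp only: bounded_iff ball_simps)
  thus ?thesis
    by (intro integrable_const_bound[of _ B] m) (auto simp: space_circle)
qed

lemma integral_cong_circle:
  "(\<And>z. z \<in> unit_circle \<Longrightarrow> F z = G z) \<Longrightarrow> integral\<^sup>L \<mu> F = integral\<^sup>L \<mu> G"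
  by (rule Bochner_Integration.integral_cong) (auto simp: space_circle)

end

lemma trig_integral_zero:
  assumes "circle_measure \<mu>" "continuous_on unit_circle w"
    and "trig S F" "\<And>n. n \<in> S \<Longrightarrow> (LINT z|\<mu>. w z * z powi n) = 0"
  shows "(LINT z|\<mu>. w z * F z) = 0"
  using assms(3,4)
proof (induction rule: trig.induct)
  interpret circle_measure \<mu> by fact
  {
    case (trig_zero F)
    have "(LINT z|\<mu>. w z * F z) = (LINT z|\<mu>. 0)"
      by (rule integral_cong_circle) (simp only: trig_zero.hyps mult_zero_right)
    then show ?case by simp
  next
    case (trig_step H n F c)
    have i: "integrable \<mu> (\<lambda>z. w z * H z)" "integrable \<mu> (\<lambda>z. w z * z powi n)"
      by (intro continuous_integrable continuous_intros assms trig_continuous[OF trig_step.hyps(1)]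
          continuous_on_powi)+
    have "(LINT z|\<mu>. w z * F z) = (LINT z|\<mu>. w z * H z + c * (w z * z powi n))"
      by (rule integral_cong_circle) (simp only: trig_step.hyps(3) algebra_simps)
    also have "\<dots> = (LINT z|\<mu>. w z * H z) + c * (LINT z|\<mu>. w z * z powi n)"
      using i by simp
    finally show ?case using trig_step by simp
  }
qed

lemma circle_lebesgue_measurable:
  "(\<lambda>t. cis (2 * pi * t)) \<in> restrict_space lborel {0..<1} \<rightarrow>\<^sub>M circle_space"
  unfolding circle_space_def
  by (intro measurable_restrict_space2 measurable_restrict_space1) (auto simp: cis_conv_exp)

lemma prob_space_circle_lebesgue: "prob_space circle_lebesgue"
  unfolding circle_lebesgue_def
  by (rule prob_space.prob_space_distr[OF _ circle_lebesgue_measurable])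
     (auto intro!: prob_spaceI simp: space_restrict_space emeasure_restrict_space)

interpretation Leb: prob_space circle_lebesgue by (rule prob_space_circle_lebesgue)

interpretation Leb: circle_measure circle_lebesgue
  by standard (simp add: circle_lebesgue_def)

lemma integral_circle_lebesgue:
  fixes F :: "complex \<Rightarrow> 'b::{banach, second_countable_topology}"
  assumes "F \<in> borel_measurable circle_space"
  shows "integral\<^sup>L circle_lebesgue F = (LINT t:{0..1}|lborel. F (cis (2 * pi * t)))"
proof -
  have "integral\<^sup>L circle_lebesgue F = (LINT t|restrict_space lborel {0..<1}. F (cis (2 * pi * t)))"
    unfolding circle_lebesgue_def by (rule integral_distr[OF circle_lebesgue_measurable assms])
  also have "\<dots> = (LINT t:{0..<1}|lborel. F (cis (2 * pi * t)))"
    by (subst integral_restrict_space) (auto simp: set_lebesgue_integral_def)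
  also have "\<dots> = (LINT t:{0..1}|lborel. F (cis (2 * pi * t)))"
    unfolding set_lebesgue_integral_def
  proof (rule integral_discrete_difference[of "{1}"])
    show "indicat_real {0..<1} x *\<^sub>R F (cis (2 * pi * x)) = indicat_real {0..1} x *\<^sub>R F (cis (2 * pi * x))"
      if "x \<notin> {1}" for x :: real
      using that by (auto simp: indicator_def)
  qed auto
  finally show ?thesis .
qed

lemma integral_cis: 
  "(LINT t:{0..1}|lborel. cis (2 * pi * t) powi n) = (if n = 0 then 1 else 0)"
proof (cases "n = 0")
  case True
  then show ?thesis by (simp add: set_lebesgue_integral_def)
next
  case False
  let ?F = "\<lambda>t. cis (2 * pi * n * t) / (\<i> * (2 * pi * n))"
  have eq: "cis (2 * pi * t) powi n = cis (2 * pi * n * t)" for t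
    by (simp add: Complex.cis_power_int mult.commute mult.left_commute)
  have "(?F has_vector_derivative cis (2 * pi * n * t)) (at t within A)" for t A
  proof -
    let ?c = "\<i> * (2 * pi * n)"
    have "((\<lambda>w. exp (?c * w) / ?c) has_field_derivative exp (?c * of_real t)) (at (of_real t))"
      using False by (auto intro!: derivative_eq_intros)
    from has_vector_derivative_real_field[OF this, of A] show ?thesis
      by (simp add: cis_conv_exp mult.assoc)
  qed
  hence "(LINT t|lborel. indicator {0..1} t *\<^sub>R cis (2 * pi * n * t)) = ?F 1 - ?F 0"
    by (intro integral_FTC_atLeastAtMost continuous_intros) auto
  moreover have "cis (2 * pi * n) = 1"
    using cis_multiple_2pi[of "of_int n"] by (simp add: mult.commute mult.left_commute)
  ultimately show ?thesis using False by (simp add: set_lebesgue_integral_def eq)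
qed

lemma integral_circle_lebesgue_powi:
  "(LINT z|circle_lebesgue. z powi n) = (if n = 0 then 1 else 0)"
proof -
  have "(\<lambda>z::complex. z powi n) \<in> borel_measurable circle_space"
    unfolding circle_space_def
    by (intro borel_measurable_continuous_on_restrict continuous_on_powi)
  thus ?thesis by (simp add: integral_circle_lebesgue integral_cis)
qed

section \<open>Integrals against a trigonometric weight\<close>

text \<open>
  A nonnegative trigonometric polynomial serves as a weight. It plays the role of the product of the
  factors chosen so far: with respect to it, monomials of degree above \<open>d\<close> have mean 0.
\<close>

locale trig_weight =
  fixes g :: "complex \<Rightarrow> real" and d :: nat
  assumes trig_g: "trig {- int d..int d} (\<lambda>z. complex_of_real (g z))"
    and g_nonneg: "z \<in> unit_circle \<Longrightarrow> 0 \<le> g z"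
begin

definition W :: "(complex \<Rightarrow> real) \<Rightarrow> real" where
  "W F = (LINT z|circle_lebesgue. g z * F z)"

definition CW :: "(complex \<Rightarrow> complex) \<Rightarrow> complex" where
  "CW F = (LINT z|circle_lebesgue. complex_of_real (g z) * F z)"

lemma continuous_g: "continuous_on unit_circle g"
  using continuous_on_Re[OF trig_continuous[OF trig_g]] by simp

lemma W_integrable:
  "continuous_on unit_circle F \<Longrightarrow> integrable circle_lebesgue (\<lambda>z. g z * F z)"
  by (intro Leb.continuous_integrable continuous_intros continuous_g)

lemma CW_integrable:
  "continuous_on unit_circle F \<Longrightarrow> integrable circle_lebesgue (\<lambda>z. complex_of_real (g z) * F z)"
  by (intro Leb.continuous_integrable continuous_intros continuous_g)

lemma W_cong: "(\<And>z. z \<in> unit_circle \<Longrightarrow> F z = G z) \<Longrightarrow> W F = W G"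
  unfolding W_def by (rule Leb.integral_cong_circle) simp

lemma CW_cong: "(\<And>z. z \<in> unit_circle \<Longrightarrow> F z = G z) \<Longrightarrow> CW F = CW G"
  unfolding CW_def by (rule Leb.integral_cong_circle) simp

lemma W_mono:
  assumes "continuous_on unit_circle F" "continuous_on unit_circle G"
    and "\<And>z. z \<in> unit_circle \<Longrightarrow> F z \<le> G z"
  shows "W F \<le> W G"
  unfolding W_def using assms
  by (intro integral_mono W_integrable mult_left_mono g_nonneg) (auto simp: Leb.space_circle)

lemma W_add:
  "continuous_on unit_circle F \<Longrightarrow> continuous_on unit_circle G \<Longrightarrow> W (\<lambda>z. F z + G z) = W F + W G"
  unfolding W_def by (simp add: distrib_left W_integrable)

lemma W_diff:
  "continuous_on unit_circle F \<Longrightarrow> continuous_on unit_circle G \<Longrightarrow> W (\<lambda>z. F z - G z) = W F - W G"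
  unfolding W_def by (simp add: right_diff_distrib W_integrable)

lemma W_cmult: "W (\<lambda>z. c * F z) = c * W F"
  unfolding W_def by (simp add: mult.left_commute)

lemma W_const: "W (\<lambda>_. c) = c * W (\<lambda>_. 1)"
  using W_cmult[of c "\<lambda>_. 1"] by simp

lemma W_sum:
  "(\<And>i. i \<in> I \<Longrightarrow> continuous_on unit_circle (F i)) \<Longrightarrow> W (\<lambda>z. \<Sum>i\<in>I. F i z) = (\<Sum>i\<in>I. W (F i))"
  unfolding W_def by (simp add: sum_distrib_left W_integrable)

lemma CW_sum:
  "(\<And>i. i \<in> I \<Longrightarrow> continuous_on unit_circle (F i)) \<Longrightarrow> CW (\<lambda>z. \<Sum>i\<in>I. F i z) = (\<Sum>i\<in>I. CW (F i))"
  unfolding CW_def by (simp add: sum_distrib_left CW_integrable)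

lemma CW_cmult: "CW (\<lambda>z. c * F z) = c * CW F"
  unfolding CW_def by (simp add: mult.left_commute)

lemma CW_of_real: "CW (\<lambda>z. complex_of_real (F z)) = complex_of_real (W F)"
  unfolding CW_def W_def by (simp flip: of_real_mult)

lemma CW_cnj: "CW (\<lambda>z. cnj (F z)) = cnj (CW F)"
  unfolding CW_def by (subst Bochner_Integration.integral_cnj[symmetric]) simp

lemma W_Re: "continuous_on unit_circle F \<Longrightarrow> W (\<lambda>z. Re (F z)) = Re (CW F)"
  unfolding W_def CW_def by (subst integral_Re[symmetric]) (simp_all add: CW_integrable)

lemma W_one_nonneg: "0 \<le> W (\<lambda>_. 1)"
  unfolding W_def by (rule integral_nonneg_AE) (auto intro!: AE_I2 g_nonneg simp: Leb.space_circle)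

lemma CW_powi: "\<bar>n\<bar> > int d \<Longrightarrow> CW (\<lambda>z. z powi n) = 0"
proof -
  assume n: "\<bar>n\<bar> > int d"
  have "(LINT z|circle_lebesgue. z powi n * complex_of_real (g z)) = 0"
  proof (rule trig_integral_zero[OF _ continuous_on_powi trig_g])
    fix i assume i: "i \<in> {- int d..int d}"
    have "(LINT z|circle_lebesgue. z powi n * z powi i) = (LINT z|circle_lebesgue. z powi (n + i))"
      by (rule Leb.integral_cong_circle) (simp only: circle_powi_add)
    also have "\<dots> = 0"
    proof -
      have "n + i \<noteq> 0" using n i by (simp only: atLeastAtMost_iff) linarith
      thus ?thesis by (simp only: integral_circle_lebesgue_powi if_False)
    qed
    finally show "(LINT z|circle_lebesgue. z powi n * z powi i) = 0" .
  qed unfold_locales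
  thus ?thesis by (simp add: CW_def mult.commute)
qed

lemma CW_trig: "trig S F \<Longrightarrow> (\<And>n. n \<in> S \<Longrightarrow> \<bar>n\<bar> > int d) \<Longrightarrow> CW F = 0"
  unfolding CW_def
proof (rule trig_integral_zero)
  show "continuous_on unit_circle (\<lambda>z. complex_of_real (g z))"
    by (intro continuous_intros continuous_g)
  show "(LINT z|circle_lebesgue. complex_of_real (g z) * z powi n) = 0"
    if "n \<in> S" "\<And>n. n \<in> S \<Longrightarrow> \<bar>n\<bar> > int d" for n
    using CW_powi[of n] that by (simp add: CW_def)
qed unfold_locales

text \<open>
  Exponentials whose frequencies differ by more than \<open>d\<close> are orthogonal with respect to the weight.
\<close>

lemma W_norm_sq:
  assumes J: "finite J" and sep: "\<And>i j. i \<in> J \<Longrightarrow> j \<in> J \<Longrightarrow> i \<noteq> j \<Longrightarrow> \<bar>e i - e j\<bar> > int d"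
  shows "W (\<lambda>z. (cmod (\<Sum>j\<in>J. z powi e j))\<^sup>2) = card J * W (\<lambda>_. 1)"
proof -
  have "complex_of_real (W (\<lambda>z. (cmod (\<Sum>j\<in>J. z powi e j))\<^sup>2))
      = CW (\<lambda>z. \<Sum>i\<in>J. \<Sum>j\<in>J. z powi (e i - e j))"
    unfolding CW_of_real[symmetric]
    by (rule CW_cong) (rule circle_norm_sum_sq)
  also have "\<dots> = (\<Sum>i\<in>J. \<Sum>j\<in>J. CW (\<lambda>z. z powi (e i - e j)))"
    by (simp add: CW_sum continuous_on_sum continuous_on_powi)
  also have "\<dots> = (\<Sum>i\<in>J. \<Sum>j\<in>J. if i = j then complex_of_real (W (\<lambda>_. 1)) else 0)"
    using sep CW_of_real[of "\<lambda>_. 1"] by (intro sum.cong refl) (auto simp: CW_powi)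
  also have "\<dots> = complex_of_real (card J * W (\<lambda>_. 1))"
    using J by (simp add: sum.delta)
  finally show ?thesis by (simp only: of_real_eq_iff)
qed

text \<open>
  Cauchy-Schwarz, from \<open>2 * u * v \<le> r * u\<^sup>2 + v\<^sup>2 / r\<close> with the optimal constant \<open>r\<close>.
\<close>

lemma W_product_le:
  assumes c: "continuous_on unit_circle F" "continuous_on unit_circle G"
    and F: "W (\<lambda>z. (F z)\<^sup>2) \<le> \<alpha> * W (\<lambda>_. 1)" and G: "W (\<lambda>z. (G z)\<^sup>2) \<le> \<beta> * W (\<lambda>_. 1)"
    and pos: "\<alpha> > 0" "\<beta> > 0"
  shows "W (\<lambda>z. F z * G z) \<le> sqrt (\<alpha> * \<beta>) * W (\<lambda>_. 1)"
proof -
  define r where "r = sqrt \<beta> / sqrt \<alpha>"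
  have r: "r > 0" using pos by (simp add: r_def)
  have "F z * G z \<le> (r / 2) * (F z)\<^sup>2 + (1 / (2 * r)) * (G z)\<^sup>2" for z
  proof -
    have "0 \<le> (r * F z - G z)\<^sup>2" by simp
    hence "2 * r * (F z * G z) \<le> r\<^sup>2 * (F z)\<^sup>2 + (G z)\<^sup>2"
      by (simp add: power2_eq_square algebra_simps)
    thus ?thesis using r by (simp add: field_simps power2_eq_square)
  qed
  hence "W (\<lambda>z. F z * G z) \<le> W (\<lambda>z. (r / 2) * (F z)\<^sup>2 + (1 / (2 * r)) * (G z)\<^sup>2)"
    by (intro W_mono continuous_intros c)
  also have "\<dots> = (r / 2) * W (\<lambda>z. (F z)\<^sup>2) + (1 / (2 * r)) * W (\<lambda>z. (G z)\<^sup>2)"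
    using r by (subst W_add) (auto intro!: continuous_intros c simp only: W_cmult)
  also have "\<dots> \<le> (r / 2) * (\<alpha> * W (\<lambda>_. 1)) + (1 / (2 * r)) * (\<beta> * W (\<lambda>_. 1))"
    using r by (intro add_mono mult_left_mono F G) auto
  also have "\<dots> = (r / 2 * \<alpha> + \<beta> / (2 * r)) * W (\<lambda>_. 1)"
    by (simp add: algebra_simps)
  also have "r / 2 * \<alpha> + \<beta> / (2 * r) = sqrt (\<alpha> * \<beta>)"
  proof -
    have a: "\<alpha> = (sqrt \<alpha>)\<^sup>2" "\<beta> = (sqrt \<beta>)\<^sup>2" using pos by auto
    show ?thesis unfolding r_def real_sqrt_mult
      by (subst (3) a(1), subst (4) a(2)) (use pos in \<open>simp add: power2_eq_square field_simps\<close>)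
  qed
  finally show ?thesis .
qed

lemma W_le_sqrt:
  assumes "continuous_on unit_circle F" "W (\<lambda>z. (F z)\<^sup>2) \<le> \<alpha> * W (\<lambda>_. 1)" "\<alpha> > 0"
  shows "W F \<le> sqrt \<alpha> * W (\<lambda>_. 1)"
  using W_product_le[OF assms(1) continuous_on_const assms(2), of 1 1] assms(3) by simp

lemma W_exponential_sum_le:
  assumes J: "finite J" and sep: "\<And>i j. i \<in> J \<Longrightarrow> j \<in> J \<Longrightarrow> i \<noteq> j \<Longrightarrow> \<bar>e i - e j\<bar> > int d"
  shows "W (\<lambda>z. cmod (\<Sum>j\<in>J. z powi e j)) \<le> sqrt (card J) * W (\<lambda>_. 1)"
proof (cases "J = {}")
  case True
  then show ?thesis by (simp add: W_def)
next
  case False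
  then show ?thesis using J
    by (intro W_le_sqrt)
       (auto intro!: continuous_intros simp: W_norm_sq[OF J sep] card_gt_0_iff)
qed

end

section \<open>Frequencies with lacunary spacers\<close>

text \<open>
  The frequencies of a product of factors \<open>z ^ (j * h + s j)\<close> and their conjugates. The multiple of \<open>h\<close>
  is not tracked: only the combination of the numbers \<open>s j\<close> has to be estimated.
\<close>

definition band :: "int \<Rightarrow> int \<Rightarrow> int \<Rightarrow> int set" where
  "band h lo hi = {m * h + s |m s. lo \<le> s \<and> s \<le> hi}"

lemma bandI: "lo \<le> s \<Longrightarrow> s \<le> hi \<Longrightarrow> m * h + s \<in> band h lo hi"
  by (auto simp: band_def)

lemma band_add:
  "i \<in> band h lo hi \<Longrightarrow> j \<in> band h lo' hi' \<Longrightarrow> i + j \<in> band h (lo + lo') (hi + hi')"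
proof -
  assume "i \<in> band h lo hi" "j \<in> band h lo' hi'"
  then obtain m s m' s' where "i = m * h + s" "lo \<le> s" "s \<le> hi" "j = m' * h + s'" "lo' \<le> s'" "s' \<le> hi'"
    unfolding band_def by blast
  thus ?thesis using bandI[of "lo + lo'" "s + s'" "hi + hi'" "m + m'" h] by (simp add: algebra_simps)
qed

lemma band_uminus: "i \<in> band h lo hi \<Longrightarrow> - i \<in> band h (- hi) (- lo)"
proof -
  assume "i \<in> band h lo hi"
  then obtain m s where "i = m * h + s" "lo \<le> s" "s \<le> hi" unfolding band_def by blast
  thus ?thesis using bandI[of "- hi" "- s" "- lo" "- m" h] by simp
qed

lemma trig_band_power:
  assumes "trig (band h lo hi) F"
  shows "trig (band h (int a * lo) (int a * hi)) (\<lambda>z. F z ^ a)"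
proof (induction a)
  case 0
  show ?case using bandI[of 0 0 0 0 h] by (auto intro!: trig_const)
next
  case (Suc a)
  have "trig (band h (int (Suc a) * lo) (int (Suc a) * hi)) (\<lambda>z. F z * F z ^ a)"
    by (rule trig_mult[OF assms Suc]) (auto dest: band_add simp: algebra_simps)
  thus ?case by simp
qed

lemma trig_band_cnj: "trig (band h lo hi) F \<Longrightarrow> trig (band h (- hi) (- lo)) (\<lambda>z. cnj (F z))"
  by (rule trig_cnj) (auto dest: band_uminus)

text \<open>
  If \<open>m \<ge> 1\<close> then \<open>m * h + s \<ge> h / 2 > d\<close>; if \<open>m \<le> 0\<close> then \<open>m * h + s \<le> s < - d\<close>.
\<close>

lemma band_avoids:
  assumes "n \<in> band h lo hi" "hi < - d" "- h \<le> 2 * lo" "2 * d < h" "0 \<le> d"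
  shows "d < \<bar>n\<bar>"
proof -
  obtain m s where n: "n = m * h + s" "lo \<le> s" "s \<le> hi" using assms(1) unfolding band_def by blast
  show ?thesis
  proof (cases "m \<ge> 1")
    case True
    hence "1 * h \<le> m * h" using assms by (intro mult_right_mono) auto
    thus ?thesis using n assms by linarith
  next
    case False
    hence "m * h \<le> 0" using assms by (intro mult_nonpos_nonneg) auto
    thus ?thesis using n assms by linarith
  qed
qed

text \<open>
  One factor \<open>P\<^sub>k\<close>, up to normalization, is the sum of \<open>z ^ (j * h + s j)\<close> over \<open>j < p\<close>. The height \<open>h\<close>
  exceeds twice the degree of the weight.
\<close>

locale lacunary_sum = trig_weight g d for g d +
  fixes h :: nat and s :: "nat \<Rightarrow> nat" and p :: nat
  assumes s_lacunary: "\<And>j. Suc j < p \<Longrightarrow> 3 * s j \<le> s (Suc j)"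
    and s_small: "\<And>j. j < p \<Longrightarrow> 6 * s j < h"
    and h_large: "2 * d < h"
begin

definition freq :: "nat \<Rightarrow> int" where
  "freq j = int j * int h + int (s j)"

lemma s_mono: "i \<le> j \<Longrightarrow> j < p \<Longrightarrow> s i \<le> s j"
proof (induction j)
  case (Suc j)
  then show ?case using s_lacunary[of j] by (cases "i = Suc j") auto
qed auto

lemma s_gap: "i < j \<Longrightarrow> j < p \<Longrightarrow> 3 * s i \<le> s j"
  using s_mono[of i "j - 1"] s_lacunary[of "j - 1"] by (cases j) auto

lemma freq_separated:
  assumes "i < p" "j < p" "i \<noteq> j"
  shows "\<bar>freq i - freq j\<bar> > int d"
proof -
  have *: "freq i - freq j > int d" if "i < p" "j < p" "j < i" for i j
  proof -
    have "(int i - int j) * int h \<ge> 1 * int h" using that by (intro mult_right_mono) auto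
    moreover have "freq i - freq j = (int i - int j) * int h + int (s i) - int (s j)"
      by (simp add: freq_def algebra_simps)
    ultimately show ?thesis using s_small[of i] s_small[of j] that h_large by linarith
  qed
  show ?thesis using *[of i j] *[of j i] assms by (cases i j rule: linorder_cases) auto
qed

subsection \<open>Moments of the lacunary part\<close>

definition partial :: "nat \<Rightarrow> nat \<Rightarrow> complex \<Rightarrow> complex" where
  "partial q n z = (\<Sum>j\<in>{q..<n}. z powi freq j)"

lemma continuous_partial: "continuous_on unit_circle (partial q n)"
  unfolding partial_def by (intro continuous_on_sum continuous_on_powi)

text \<open>
  In \<open>v\<^sup>a * cnj v\<^sup>b\<close> with \<open>b < a \<le> 3\<close>, the new exponential occurs with net power \<open>a - b\<close> and is too
  high to be cancelled by the earlier ones: their contribution is at most \<open>a * s n / 3 - b * (3 * d + 1)\<close>.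
  If \<open>a = 3\<close> and \<open>b = 2\<close>, the first term equals \<open>s n\<close> in the worst case, and the margin comes from
  \<open>s j > 3 * d\<close> alone; this is why the columns with smaller \<open>s j\<close> are treated separately.
\<close>

lemma mixed_moment_zero:
  assumes q: "\<And>j. q \<le> j \<Longrightarrow> j < p \<Longrightarrow> 3 * d < s j" and n: "q \<le> n" "n < p"
    and ab: "b < a" "a \<le> 3"
  defines "v \<equiv> \<lambda>z. partial q n z * cnj (z powi freq n)"
  shows "CW (\<lambda>z. v z ^ a * cnj (v z) ^ b) = 0"
proof -
  define y where "y = int (s n)"
  define Y where "Y = y div 3"
  define lo where "lo = 3 * int d + 1 - y"
  define hi where "hi = Y - y"
  have Y: "3 * Y \<le> y" unfolding Y_def by presburger
  have y: "3 * int d + 1 \<le> y" "6 * y < int h"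
    using q[of n] n s_small[of n] by (auto simp: y_def)
  have A: "trig (band h (3 * int d + 1) Y) (partial q n)"
    unfolding partial_def
  proof (rule trig_sum)
    fix j assume j: "j \<in> {q..<n}"
    have "3 * int (s j) \<le> y" using s_gap[of j n] j n by (simp add: y_def)
    hence "int (s j) \<le> Y" unfolding Y_def by presburger
    moreover have "3 * int d + 1 \<le> int (s j)" using q[of j] j n by auto
    ultimately have "freq j \<in> band h (3 * int d + 1) Y"
      unfolding freq_def by (intro bandI)
    thus "trig (band h (3 * int d + 1) Y) (\<lambda>z. z powi freq j)"
      using trig_monom[of "freq j" _ 1] by simp
  qed
  have "freq n \<in> band h y y" unfolding freq_def y_def by (rule bandI) auto
  hence "trig (band h y y) (\<lambda>z. z powi freq n)" using trig_monom[of "freq n" _ 1] by simp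
  note x = trig_band_cnj[OF this]
  have v: "trig (band h lo hi) v"
    unfolding v_def
  proof (rule trig_mult[OF A x])
    show "i + j \<in> band h lo hi" if "i \<in> band h (3 * int d + 1) Y" "j \<in> band h (- y) (- y)" for i j
      using band_add[OF that] by (simp only: lo_def hi_def diff_conv_add_uminus)
  qed
  have "trig (band h (int a * lo + int b * (- hi)) (int a * hi + int b * (- lo))) (\<lambda>z. v z ^ a * cnj (v z) ^ b)"
    by (rule trig_mult[OF trig_band_power[OF v] trig_band_power[OF trig_band_cnj[OF v]]])
       (auto dest: band_add)
  moreover have "int a * hi + int b * (- lo) < - int d \<and> - int h \<le> 2 * (int a * lo + int b * (- hi))"
  proof -
    have "a = 1 \<and> b = 0 \<or> a = 2 \<and> b = 0 \<or> a = 2 \<and> b = 1 \<or> a = 3 \<and> b = 0 \<or> a = 3 \<and> b = 1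
        \<or> a = 3 \<and> b = 2" using ab by auto
    thus ?thesis using Y y unfolding hi_def lo_def
      by (elim disjE; elim conjE; hypsubst; intro conjI; simp; linarith)
  qed
  ultimately show ?thesis
    using h_large by (elim CW_trig) (auto intro: band_avoids)
qed

text \<open>
  If \<open>A\<close> is the old sum, \<open>x\<close> the new exponential and \<open>v = A * cnj x\<close>, then \<open>\<bar>A + x\<bar> = \<bar>1 + v\<bar>\<close>, so
  \<open>\<bar>A + x\<bar>\<^sup>2\<^sup>m = (1 + v)\<^sup>m * cnj (1 + v)\<^sup>m\<close>, and only the diagonal terms of the binomial expansion survive.
\<close>

lemma moment_step:
  assumes q: "\<And>j. q \<le> j \<Longrightarrow> j < p \<Longrightarrow> 3 * d < s j" and n: "q \<le> n" "n < p" and m: "m \<le> 3"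
  shows "W (\<lambda>z. cmod (partial q (Suc n) z) ^ (2 * m))
       = (\<Sum>a\<le>m. real ((m choose a)\<^sup>2) * W (\<lambda>z. cmod (partial q n z) ^ (2 * a)))"
proof -
  define v where "v = (\<lambda>z. partial q n z * cnj (z powi freq n))"
  have cont_v: "continuous_on unit_circle v"
    unfolding v_def by (intro continuous_intros continuous_partial continuous_on_powi)
  have norm_v: "cmod (v z) = cmod (partial q n z)" if "z \<in> unit_circle" for z
    using circle_norm_powi[OF that] by (simp only: v_def norm_mult complex_mod_cnj mult_1_right)
  have norm_Suc: "cmod (partial q (Suc n) z) = cmod (1 + v z)" if z: "z \<in> unit_circle" for z
  proof -
    have x: "cmod (z powi freq n) = 1" by (rule circle_norm_powi[OF z])
    have "partial q (Suc n) z = partial q n z + z powi freq n"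
      using n by (simp add: partial_def)
    also have "\<dots> = z powi freq n * (1 + v z)"
      using complex_norm_square[of "z powi freq n"]
      by (simp only: x v_def) (simp add: algebra_simps)
    finally show ?thesis by (simp only: norm_mult x mult_1_left)
  qed
  have diag: "CW (\<lambda>z. v z ^ a * cnj (v z) ^ a) = W (\<lambda>z. cmod (partial q n z) ^ (2 * a))" for a
  proof -
    have "CW (\<lambda>z. v z ^ a * cnj (v z) ^ a) = CW (\<lambda>z. complex_of_real (cmod (partial q n z) ^ (2 * a)))"
    proof (rule CW_cong)
      fix z :: complex assume z: "z \<in> unit_circle"
      have "v z ^ a * cnj (v z) ^ a = complex_of_real ((cmod (v z))\<^sup>2) ^ a"
        by (simp only: complex_norm_square power_mult_distrib)
      thus "v z ^ a * cnj (v z) ^ a = complex_of_real (cmod (partial q n z) ^ (2 * a))"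
        by (simp only: norm_v[OF z] power_mult of_real_power)
    qed
    thus ?thesis by (simp only: CW_of_real)
  qed
  have off: "CW (\<lambda>z. v z ^ a * cnj (v z) ^ b) = 0" if "a \<noteq> b" "a \<le> m" "b \<le> m" for a b
  proof (cases "b < a")
    case True
    then show ?thesis using mixed_moment_zero[OF q n] that m by (simp add: v_def)
  next
    case False
    hence "CW (\<lambda>z. v z ^ b * cnj (v z) ^ a) = 0"
      using mixed_moment_zero[OF q n, of a b] that m by (simp add: v_def)
    moreover have "CW (\<lambda>z. v z ^ a * cnj (v z) ^ b) = cnj (CW (\<lambda>z. v z ^ b * cnj (v z) ^ a))"
      by (subst CW_cnj[symmetric]) (simp add: mult.commute)
    ultimately show ?thesis by simp
  qed
  have "complex_of_real (W (\<lambda>z. cmod (partial q (Suc n) z) ^ (2 * m)))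
      = CW (\<lambda>z. \<Sum>a\<le>m. \<Sum>b\<le>m. of_nat (m choose a) * of_nat (m choose b) * (v z ^ a * cnj (v z) ^ b))"
    unfolding CW_of_real[symmetric]
  proof (rule CW_cong)
    fix z :: complex assume z: "z \<in> unit_circle"
    have "complex_of_real (cmod (partial q (Suc n) z) ^ (2 * m)) = (1 + v z) ^ m * (1 + cnj (v z)) ^ m"
      unfolding norm_Suc[OF z] power_mult of_real_power complex_norm_square power_mult_distrib[symmetric]
      using complex_norm_square[of "1 + v z"] by simp
    also have "\<dots> = (\<Sum>a\<le>m. \<Sum>b\<le>m. of_nat (m choose a) * of_nat (m choose b) * (v z ^ a * cnj (v z) ^ b))"
      unfolding add.commute[of 1] binomial_ring sum_product
      by (intro sum.cong refl) (simp add: algebra_simps)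
    finally show "complex_of_real (cmod (partial q (Suc n) z) ^ (2 * m)) = \<dots>" .
  qed
  also have "\<dots> = (\<Sum>a\<le>m. \<Sum>b\<le>m. of_nat (m choose a) * of_nat (m choose b) * CW (\<lambda>z. v z ^ a * cnj (v z) ^ b))"
    by (simp add: CW_sum CW_cmult continuous_intros cont_v)
  also have "\<dots> = (\<Sum>a\<le>m. \<Sum>b\<le>m. if a = b then
      complex_of_real (real ((m choose a)\<^sup>2) * W (\<lambda>z. cmod (partial q n z) ^ (2 * a))) else 0)"
    by (intro sum.cong refl) (auto simp: off diag power2_eq_square)
  also have "\<dots> = complex_of_real (\<Sum>a\<le>m. real ((m choose a)\<^sup>2) * W (\<lambda>z. cmod (partial q n z) ^ (2 * a)))"
    by (simp add: sum.delta)
  finally show ?thesis by (simp only: of_real_eq_iff)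
qed

text \<open>
  The recursion of \<open>moment_step\<close> is the one for sums of independent uniform phases.
\<close>

lemma lacunary_moments:
  assumes q: "\<And>j. q \<le> j \<Longrightarrow> j < p \<Longrightarrow> 3 * d < s j" and N: "q + N \<le> p"
  shows "W (\<lambda>z. cmod (partial q (q + N) z) ^ 2) = N * W (\<lambda>_. 1)" (is ?m1)
    and "W (\<lambda>z. cmod (partial q (q + N) z) ^ 4) = (2 * real N ^ 2 - N) * W (\<lambda>_. 1)" (is ?m2)
    and "W (\<lambda>z. cmod (partial q (q + N) z) ^ 6) \<le> 6 * real N ^ 3 * W (\<lambda>_. 1)" (is ?m3)
proof -
  have "?m1 \<and> ?m2 \<and> ?m3" using N
  proof (induction N)
    case 0
    show ?case by (simp add: partial_def W_def)
  next
    case (Suc N)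
    define E where "E m n = W (\<lambda>z. cmod (partial q n z) ^ m)" for m n
    have IH: "E 2 (q + N) = N * W (\<lambda>_. 1)" "E 4 (q + N) = (2 * real N ^ 2 - N) * W (\<lambda>_. 1)"
        "E 6 (q + N) \<le> 6 * real N ^ 3 * W (\<lambda>_. 1)"
      using Suc unfolding E_def by auto
    have step: "E (2 * m) (q + Suc N) = (\<Sum>a\<le>m. real ((m choose a)\<^sup>2) * E (2 * a) (q + N))" if "m \<le> 3" for m
      using moment_step[OF q, of q "q + N" m] Suc.prems that by (simp add: E_def)
    have E0: "E 0 n = W (\<lambda>_. 1)" for n by (simp add: E_def)
    have sets: "{..1::nat} = {0, 1}" "{..2::nat} = {0, 1, 2}" "{..3::nat} = {0, 1, 2, 3}" by auto
    have choose: "(2 choose 1) = (2::nat)" "(3 choose 1) = (3::nat)" "(3 choose 2) = (3::nat)"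
      by (simp_all add: eval_nat_numeral)
    have 1: "E 2 (q + Suc N) = W (\<lambda>_. 1) + E 2 (q + N)"
      using step[of 1] unfolding sets by (simp add: E0)
    have 2: "E 4 (q + Suc N) = W (\<lambda>_. 1) + 4 * E 2 (q + N) + E 4 (q + N)"
      using step[of 2] choose unfolding sets by (simp add: E0)
    have 3: "E 6 (q + Suc N) = W (\<lambda>_. 1) + 9 * E 2 (q + N) + 9 * E 4 (q + N) + E 6 (q + N)"
      using step[of 3] choose unfolding sets by (simp add: E0)
    have "E 6 (q + Suc N) \<le> (1 + 9 * real N + 9 * (2 * real N ^ 2 - N) + 6 * real N ^ 3) * W (\<lambda>_. 1)"
      unfolding 3 IH(1,2) using IH(3) by (simp add: algebra_simps)
    also have "\<dots> \<le> 6 * real (Suc N) ^ 3 * W (\<lambda>_. 1)"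
      by (intro mult_right_mono W_one_nonneg) (simp add: power2_eq_square power3_eq_cube algebra_simps)
    finally show ?case unfolding E_def[symmetric] 1 2 IH(1,2)
      by (simp add: power2_eq_square algebra_simps)
  qed
  thus ?m1 ?m2 ?m3 by auto
qed

text \<open>
  The minimum of the quartic is attained at \<open>t = 5/2\<close>, whence the sum of squares.
\<close>

lemma quartic_positive: "0 \<le> (t + 1)\<^sup>2 * (t\<^sup>2 - 15) + (112 :: real)"
proof -
  have "(t + 1)\<^sup>2 * (t\<^sup>2 - 15) + 112
      = (t\<^sup>2 + t - 35/4)\<^sup>2 + 5/2 * (t - 5/2)\<^sup>2 + 77/16"
    by (simp add: power2_eq_square field_simps)
  also have "\<dots> \<ge> 0" by (intro add_nonneg_nonneg mult_nonneg_nonneg) auto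
  finally show ?thesis .
qed

text \<open>
  With \<open>u = t\<^sup>2 - 1\<close> this bounds \<open>\<surd>(1 + u)\<close> by a cubic that touches it at \<open>u = 0\<close>. The negative
  quadratic term makes the mean of \<open>t\<close> fall below 1 when \<open>u\<close> has mean 0, a variance bounded from below
  and a bounded third moment; the two coefficients are chosen so that this works for the moments of
  \<open>lacunary_moments\<close>.
\<close>

lemma sqrt_cubic_bound:
  fixes t :: real
  shows "t \<le> 1 + (t\<^sup>2 - 1) / 2 - (t\<^sup>2 - 1)\<^sup>2 / 16 + (t\<^sup>2 - 1) ^ 3 / 224"
proof -
  define u where "u = t\<^sup>2 - 1"
  have "0 \<le> (t - 1)\<^sup>2 * ((t + 1)\<^sup>2 * (t\<^sup>2 - 15) + 112)"
    by (intro mult_nonneg_nonneg quartic_positive) auto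
  also have "\<dots> = 224 * (1 + u / 2 - u\<^sup>2 / 16 + u ^ 3 / 224 - t)"
    by (simp add: u_def power2_eq_square power3_eq_cube field_simps)
  finally have "0 \<le> 224 * (1 + u / 2 - u\<^sup>2 / 16 + u ^ 3 / 224 - t)" .
  moreover have "0 \<le> x" if "0 \<le> 224 * x" for x :: real using that by simp
  ultimately have "0 \<le> 1 + u / 2 - u\<^sup>2 / 16 + u ^ 3 / 224 - t" by blast
  thus ?thesis unfolding u_def[symmetric] by (simp only: diff_ge_0_iff_ge)
qed

text \<open>
  Apply the cubic bound to \<open>t = \<bar>A\<bar> / \<surd>N\<close>. Then \<open>u\<close> has mean 0, second moment at least \<open>1/2\<close> and
  third moment at most \<open>7/2\<close>, relative to the mass of the weight, so that the loss is at least
  \<open>1/32 - 1/64\<close>.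
\<close>

lemma lacunary_L1:
  assumes q: "\<And>j. q \<le> j \<Longrightarrow> j < p \<Longrightarrow> 3 * d < s j" and N: "q + N \<le> p" "2 \<le> N"
  shows "W (\<lambda>z. cmod (partial q (q + N) z)) \<le> 63 / 64 * sqrt N * W (\<lambda>_. 1)"
proof -
  let ?A = "\<lambda>z. cmod (partial q (q + N) z)"
  define w where "w = W (\<lambda>_. 1)"
  define r where "r = real N"
  have r: "2 \<le> r" using N by (simp add: r_def)
  have m: "W (\<lambda>z. ?A z ^ 2) = r * w" "W (\<lambda>z. ?A z ^ 4) = (2 * r ^ 2 - r) * w"
      "W (\<lambda>z. ?A z ^ 6) \<le> 6 * r ^ 3 * w"
    unfolding w_def r_def by (rule lacunary_moments; use q N in auto)+
  have w: "0 \<le> w" unfolding w_def by (rule W_one_nonneg)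
  have c: "continuous_on unit_circle ?A" by (intro continuous_intros continuous_partial)
  \<comment> \<open>the coefficients of the cubic bound, written as a polynomial in \<open>t\<^sup>2\<close>\<close>
  define c0 c2 c4 c6 :: real where
    "c0 = 1 - 1 / 2 - 1 / 16 - 1 / 224" and "c2 = 1 / 2 + 1 / 8 + 3 / 224" and
    "c4 = - 1 / 16 - 3 / 224" and "c6 = 1 / 224"
  have "W (\<lambda>z. 1 / sqrt r * ?A z)
      \<le> W (\<lambda>z. c0 + c2 / r * ?A z ^ 2 + c4 / r ^ 2 * ?A z ^ 4 + c6 / r ^ 3 * ?A z ^ 6)"
  proof (intro W_mono continuous_intros continuous_partial)
    fix z
    define t where "t = ?A z / sqrt r"
    have t2: "t\<^sup>2 = ?A z ^ 2 / r" using r by (simp add: t_def power_divide)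
    have t4: "t ^ 4 = ?A z ^ 4 / r ^ 2" using t2
      by (metis power_divide power_mult mult_2_right numeral_Bit0)
    have "t ^ 6 = (t\<^sup>2) ^ 3" by simp
    also have "\<dots> = ?A z ^ 6 / r ^ 3" unfolding t2 by (simp add: power_divide flip: power_mult)
    finally have t6: "t ^ 6 = ?A z ^ 6 / r ^ 3" .
    have "t \<le> c0 + c2 * t\<^sup>2 + c4 * t ^ 4 + c6 * t ^ 6"
      using sqrt_cubic_bound[of t]
      by (simp add: c0_def c2_def c4_def c6_def field_simps power2_eq_square power3_eq_cube
          eval_nat_numeral)
    thus "1 / sqrt r * ?A z \<le> c0 + c2 / r * ?A z ^ 2 + c4 / r ^ 2 * ?A z ^ 4 + c6 / r ^ 3 * ?A z ^ 6"
      unfolding t2 t4 t6 by (simp add: t_def)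
  qed
  also have "\<dots> = c0 * w + c2 / r * W (\<lambda>z. ?A z ^ 2) + c4 / r ^ 2 * W (\<lambda>z. ?A z ^ 4)
      + c6 / r ^ 3 * W (\<lambda>z. ?A z ^ 6)"
    unfolding w_def by (simp only: W_add W_cmult W_const[of c0] continuous_intros c)
  also have "\<dots> \<le> c0 * w + c2 / r * (r * w) + c4 / r ^ 2 * ((2 * r ^ 2 - r) * w) + c6 / r ^ 3 * (6 * r ^ 3 * w)"
    unfolding m(1,2) using m(3) r by (intro add_left_mono mult_left_mono) (auto simp: c6_def)
  also have "\<dots> = (c0 + c2 + c4 * (2 - 1 / r) + 6 * c6) * w"
    using r by (simp add: field_simps power2_eq_square power3_eq_cube)
  also have "\<dots> \<le> 63 / 64 * w"
  proof (intro mult_right_mono w)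
    have "1 / r \<le> 1 / 2" using r by (simp add: field_simps)
    thus "c0 + c2 + c4 * (2 - 1 / r) + 6 * c6 \<le> 63 / 64"
      by (simp add: c0_def c2_def c4_def c6_def algebra_simps)
  qed
  finally have "W ?A / sqrt r \<le> 63 / 64 * w" by (simp only: W_cmult) simp
  thus ?thesis using r by (simp add: w_def r_def field_simps)
qed

subsection \<open>The part without spacers\<close>

text \<open>
  A Dirichlet kernel \<open>D\<^sub>q\<close> in \<open>x = z ^ h\<close> changes little when multiplied by \<open>x\<^sup>i\<close> with small \<open>i\<close>, since
  \<open>D\<^sub>q - x\<^sup>i * D\<^sub>q = D\<^sub>i - x\<^sup>q * D\<^sub>i\<close>. Averaging over \<open>i < R\<close> replaces it by \<open>D\<^sub>R * D\<^sub>q / R\<close>, whose \<open>L\<^sup>1\<close> norm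
  is small by Cauchy-Schwarz. The argument uses only orthogonality of powers of \<open>x\<close>, so it works with
  any weight of degree less than \<open>h\<close>.
\<close>

lemma dirichlet_L1:
  assumes q: "q \<le> p" "s (q - 1) = 0" and R: "1 \<le> R" "R \<le> p"
  shows "W (\<lambda>z. cmod (\<Sum>j<q. z powi freq j)) \<le> (sqrt (p / R) + 2 * sqrt R) * W (\<lambda>_. 1)"
proof (cases "q = 0")
  case True
  then show ?thesis by (simp add: W_def[of "\<lambda>z. 0"] W_one_nonneg)
next
  case False
  define D where "D n z = (\<Sum>j<n. (z powi int h) ^ j)" for n and z :: complex
  have cont_D: "continuous_on unit_circle (D n)" for n
    unfolding D_def by (intro continuous_intros continuous_on_powi)
  define w where "w = W (\<lambda>_. 1)"
  have w: "0 \<le> w" unfolding w_def by (rule W_one_nonneg)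
  have D_powi: "D n z = (\<Sum>j<n. z powi (int j * int h))" for n z
    unfolding D_def
    by (simp only: of_nat_mult[symmetric] power_int_of_nat mult.commute[of _ h] power_mult)
  have q_freq: "(\<Sum>j<q. z powi freq j) = D q z" for z
  proof -
    have "s j = 0" if "j < q" for j using s_mono[of j "q - 1"] that q by simp
    thus ?thesis unfolding D_powi by (intro sum.cong) (auto simp: freq_def)
  qed
  have D_sq: "W (\<lambda>z. (cmod (D n z))\<^sup>2) = n * w" for n
    unfolding D_powi w_def
  proof (subst W_norm_sq)
    fix i j :: nat assume "i \<noteq> j"
    hence "\<bar>int i - int j\<bar> * int h \<ge> 1 * int h" by (intro mult_right_mono) auto
    moreover have "\<bar>int i * int h - int j * int h\<bar> = \<bar>int i - int j\<bar> * int h"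
      by (simp add: abs_mult flip: left_diff_distrib)
    ultimately show "\<bar>int i * int h - int j * int h\<bar> > int d" using h_large by linarith
  qed auto
  have D_L1: "W (\<lambda>z. cmod (D n z)) \<le> sqrt n * w" for n
  proof (cases "n = 0")
    case False
    then show ?thesis unfolding w_def
      by (intro W_le_sqrt continuous_intros cont_D) (simp_all add: D_sq w_def)
  qed (simp add: D_def W_def)
  have split: "cmod (D q z) \<le> 1 / R * (cmod (D R z) * cmod (D q z)) + 2 / R * (\<Sum>i<R. cmod (D i z))"
    if z: "z \<in> unit_circle" for z
  proof -
    define x where "x = z powi int h"
    have x: "cmod x = 1" unfolding x_def by (rule circle_norm_powi[OF z])
    have shift: "D (a + b) z = D a z + x ^ a * D b z" for a b
      unfolding D_def x_def[symmetric]
      by (induction b) (simp_all add: power_add algebra_simps)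
    have "real R * cmod (D q z) = cmod (\<Sum>i<R. D q z)"
      by (simp add: norm_mult)
    also have "(\<Sum>i<R. D q z) = (\<Sum>i<R. x ^ i * D q z + (D i z - x ^ q * D i z))"
      using shift[of q] shift[of _ q] by (intro sum.cong refl) (simp add: add.commute algebra_simps)
    also have "\<dots> = D R z * D q z + (\<Sum>i<R. D i z - x ^ q * D i z)"
      unfolding D_def[of R] x_def[symmetric] by (simp add: sum.distrib sum_distrib_right)
    also have "cmod \<dots> \<le> cmod (D R z) * cmod (D q z) + (\<Sum>i<R. 2 * cmod (D i z))"
    proof (intro order_trans[OF norm_triangle_ineq] add_mono order_trans[OF norm_sum] sum_mono)
      fix i
      have "cmod (D i z - x ^ q * D i z) \<le> cmod (D i z) + cmod (x ^ q * D i z)" by (rule norm_triangle_ineq4)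
      thus "cmod (D i z - x ^ q * D i z) \<le> 2 * cmod (D i z)" by (simp add: norm_mult norm_power x)
    qed (simp add: norm_mult)
    finally show ?thesis using R by (simp add: field_simps sum_distrib_left)
  qed
  have "W (\<lambda>z. cmod (D q z))
      \<le> W (\<lambda>z. 1 / R * (cmod (D R z) * cmod (D q z)) + 2 / R * (\<Sum>i<R. cmod (D i z)))"
    by (intro W_mono continuous_intros cont_D split) auto
  also have "\<dots> = 1 / R * W (\<lambda>z. cmod (D R z) * cmod (D q z)) + 2 / R * (\<Sum>i<R. W (\<lambda>z. cmod (D i z)))"
    by (simp add: W_add W_cmult W_sum continuous_intros cont_D del: times_divide_eq_left)
  also have "\<dots> \<le> 1 / R * (sqrt (real R * real q) * w) + 2 / R * (\<Sum>i<R. sqrt R * w)"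
  proof (intro add_mono mult_left_mono sum_mono)
    show "W (\<lambda>z. cmod (D R z) * cmod (D q z)) \<le> sqrt (real R * real q) * w"
      unfolding w_def using R False
      by (intro W_product_le continuous_intros cont_D) (simp_all add: D_sq w_def)
    fix i assume "i \<in> {..<R}"
    hence "sqrt i * w \<le> sqrt R * w" by (intro mult_right_mono w) auto
    thus "W (\<lambda>z. cmod (D i z)) \<le> sqrt R * w" using D_L1[of i] by linarith
  qed auto
  also have "\<dots> = (sqrt (q / R) + 2 * sqrt R) * w"
    using R by (simp add: real_sqrt_mult real_sqrt_divide field_simps)
  also have "\<dots> \<le> (sqrt (p / R) + 2 * sqrt R) * w"
    using q R by (intro mult_right_mono w add_mono) (auto intro!: divide_right_mono)
  finally show ?thesis by (simp add: q_freq w_def)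
qed

text \<open>
  The columns are split into those with \<open>s j = 0\<close>, those with \<open>0 < s j \<le> 3 * d\<close>, and the rest. The
  second kind is rare because the nonzero values of \<open>s\<close> are distinct. Divided by \<open>\<surd>p\<close>, everything but
  the term with \<open>63/64\<close> becomes negligible when first \<open>R\<close> and then \<open>p\<close> is large.
\<close>

lemma L1_bound_many_columns:
  assumes R: "1 \<le> R" "R \<le> p" and s0: "s 0 = 0"
  shows "W (\<lambda>z. cmod (\<Sum>j<p. z powi freq j))
    \<le> (sqrt (p / R) + 2 * sqrt R + sqrt (3 * d) + 1 + 63 / 64 * sqrt p) * W (\<lambda>_. 1)"
proof -
  define w where "w = W (\<lambda>_. 1)"
  have w: "0 \<le> w" unfolding w_def by (rule W_one_nonneg)
  have threshold: "\<exists>q\<le>n. \<forall>j<n. s j \<le> t \<longleftrightarrow> j < q" if "n \<le> p" for n t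
    using that
  proof (induction n)
    case (Suc n)
    then obtain q where q: "q \<le> n" "\<forall>j<n. s j \<le> t \<longleftrightarrow> j < q" by auto
    show ?case
    proof (cases "s n \<le> t")
      case True
      hence "\<forall>j<Suc n. s j \<le> t" using s_mono[of _ n] Suc.prems by (auto simp: less_Suc_eq_le intro: order_trans)
      thus ?thesis by (intro exI[of _ "Suc n"]) auto
    next
      case False
      then show ?thesis using q by (intro exI[of _ q]) (auto simp: less_Suc_eq)
    qed
  qed simp
  obtain q0 where q0: "q0 \<le> p" "\<And>j. j < p \<Longrightarrow> s j \<le> 0 \<longleftrightarrow> j < q0" using threshold[of p 0] by auto
  obtain q where q: "q \<le> p" "\<And>j. j < p \<Longrightarrow> s j \<le> 3 * d \<longleftrightarrow> j < q" using threshold[of p "3 * d"] by auto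
  have q0q: "q0 \<le> q"
  proof (rule ccontr)
    assume "\<not> q0 \<le> q"
    hence "s q \<le> 0" "\<not> s q \<le> 3 * d" using q0 q by auto
    thus False by simp
  qed
  let ?S = "\<lambda>J (z::complex). \<Sum>j\<in>J. z powi freq j"
  have cS: "continuous_on unit_circle (?S J)" for J
    by (intro continuous_on_sum continuous_on_powi)
  have "W (\<lambda>z. cmod (?S {..<p} z)) \<le> W (\<lambda>z. cmod (?S {..<q0} z) + cmod (?S {q0..<q} z) + cmod (?S {q..<p} z))"
  proof (intro W_mono continuous_on_add continuous_on_norm cS)
    fix z :: complex
    have "?S {..<p} z = ?S {..<q0} z + ?S {q0..<q} z + ?S {q..<p} z"
      unfolding lessThan_atLeast0
      using q0q q by (simp add: sum.atLeastLessThan_concat)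
    thus "cmod (?S {..<p} z) \<le> cmod (?S {..<q0} z) + cmod (?S {q0..<q} z) + cmod (?S {q..<p} z)"
      by (metis norm_triangle_ineq norm_triangle_mono order_refl)
  qed
  also have "\<dots> = W (\<lambda>z. cmod (?S {..<q0} z)) + W (\<lambda>z. cmod (?S {q0..<q} z)) + W (\<lambda>z. cmod (?S {q..<p} z))"
    by (simp add: W_add continuous_intros cS)
  also have "W (\<lambda>z. cmod (?S {..<q0} z)) \<le> (sqrt (p / R) + 2 * sqrt R) * w"
  proof -
    have "s (q0 - 1) = 0" using q0(1) q0(2)[of "q0 - 1"] s0 by (cases "q0 = 0") auto
    thus ?thesis unfolding w_def using q0(1) R by (intro dirichlet_L1)
  qed
  also have "W (\<lambda>z. cmod (?S {q0..<q} z)) \<le> sqrt (3 * d) * w"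
  proof -
    have "inj_on s {q0..<q}"
    proof (rule linorder_inj_onI')
      fix i j assume "i \<in> {q0..<q}" "j \<in> {q0..<q}" "i < j"
      moreover from this have "0 < s i" using q0(2)[of i] q by auto
      ultimately show "s i \<noteq> s j" using s_gap[of i j] q by auto
    qed
    hence "card {q0..<q} = card (s ` {q0..<q})" by (simp add: card_image)
    also have "\<dots> \<le> card {1..3 * d}"
    proof (intro card_mono image_subsetI)
      fix j assume "j \<in> {q0..<q}"
      thus "s j \<in> {1..3 * d}" using q0(2)[of j] q(2)[of j] q(1) by auto
    qed auto
    finally have "card {q0..<q} \<le> 3 * d" by simp
    hence "sqrt (card {q0..<q}) * w \<le> sqrt (3 * d) * w"
      by (intro mult_right_mono w real_sqrt_le_mono) linarith
    moreover have "W (\<lambda>z. cmod (?S {q0..<q} z)) \<le> sqrt (card {q0..<q}) * w"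
      unfolding w_def using q by (intro W_exponential_sum_le freq_separated) auto
    ultimately show ?thesis by linarith
  qed
  also have "W (\<lambda>z. cmod (?S {q..<p} z)) \<le> (1 + 63 / 64 * sqrt p) * w"
  proof (cases "2 \<le> p - q")
    case True
    have "3 * d < s j" if "q \<le> j" "j < p" for j using q(2)[of j] that by linarith
    hence "W (\<lambda>z. cmod (partial q (q + (p - q)) z)) \<le> 63 / 64 * sqrt (p - q) * w"
      unfolding w_def using q True by (intro lacunary_L1) auto
    also have "\<dots> \<le> (1 + 63 / 64 * sqrt p) * w"
    proof (intro mult_right_mono w)
      have "sqrt (p - q) \<le> sqrt p" by (intro real_sqrt_le_mono) simp
      thus "63 / 64 * sqrt (p - q) \<le> 1 + 63 / 64 * sqrt p" by linarith
    qed
    finally show ?thesis using q by (simp add: partial_def)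
  next
    case False
    have "W (\<lambda>z. cmod (?S {q..<p} z)) \<le> sqrt (card {q..<p}) * w"
      unfolding w_def using q by (intro W_exponential_sum_le freq_separated) auto
    also have "\<dots> \<le> (1 + 63 / 64 * sqrt p) * w"
    proof (intro mult_right_mono w)
      have "sqrt (card {q..<p}) \<le> 1" using False by simp
      moreover have "0 \<le> 63 / 64 * sqrt p" by simp
      ultimately show "sqrt (card {q..<p}) \<le> 1 + 63 / 64 * sqrt p" by linarith
    qed
    finally show ?thesis .
  qed
  finally show ?thesis by (simp add: w_def algebra_simps)
qed

subsection \<open>A bounded number of columns\<close>

text \<open>
  Let \<open>t\<close> be the normalized modulus and \<open>u = t\<^sup>2 - 1\<close>. Since \<open>t \<le> \<surd>p\<close>, one has
  \<open>t \<le> 1 + u / 2 - \<alpha> * u\<^sup>2\<close> with \<open>\<alpha> = 1 / (2 * (\<surd>p + 1)\<^sup>2)\<close>. The mean of \<open>u\<^sup>2\<close> is bounded from below by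
  Bessel's inequality for the single function \<open>\<rho> = Re (z ^ m)\<close>, where \<open>m\<close> is the largest
  difference of two frequencies, which only the first and the last column attain.
\<close>

lemma L1_bound_fixed_columns:
  assumes p: "2 \<le> p"
  shows "W (\<lambda>z. cmod (\<Sum>j<p. z powi freq j) / sqrt p)
    \<le> (1 - 1 / (real p * (sqrt p + 1))\<^sup>2) * W (\<lambda>_. 1)"
proof -
  define w where "w = W (\<lambda>_. 1)"
  define r where "r = real p"
  have r: "r > 0" using p by (simp add: r_def)
  define t where "t = (\<lambda>z. cmod (\<Sum>j<p. z powi freq j) / sqrt r)"
  define m where "m = freq (p - 1) - freq 0"
  define \<rho> where "\<rho> = (\<lambda>z::complex. Re (z powi m))"
  define \<alpha> where "\<alpha> = 1 / (2 * (sqrt r + 1)\<^sup>2)"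
  have a0: "\<alpha> \<ge> 0" by (simp add: \<alpha>_def)
  have ct: "continuous_on unit_circle t"
    unfolding t_def using r by (intro continuous_intros continuous_on_powi) auto
  have c\<rho>: "continuous_on unit_circle \<rho>"
    unfolding \<rho>_def by (intro continuous_intros continuous_on_powi)
  have m: "\<bar>m\<bar> > int d" "\<bar>2 * m\<bar> > int d"
    using freq_separated[of "p - 1" 0] p by (auto simp: m_def)
  have W\<rho>: "W \<rho> = 0"
    unfolding \<rho>_def using m by (simp add: W_Re continuous_on_powi CW_powi)
  have W\<rho>2: "W (\<lambda>z. (\<rho> z)\<^sup>2) = w / 2"
  proof -
    have "W (\<lambda>z. (\<rho> z)\<^sup>2) = W (\<lambda>z. 1 / 2 + 1 / 2 * Re (z powi (2 * m)))"
    proof (rule W_cong)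
      fix z :: complex assume z: "z \<in> unit_circle"
      define x where "x = z powi m"
      have "z powi (2 * m) = x\<^sup>2"
        using circle_powi_add[OF z, of m m] by (simp add: x_def power2_eq_square)
      moreover have "(Re x)\<^sup>2 + (Im x)\<^sup>2 = 1"
        using circle_norm_powi[OF z, of m] by (simp only: x_def cmod_power2[symmetric]) simp
      ultimately show "(\<rho> z)\<^sup>2 = 1 / 2 + 1 / 2 * Re (z powi (2 * m))"
        by (simp add: \<rho>_def x_def[symmetric] power2_eq_square field_simps)
    qed
    also have "\<dots> = W (\<lambda>_. 1 / 2) + W (\<lambda>z. 1 / 2 * Re (z powi (2 * m)))"
      by (intro W_add continuous_on_mult continuous_on_const continuous_on_Re continuous_on_powi)
    also have "\<dots> = 1 / 2 * w + 1 / 2 * Re (CW (\<lambda>z. z powi (2 * m)))"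
      by (simp only: W_cmult W_const[of "1 / 2"] W_Re continuous_on_powi w_def)
    also have "\<dots> = w / 2" using m by (simp add: CW_powi)
    finally show ?thesis .
  qed
  have Wt2: "W (\<lambda>z. (t z)\<^sup>2) = w"
  proof -
    have "W (\<lambda>z. (t z)\<^sup>2) = W (\<lambda>z. 1 / r * (cmod (\<Sum>j<p. z powi freq j))\<^sup>2)"
      using r by (intro W_cong) (simp add: t_def power_divide)
    also have "\<dots> = w" using r
      unfolding W_cmult by (subst W_norm_sq) (auto intro!: freq_separated simp: w_def r_def)
    finally show ?thesis .
  qed
  have Wt2\<rho>: "W (\<lambda>z. (t z)\<^sup>2 * \<rho> z) = w / r"
  proof -
    have cS: "continuous_on unit_circle (\<lambda>z. \<Sum>i<p. \<Sum>j<p. z powi (freq i - freq j + m))"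
      by (intro continuous_on_sum continuous_on_powi)
    have "W (\<lambda>z. (t z)\<^sup>2 * \<rho> z) = W (\<lambda>z. 1 / r * Re (\<Sum>i<p. \<Sum>j<p. z powi (freq i - freq j + m)))"
    proof (rule W_cong)
      fix z :: complex assume z: "z \<in> unit_circle"
      have "(\<Sum>i<p. \<Sum>j<p. z powi (freq i - freq j + m)) =
          complex_of_real ((cmod (\<Sum>j<p. z powi freq j))\<^sup>2) * z powi m"
        unfolding circle_norm_sum_sq[OF z] by (simp only: circle_powi_add[OF z] sum_distrib_right)
      thus "(t z)\<^sup>2 * \<rho> z = 1 / r * Re (\<Sum>i<p. \<Sum>j<p. z powi (freq i - freq j + m))"
        using r by (simp add: t_def \<rho>_def power_divide)
    qed
    also have "\<dots> = 1 / r * Re (\<Sum>i<p. \<Sum>j<p. CW (\<lambda>z. z powi (freq i - freq j + m)))"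
      by (subst W_cmult, subst W_Re[OF cS]) (simp add: CW_sum continuous_on_sum continuous_on_powi)
    also have "(\<Sum>i<p. \<Sum>j<p. CW (\<lambda>z. z powi (freq i - freq j + m)))
        = (\<Sum>i<p. \<Sum>j<p. if j = p - 1 then if i = 0 then complex_of_real w else 0 else 0)"
    proof (intro sum.cong refl)
      fix i j assume ij: "i \<in> {..<p}" "j \<in> {..<p}"
      show "CW (\<lambda>z. z powi (freq i - freq j + m)) = (if j = p - 1 then if i = 0 then complex_of_real w else 0 else 0)"
      proof (cases "i = 0 \<and> j = p - 1")
        case True
        then show ?thesis using CW_of_real[of "\<lambda>_. 1"] by (simp add: m_def w_def)
      next
        case False
        have "1 * int h \<le> (int i - int j + int (p - 1)) * int h"
          using False ij p by (intro mult_right_mono) auto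
        moreover have "freq i - freq j + m
            = (int i - int j + int (p - 1)) * int h + int (s i) - int (s j) + int (s (p - 1)) - int (s 0)"
          by (simp add: freq_def m_def algebra_simps)
        moreover have "6 * int (s j) < int h" "6 * int (s 0) < int h"
          using s_small[of j] s_small[of 0] ij by simp_all
        ultimately have "int d < \<bar>freq i - freq j + m\<bar>" using h_large by linarith
        then show ?thesis using False by (auto simp: CW_powi)
      qed
    qed
    also have "\<dots> = complex_of_real w" using p by (simp add: sum.delta)
    finally show ?thesis by simp
  qed
  have pointwise: "t z \<le> 1 / 2 + 1 / 2 * (t z)\<^sup>2
      - \<alpha> * (4 / r * ((t z)\<^sup>2 * \<rho> z - \<rho> z) - 4 / r\<^sup>2 * (\<rho> z)\<^sup>2)" if z: "z \<in> unit_circle" for z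
  proof -
    \<comment> \<open>the pointwise form of Bessel's inequality, with the coefficient \<open>2 / r\<close> of \<open>\<rho>\<close> in the expansion of \<open>t\<^sup>2 - 1\<close>\<close>
    have "0 \<le> ((t z)\<^sup>2 - 1 - 2 / r * \<rho> z)\<^sup>2" by simp
    also have "\<dots> = ((t z)\<^sup>2 - 1)\<^sup>2 - (4 / r * ((t z)\<^sup>2 * \<rho> z - \<rho> z) - 4 / r\<^sup>2 * (\<rho> z)\<^sup>2)"
      using r by (simp add: power2_eq_square field_simps)
    finally have 1: "4 / r * ((t z)\<^sup>2 * \<rho> z - \<rho> z) - 4 / r\<^sup>2 * (\<rho> z)\<^sup>2 \<le> ((t z)\<^sup>2 - 1)\<^sup>2"
      by (simp only: diff_ge_0_iff_ge)
    have t0: "0 \<le> t z" by (simp add: t_def r_def)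
    have "cmod (\<Sum>j<p. z powi freq j) \<le> (\<Sum>j<p. 1)"
      by (intro order_trans[OF norm_sum] sum_mono) (simp only: circle_norm_powi[OF z])
    hence "t z \<le> r / sqrt r" unfolding t_def by (intro divide_right_mono) (auto simp: r_def)
    hence "t z \<le> sqrt r" using r by (simp add: real_div_sqrt)
    hence "(t z + 1)\<^sup>2 \<le> (sqrt r + 1)\<^sup>2" using t0 by (intro power_mono) auto
    hence "\<alpha> * (t z + 1)\<^sup>2 \<le> 1 / 2"
      using r by (simp add: \<alpha>_def divide_le_eq add_pos_pos)
    hence "(t z - 1)\<^sup>2 * (\<alpha> * (t z + 1)\<^sup>2) \<le> (t z - 1)\<^sup>2 * (1 / 2)"
      by (intro mult_left_mono) auto
    hence "\<alpha> * ((t z)\<^sup>2 - 1)\<^sup>2 \<le> 1 / 2 + 1 / 2 * (t z)\<^sup>2 - t z"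
      by (simp add: power2_eq_square algebra_simps)
    moreover have "\<alpha> * (4 / r * ((t z)\<^sup>2 * \<rho> z - \<rho> z) - 4 / r\<^sup>2 * (\<rho> z)\<^sup>2) \<le> \<alpha> * ((t z)\<^sup>2 - 1)\<^sup>2"
      by (intro mult_left_mono 1 a0)
    ultimately show ?thesis by linarith
  qed
  have "W t \<le> W (\<lambda>z. 1 / 2 + 1 / 2 * (t z)\<^sup>2
      - \<alpha> * (4 / r * ((t z)\<^sup>2 * \<rho> z - \<rho> z) - 4 / r\<^sup>2 * (\<rho> z)\<^sup>2))"
    by (intro W_mono continuous_intros ct c\<rho> pointwise) auto
  also have "\<dots> = 1 / 2 * w + 1 / 2 * w - \<alpha> * (4 / r * (w / r - 0) - 4 / r\<^sup>2 * (w / 2))"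
    by (simp only: W_add W_diff W_cmult W_const[of "1 / 2"] continuous_intros ct c\<rho> W\<rho> W\<rho>2 Wt2 Wt2\<rho> w_def[symmetric])
  also have "\<dots> = (1 - 1 / (r * (sqrt r + 1))\<^sup>2) * w"
  proof -
    define b where "b = (sqrt r + 1)\<^sup>2"
    have "sqrt r + 1 > 0" using r by (simp add: add_pos_pos)
    hence b: "b > 0" by (simp add: b_def)
    show ?thesis unfolding \<alpha>_def power_mult_distrib b_def[symmetric]
      using r b by (simp add: field_simps power2_eq_square)
  qed
  finally show ?thesis by (simp only: t_def w_def r_def)
qed

end

section \<open>Riesz factors\<close>

definition riesz :: "(nat \<Rightarrow> nat) \<Rightarrow> (nat \<Rightarrow> nat \<Rightarrow> nat) \<Rightarrow> nat \<Rightarrow> complex \<Rightarrow> complex" where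
  "riesz p a k z = (\<Sum>j<p k. z ^ (j * height p a k + spacer_sum a k j)) / sqrt (p k)"

lemma spacer_sum_Suc: "spacer_sum a k (Suc j) = spacer_sum a k j + a k (Suc j)"
  by (simp add: spacer_sum_def)

lemma spacer_sum_mono: "i \<le> j \<Longrightarrow> spacer_sum a k i \<le> spacer_sum a k j"
  by (auto simp: spacer_sum_def intro!: sum_mono2)

lemma continuous_riesz: "continuous_on S (riesz p a k)"
  unfolding riesz_def divide_inverse by (intro continuous_intros)

lemma height_ge_power: "(\<And>k. p k \<ge> 2) \<Longrightarrow> 2 ^ k \<le> height p a k"
proof (induction k)
  case (Suc k)
  have "2 * 2 ^ k \<le> p k * height p a k" using Suc by (intro mult_le_mono) auto
  then show ?case by simp
qed simp

lemma height_gt: "(\<And>k. p k \<ge> 2) \<Longrightarrow> k < height p a k"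
  by (rule less_le_trans[OF less_exp height_ge_power])

locale lacunary_spacers =
  fixes p :: "nat \<Rightarrow> nat" and a :: "nat \<Rightarrow> nat \<Rightarrow> nat"
  assumes p2: "\<And>k. p k \<ge> 2"
    and lacunary: "\<And>k j. j < p k \<Longrightarrow> a k (j + 1) \<ge> 2 * spacer_sum a k j"
    and small: "\<And>k. real (spacer_sum a k (p k)) / real (height p a k) < 1 / 2"
begin

lemma height_pos: "0 < height p a k"
  using height_gt[of p k a] p2 by simp

lemma lacunary_sum_riesz:
  assumes "trig_weight g d" "2 * d < k"
  shows "lacunary_sum g d (height p a k) (spacer_sum a k) (p k)"
proof -
  interpret trig_weight g d by fact
  have lac: "3 * spacer_sum a k j \<le> spacer_sum a k (Suc j)" if "j < p k" for j
    using lacunary[OF that] by (simp add: spacer_sum_Suc)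
  show ?thesis
  proof
    show "6 * spacer_sum a k j < height p a k" if "j < p k" for j
    proof -
      have "3 * spacer_sum a k j \<le> spacer_sum a k (p k)"
        using lac[OF that] spacer_sum_mono[of "Suc j" "p k" a k] that by linarith
      moreover have "2 * spacer_sum a k (p k) < height p a k"
        using small[of k] height_pos[of k] by (simp add: field_simps)
      ultimately show ?thesis by linarith
    qed
    show "2 * d < height p a k" using height_gt[of p k a] p2 assms(2) by simp
  qed (use lac in auto)
qed

lemma norm_riesz:
  assumes "lacunary_sum g d (height p a k) (spacer_sum a k) (p k)"
  shows "cmod (riesz p a k z)
    = cmod (\<Sum>j<p k. z powi lacunary_sum.freq (height p a k) (spacer_sum a k) j) / sqrt (p k)"
proof -
  interpret lacunary_sum g d "height p a k" "spacer_sum a k" "p k" by fact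
  have "z powi freq j = z ^ (j * height p a k + spacer_sum a k j)" for j
    unfolding freq_def by (simp only: of_nat_mult[symmetric] of_nat_add[symmetric] power_int_of_nat)
  thus ?thesis by (simp add: riesz_def norm_divide)
qed

text \<open>
  Either \<open>p k\<close> takes some value \<open>P\<close> infinitely often, and the bound for \<open>P\<close> columns applies, or \<open>p k\<close>
  tends to infinity. The constant may depend on \<open>P\<close> but not on the weight.
\<close>

lemma riesz_L1_contraction:
  obtains c where "0 \<le> c" "c < 1"
    and "\<And>g d k0. trig_weight g d \<Longrightarrow> \<exists>k\<ge>k0. (LINT z|circle_lebesgue. g z * cmod (riesz p a k z))
           \<le> c * (LINT z|circle_lebesgue. g z)"
proof (cases "\<exists>P. \<forall>k0. \<exists>k\<ge>k0. p k = P")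
  case True
  then obtain P where P: "\<And>k0. \<exists>k\<ge>k0. p k = P" by blast
  have "P \<ge> 2" using P p2 by metis
  define c where "c = 1 - 1 / (real P * (sqrt P + 1))\<^sup>2"
  have "1 * 1 \<le> real P * (sqrt P + 1)"
    using \<open>P \<ge> 2\<close> by (intro mult_mono) auto
  hence "1 \<le> (real P * (sqrt P + 1))\<^sup>2" by (intro one_le_power) simp
  hence c: "0 \<le> c" "c < 1" using \<open>P \<ge> 2\<close> by (auto simp: c_def divide_le_eq_1 simp del: power_mult_distrib)
  show ?thesis
  proof (rule that[OF c])
    fix g d k0 assume g: "trig_weight g d"
    then interpret trig_weight g d .
    obtain k where k: "k \<ge> max k0 (2 * d + 1)" "p k = P" using P by blast
    hence L: "lacunary_sum g d (height p a k) (spacer_sum a k) (p k)"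
      by (intro lacunary_sum_riesz g) auto
    from lacunary_sum.L1_bound_fixed_columns[OF this p2]
    have "W (\<lambda>z. cmod (riesz p a k z)) \<le> c * W (\<lambda>_. 1)"
      unfolding norm_riesz[OF L] c_def k(2)[symmetric] .
    thus "\<exists>k\<ge>k0. (LINT z|circle_lebesgue. g z * cmod (riesz p a k z)) \<le> c * (LINT z|circle_lebesgue. g z)"
      using k by (intro exI[of _ k]) (auto simp: W_def)
  qed
next
  case False
  hence "\<exists>k0. \<forall>k\<ge>k0. p k \<noteq> P" for P by auto
  then obtain k1 where k1: "\<And>P k. k1 P \<le> k \<Longrightarrow> p k \<noteq> P" by metis
  have large: "\<exists>k\<ge>k0. n < p k" for n k0
  proof (intro exI conjI)
    \<comment> \<open>from this index on, none of the values \<open>P \<le> n\<close> occurs\<close>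
    let ?k = "max k0 (\<Sum>P\<le>n. k1 P)"
    show "n < p ?k"
    proof (rule ccontr)
      assume "\<not> n < p ?k"
      hence "k1 (p ?k) \<le> (\<Sum>P\<le>n. k1 P)" by (intro member_le_sum) auto
      hence "k1 (p ?k) \<le> ?k" by (rule max.coboundedI2)
      thus False using k1 by blast
    qed
  qed auto
  show ?thesis
  proof (rule that[of "127 / 128"])
    fix g d k0 assume g: "trig_weight g d"
    then interpret trig_weight g d .
    \<comment> \<open>\<open>R = 256\<^sup>2\<close> makes the term with \<open>R\<close> in the denominator at most \<open>1/256\<close>; this \<open>n\<close> does the same for the rest\<close>
    define n where "n = nat \<lceil>(256 * (513 + sqrt (3 * d)))\<^sup>2\<rceil> + 65536"
    obtain k where k: "k \<ge> max k0 (2 * d + 1)" "n < p k" using large by blast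
    hence L: "lacunary_sum g d (height p a k) (spacer_sum a k) (p k)"
      by (intro lacunary_sum_riesz g) auto
    interpret L: lacunary_sum g d "height p a k" "spacer_sum a k" "p k" by fact
    have sq: "sqrt 65536 = (256::real)" by (rule real_sqrt_unique) auto
    define r where "r = sqrt (p k)"
    have r: "r > 0" using p2[of k] by (simp add: r_def)
    have "256 * (513 + sqrt (3 * d)) \<le> r"
      unfolding r_def
    proof (rule real_le_rsqrt)
      have "(256 * (513 + sqrt (3 * d)))\<^sup>2 \<le> real n" unfolding n_def by linarith
      also have "\<dots> \<le> real (p k)" using k by simp
      finally show "(256 * (513 + sqrt (3 * d)))\<^sup>2 \<le> real (p k)" .
    qed
    hence bound: "(sqrt (p k / 65536) + 2 * sqrt 65536 + sqrt (3 * d) + 1 + 63 / 64 * r) / r \<le> 127 / 128"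
      using r unfolding real_sqrt_divide sq r_def[symmetric] by (simp add: field_simps)
    have "W (\<lambda>z. cmod (riesz p a k z))
        = 1 / r * W (\<lambda>z. cmod (\<Sum>j<p k. z powi L.freq j))"
      unfolding norm_riesz[OF L] by (subst W_cmult[symmetric]) (simp add: r_def)
    also have "\<dots> \<le> 1 / r * ((sqrt (p k / 65536) + 2 * sqrt 65536 + sqrt (3 * d) + 1 + 63 / 64 * sqrt (p k)) * W (\<lambda>_. 1))"
      using r k n_def L.L1_bound_many_columns[of 65536]
      by (intro mult_left_mono) (auto simp: spacer_sum_def)
    also have "\<dots> = (sqrt (p k / 65536) + 2 * sqrt 65536 + sqrt (3 * d) + 1 + 63 / 64 * r) / r * W (\<lambda>_. 1)"
      by (simp add: r_def)
    also have "\<dots> \<le> 127 / 128 * W (\<lambda>_. 1)"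
      by (intro mult_right_mono bound W_one_nonneg)
    finally show "\<exists>k\<ge>k0. (LINT z|circle_lebesgue. g z * cmod (riesz p a k z)) \<le> 127 / 128 * (LINT z|circle_lebesgue. g z)"
      using k by (intro exI[of _ k]) (auto simp: W_def)
  qed auto
qed

text \<open>
  Each new index multiplies the integral by at most \<open>c\<close>, up to the error of replacing the current
  product by a trigonometric polynomial above it.
\<close>

lemma riesz_products_vanish:
  assumes "\<epsilon> > 0"
  obtains K where "finite K" "K \<subseteq> {m..}"
    "(LINT z|circle_lebesgue. (\<Prod>k\<in>K. cmod (riesz p a k z))) < \<epsilon>"
proof -
  obtain c where c: "0 \<le> c" "c < 1"
    and contraction: "\<And>g d k0. trig_weight g d \<Longrightarrow> \<exists>k\<ge>k0. (LINT z|circle_lebesgue. g z * cmod (riesz p a k z))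
           \<le> c * (LINT z|circle_lebesgue. g z)"
    using riesz_L1_contraction by blast
  let ?I = "\<lambda>K. LINT z|circle_lebesgue. (\<Prod>k\<in>K. cmod (riesz p a k z))"
  have cont: "continuous_on unit_circle (\<lambda>z. \<Prod>k\<in>K. cmod (riesz p a k z))" for K
    by (intro continuous_intros continuous_riesz)
  have "\<exists>K. finite K \<and> K \<subseteq> {m..} \<and> ?I K \<le> c ^ n + \<eta>" if "\<eta> > 0" for n \<eta>
    using that
  proof (induction n arbitrary: \<eta>)
    case 0
    then show ?case by (intro exI[of _ "{}"]) (simp add: Leb.prob_space)
  next
    case (Suc n)
    then obtain K where K: "finite K" "K \<subseteq> {m..}" "?I K \<le> c ^ n + \<eta> / 2"
      using Suc.IH[OF half_gt_zero[OF Suc.prems]] by blast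
    let ?G = "\<lambda>z. \<Prod>k\<in>K. cmod (riesz p a k z)"
    obtain g where g: "trig UNIV (\<lambda>z. complex_of_real (g z))"
      and approx: "\<And>z. z \<in> unit_circle \<Longrightarrow> \<bar>?G z - g z\<bar> < \<eta> / 4"
      using trig_approximation[OF cont, of "\<eta> / 4" K] Suc.prems by auto
    have g': "trig UNIV (\<lambda>z. complex_of_real (g z + \<eta> / 4))"
      unfolding of_real_add by (intro trig_add g trig_const) auto
    then obtain d where d: "trig {- int d..int d} (\<lambda>z. complex_of_real (g z + \<eta> / 4))"
      using trig_bounded_freq by blast
    have G_le: "?G z \<le> g z + \<eta> / 4" "g z + \<eta> / 4 \<le> ?G z + \<eta> / 2" if "z \<in> unit_circle" for z
      using approx[OF that] by (simp_all only: abs_less_iff) linarith+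
    have G0: "0 \<le> ?G z" for z by (intro prod_nonneg) auto
    have w: "trig_weight (\<lambda>z. g z + \<eta> / 4) d"
      by standard (rule d, use G_le G0 in \<open>meson order_trans\<close>)
    define k0 where "k0 = Suc (Max (insert m K))"
    obtain k where k: "k \<ge> k0" "(LINT z|circle_lebesgue. (g z + \<eta> / 4) * cmod (riesz p a k z))
           \<le> c * (LINT z|circle_lebesgue. g z + \<eta> / 4)" using contraction[OF w] by blast
    have k_new: "k \<notin> K" "m \<le> k"
    proof -
      have "Max (insert m K) < k" using k(1) by (simp add: k0_def)
      thus "k \<notin> K" "m \<le> k" using K(1) by (auto simp: Max_less_iff[of "insert m K" k, OF _ insert_not_empty])
    qed
    have cg: "continuous_on unit_circle (\<lambda>z. g z + \<eta> / 4)"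
      using trig_weight.continuous_g[OF w] .
    have "?I (insert k K) = (LINT z|circle_lebesgue. ?G z * cmod (riesz p a k z))"
      using K k_new by (simp add: mult.commute)
    also have "\<dots> \<le> (LINT z|circle_lebesgue. (g z + \<eta> / 4) * cmod (riesz p a k z))"
      by (intro integral_mono Leb.continuous_integrable continuous_intros cont continuous_riesz cg
          mult_right_mono G_le) (auto simp: Leb.space_circle)
    also have "\<dots> \<le> c * (LINT z|circle_lebesgue. g z + \<eta> / 4)" by (rule k(2))
    also have "(LINT z|circle_lebesgue. g z + \<eta> / 4) \<le> (LINT z|circle_lebesgue. ?G z + \<eta> / 2)"
      using G_le by (intro integral_mono Leb.continuous_integrable continuous_intros cont cg)
        (auto simp: Leb.space_circle)
    also have "\<dots> = ?I K + \<eta> / 2"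
      by (simp add: Leb.continuous_integrable[OF cont] Leb.prob_space)
    also have "c * (?I K + \<eta> / 2) \<le> c * (c ^ n + \<eta>)"
      using K c by (intro mult_left_mono) auto
    also have "\<dots> \<le> c ^ Suc n + \<eta>"
      using c Suc.prems mult_left_le_one_le[of \<eta> c] by (simp add: algebra_simps)
    finally have "?I (insert k K) \<le> c ^ Suc n + \<eta>" using c by (simp add: mult_left_mono)
    then show ?case using K k_new by (intro exI[of _ "insert k K"]) auto
  qed
  moreover obtain n where "c ^ n < \<epsilon> / 2"
    using real_arch_pow_inv[of "\<epsilon> / 2" c] assms c by auto
  ultimately obtain K where "finite K" "K \<subseteq> {m..}" "?I K \<le> c ^ n + \<epsilon> / 4"
    using assms by (meson divide_pos_pos zero_less_numeral)
  thus ?thesis using \<open>c ^ n < \<epsilon> / 2\<close> assms by (intro that[of K]) auto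
qed

end

section \<open>Herglotz' theorem\<close>

text \<open>
  A positive definite sequence is the sequence of Fourier coefficients of a measure on the circle:
  its Cesaro means are nonnegative densities, and a weak limit of them, taken on the interval from 0
  to \<open>2 * pi\<close> and wrapped around the circle, is the measure sought.
\<close>

locale positive_definite =
  fixes c :: "int \<Rightarrow> complex"
  assumes positive: "0 \<le> Re (\<Sum>i<N. \<Sum>j<N. u i * cnj (u j) * c (int i - int j))"
    and hermitian: "c (- n) = cnj (c n)"
begin

definition cesaro :: "nat \<Rightarrow> complex \<Rightarrow> real" where
  "cesaro N z = Re (\<Sum>i<Suc N. \<Sum>j<Suc N. c (int i - int j) * z powi (int i - int j)) / real (Suc N)"

lemma continuous_cesaro: "continuous_on unit_circle (cesaro N)"
  unfolding cesaro_def divide_inverse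
  by (intro continuous_on_mult continuous_on_Re continuous_on_sum continuous_on_const continuous_on_powi)

lemma cesaro_nonneg:
  assumes z: "z \<in> unit_circle"
  shows "0 \<le> cesaro N z"
proof -
  have "z powi (int i - int j) = z ^ i * cnj (z ^ j)" for i j :: nat
    using circle_powi_add[OF z, of "int i" "- int j"]
    by (simp only: cnj_powi[OF z, of "int j", symmetric] power_int_of_nat diff_conv_add_uminus)
  thus ?thesis
    using positive[of "\<lambda>i. z ^ i" "Suc N"] unfolding cesaro_def
    by (intro divide_nonneg_nonneg) (simp_all add: mult.commute)
qed

lemma cesaro_complex:
  assumes z: "z \<in> unit_circle"
  shows "complex_of_real (cesaro N z)
    = (\<Sum>i<Suc N. \<Sum>j<Suc N. c (int i - int j) * z powi (int i - int j)) / of_nat (Suc N)" (is "_ = ?S / _")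
proof -
  have "cnj ?S = (\<Sum>i<Suc N. \<Sum>j<Suc N. c (int j - int i) * z powi (int j - int i))"
    unfolding cnj_sum complex_cnj_mult cnj_powi[OF z] hermitian[symmetric] by simp
  also have "\<dots> = ?S" by (rule sum.swap)
  finally have "complex_of_real (Re ?S) = ?S" by (simp add: complex_eq_iff del: cnj_sum)
  thus ?thesis unfolding cesaro_def by simp
qed

lemma cesaro_moment:
  "(LINT z|circle_lebesgue. z powi (- int n) * complex_of_real (cesaro N z))
    = of_nat (Suc N - n) / of_nat (Suc N) * c (int n)"
proof -
  let ?M = "Suc N"
  have "(LINT z|circle_lebesgue. z powi (- int n) * complex_of_real (cesaro N z))
      = (LINT z|circle_lebesgue. (\<Sum>i<?M. \<Sum>j<?M. c (int i - int j) / of_nat ?M * z powi (int i - int j - int n)))"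
  proof (rule Leb.integral_cong_circle)
    fix z :: complex assume z: "z \<in> unit_circle"
    have e: "z powi (int i - int j - int n) = z powi (- int n) * z powi (int i - int j)" for i j :: nat
      by (simp only: circle_powi_add[OF z, symmetric]) simp
    show "z powi (- int n) * complex_of_real (cesaro N z)
        = (\<Sum>i<?M. \<Sum>j<?M. c (int i - int j) / of_nat ?M * z powi (int i - int j - int n))"
      unfolding cesaro_complex[OF z] e sum_divide_distrib sum_distrib_left
      by (intro sum.cong refl) (simp only: times_divide_eq_left times_divide_eq_right mult_ac)
  qed
  also have "\<dots> = (\<Sum>i<?M. \<Sum>j<?M. c (int i - int j) / of_nat ?M * (LINT z|circle_lebesgue. z powi (int i - int j - int n)))"
    by (simp add: Leb.continuous_integrable continuous_on_sum continuous_on_mult continuous_on_const continuous_on_powi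
        del: sum.lessThan_Suc)
  also have "\<dots> = (\<Sum>j<?M. \<Sum>i<?M. if i = j + n then c (int n) / of_nat ?M else 0)"
    unfolding integral_circle_lebesgue_powi
    by (subst sum.swap, intro sum.cong refl) auto
  also have "\<dots> = (\<Sum>j<?M. if j \<in> {j. j < ?M - n} then c (int n) / of_nat ?M else 0)"
    by (intro sum.cong refl) (auto simp: sum.delta simp del: sum.lessThan_Suc)
  also have "\<dots> = (\<Sum>j\<in>{..<?M} \<inter> {j. j < ?M - n}. c (int n) / of_nat ?M)"
    by (rule sum.inter_restrict[symmetric]) simp
  also have "{..<?M} \<inter> {j. j < ?M - n} = {..<?M - n}" by auto
  finally show ?thesis by (simp add: field_simps)
qed

lemma c0: "c 0 = complex_of_real (Re (c 0))" "0 \<le> Re (c 0)"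
  using hermitian[of 0] positive[where N = 1 and u = "\<lambda>_. 1"] by (auto simp: complex_eq_iff)

lemma cesaro_integral: "(LINT z|circle_lebesgue. cesaro N z) = Re (c 0)"
proof -
  have "complex_of_real (LINT z|circle_lebesgue. cesaro N z) = complex_of_real (Re (c 0))"
    using cesaro_moment[of 0 N] c0 by (simp del: of_nat_Suc)
  thus ?thesis by (simp only: of_real_eq_iff)
qed

lemma cesaro_moment_int:
  "(LINT z|circle_lebesgue. z powi (- n) * complex_of_real (cesaro N z))
    = of_nat (Suc N - nat \<bar>n\<bar>) / of_nat (Suc N) * c n"
proof (cases "n \<ge> 0")
  case True
  then show ?thesis using cesaro_moment[of "nat n" N] by (simp del: of_nat_Suc)
next
  case False
  have "(LINT z|circle_lebesgue. z powi (- n) * complex_of_real (cesaro N z))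
      = (LINT z|circle_lebesgue. cnj (z powi n * complex_of_real (cesaro N z)))"
    by (rule Leb.integral_cong_circle) (simp only: complex_cnj_mult cnj_powi complex_cnj_complex_of_real)
  also have "\<dots> = cnj (LINT z|circle_lebesgue. z powi n * complex_of_real (cesaro N z))"
    by (rule Bochner_Integration.integral_cnj)
  finally show ?thesis
    using cesaro_moment[of "nat (- n)" N] False hermitian[of n] by (simp del: of_nat_Suc)
qed

lemma cesaro_weights_tendsto: "(\<lambda>N. of_nat (Suc N - m) / of_nat (Suc N) :: complex) \<longlonglongrightarrow> 1"
proof -
  have "(\<lambda>N. 1 - complex_of_real (real m / real (Suc N))) \<longlonglongrightarrow> 1 - complex_of_real 0"
    by (intro tendsto_intros LIMSEQ_Suc[OF lim_const_over_n])
  moreover have "\<forall>\<^sub>F N in sequentially. of_nat (Suc N - m) / of_nat (Suc N) = 1 - complex_of_real (real m / real (Suc N))"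
    using eventually_ge_at_top[of m]
  proof eventually_elim
    case (elim N)
    have "of_nat (Suc N - m) = of_nat (Suc N) - (of_nat m :: complex)" using elim by (intro of_nat_diff) simp
    thus ?case by (simp add: diff_divide_distrib del: of_nat_Suc)
  qed
  ultimately show ?thesis by (simp add: filterlim_cong[OF refl refl])
qed

lemma tendsto_moment:
  "(\<lambda>N. LINT z|circle_lebesgue. z powi (- n) * complex_of_real (cesaro N z)) \<longlonglongrightarrow> c n"
  unfolding cesaro_moment_int
  using tendsto_mult[OF cesaro_weights_tendsto[of "nat \<bar>n\<bar>"] tendsto_const[of "c n"]]
  by (simp only: mult_1)

text \<open>
  If \<open>c 0 = 0\<close>, the Cesaro means have integral 0 and so do all their moments. Otherwise they are
  normalized to probability measures on the line, all supported in one compact interval, so that Helly's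
  theorem yields a limit, whose characteristic function at the integers is known.
\<close>

lemma circle_measure_exists:
  obtains \<sigma> where "circle_measure \<sigma>" "\<And>n. (LINT z|\<sigma>. z powi (- n)) = c n"
proof (cases "Re (c 0) = 0")
  case True
  have "c n = 0" for n
  proof -
    have "(LINT z|circle_lebesgue. z powi (- n) * complex_of_real (cesaro N z)) = 0" for N
    proof -
      have "norm (LINT z|circle_lebesgue. z powi (- n) * complex_of_real (cesaro N z))
          \<le> (LINT z|circle_lebesgue. cmod (z powi (- n) * complex_of_real (cesaro N z)))"
        by (rule integral_norm_bound)
      also have "\<dots> = (LINT z|circle_lebesgue. cesaro N z)"
        by (rule Leb.integral_cong_circle)
           (simp only: norm_mult circle_norm_powi norm_of_real abs_of_nonneg cesaro_nonneg mult_1)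
      finally show ?thesis using True by (simp add: cesaro_integral)
    qed
    thus ?thesis using tendsto_moment[of n] by (simp add: LIMSEQ_const_iff)
  qed
  moreover have "circle_measure (null_measure circle_space)"
    unfolding circle_measure_def circle_measure_axioms_def
    by (intro conjI finite_measureI) simp_all
  ultimately show ?thesis by (intro that[of "null_measure circle_space"]) auto
next
  case False
  define r where "r = Re (c 0)"
  have r: "r > 0" using False c0(2) by (simp add: r_def)
  let ?L = "restrict_space lborel {0..<1::real}"
  let ?e = "\<lambda>t. cis (2 * pi * t)"
  have e_circle: "?e t \<in> unit_circle" for t by simp
  have e_meas: "?e \<in> ?L \<rightarrow>\<^sub>M circle_space" by (rule circle_lebesgue_measurable)
  define w where "w N t = cesaro N (?e t) / r" for N t
  have cesaro_meas[measurable]: "cesaro N \<in> borel_measurable circle_space" for N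
    unfolding circle_space_def by (intro borel_measurable_continuous_on_restrict continuous_cesaro)
  have w_meas[measurable]: "w N \<in> borel_measurable ?L" for N
    unfolding w_def using measurable_compose[OF e_meas cesaro_meas] by measurable
  have w_nonneg: "0 \<le> w N t" for N t
    unfolding w_def using r cesaro_nonneg[OF e_circle] by simp
  have w_integral: "(LINT t|?L. G (?e t) * complex_of_real (w N t))
      = (LINT z|circle_lebesgue. G z * complex_of_real (cesaro N z)) / of_real r"
    if "G \<in> borel_measurable circle_space" for G N
  proof -
    have "(LINT z|circle_lebesgue. G z * complex_of_real (cesaro N z) / of_real r)
        = (LINT t|?L. G (?e t) * complex_of_real (cesaro N (?e t)) / of_real r)"
      unfolding circle_lebesgue_def
      by (intro integral_distr e_meas borel_measurable_divide borel_measurable_times borel_measurable_const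
          that measurable_compose[OF cesaro_meas borel_measurable_continuous_onI] continuous_intros)
    from this[symmetric] show ?thesis by (simp add: w_def)
  qed
  define \<mu> where "\<mu> N = distr (density ?L (\<lambda>t. ennreal (w N t))) borel (\<lambda>t. 2 * pi * t)" for N
  have \<mu>_integral: "(LINT x|\<mu> N. H x) = (LINT t|?L. H (2 * pi * t) * complex_of_real (w N t))"
    if [measurable]: "H \<in> borel_measurable borel" for H :: "real \<Rightarrow> complex" and N
  proof -
    have "(LINT x|\<mu> N. H x) = (LINT t|density ?L (\<lambda>t. ennreal (w N t)). H (2 * pi * t))"
      unfolding \<mu>_def by (rule integral_distr) (auto simp: measurable_restrict_space1)
    also have "\<dots> = (LINT t|?L. w N t *\<^sub>R H (2 * pi * t))"
      using w_nonneg by (intro integral_density) (auto intro!: measurable_restrict_space1)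
    finally show ?thesis by (simp add: scaleR_conv_of_real mult.commute)
  qed
  have w_integrable: "integrable ?L (w N)" for N
  proof -
    have "integrable circle_lebesgue (\<lambda>z. cesaro N z / r)"
      using r by (intro Leb.continuous_integrable continuous_intros continuous_cesaro) auto
    hence "integrable ?L (\<lambda>t. cesaro N (?e t) / r)"
      unfolding circle_lebesgue_def
      by (subst (asm) integrable_distr_eq[OF e_meas]) (use cesaro_meas in measurable)
    thus ?thesis by (simp add: w_def[abs_def])
  qed
  have w_total: "(LINT t|?L. w N t) = 1" for N
  proof -
    have "complex_of_real (LINT t|?L. w N t) = 1"
      using w_integral[of "\<lambda>_. 1" N] r by (simp add: cesaro_integral r_def)
    thus ?thesis by (simp only: of_real_eq_1_iff)
  qed
  have em: "emeasure (density ?L (\<lambda>t. ennreal (w N t))) {0..<1} = 1" for N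
  proof -
    have "emeasure (density ?L (\<lambda>t. ennreal (w N t))) {0..<1} = (\<integral>\<^sup>+t\<in>{0..<1}. ennreal (w N t) \<partial>?L)"
      by (rule emeasure_density) (auto simp: sets_restrict_space)
    also have "\<dots> = (\<integral>\<^sup>+t. ennreal (w N t) \<partial>?L)"
      by (rule nn_integral_cong) (auto simp: space_restrict_space)
    also have "\<dots> = 1"
      using nn_integral_eq_integral[OF w_integrable[of N]] w_nonneg by (simp add: w_total)
    finally show ?thesis .
  qed
  have real_dist: "real_distribution (\<mu> N)" for N
  proof -
    have "prob_space (density ?L (\<lambda>t. ennreal (w N t)))"
      using em by (intro prob_spaceI) (simp add: space_restrict_space)
    hence "prob_space (\<mu> N)" unfolding \<mu>_def
      by (rule prob_space.prob_space_distr) (auto intro!: measurable_restrict_space1)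
    thus ?thesis unfolding real_distribution_def real_distribution_axioms_def by (simp add: \<mu>_def)
  qed
  have "tight \<mu>"
    unfolding tight_def
  proof (intro conjI allI impI real_dist)
    fix e :: real assume "e > 0"
    have "measure (\<mu> N) {- 1<..8} = 1" for N
    proof -
      have "2 * pi * t \<le> 8" if "t < 1" for t
      proof -
        have "2 * pi * t \<le> 2 * pi * 1" using that by (intro mult_left_mono) auto
        thus ?thesis using pi_less_4 by linarith
      qed
      moreover have "- 1 < 2 * pi * t" if "0 \<le> t" for t
        by (rule less_le_trans[OF _ mult_nonneg_nonneg[OF _ that]]) auto
      ultimately have "(\<lambda>t. 2 * pi * t) -` {- 1<..8} \<inter> space ?L = {0..<1}"
        by (auto simp: space_restrict_space)
      thus ?thesis unfolding \<mu>_def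
        by (subst measure_distr) (auto intro!: measurable_restrict_space1 simp: measure_def em)
    qed
    thus "\<exists>a b. a < b \<and> (\<forall>n. 1 - e < measure (\<mu> n) {a<..b})"
      using \<open>e > 0\<close> by (intro exI[of _ "- 1"] exI[of _ 8]) auto
  qed
  from tight_imp_convergent_subsubsequence[OF this strict_mono_id]
  obtain \<rho> M where M: "strict_mono \<rho>" "real_distribution M" "weak_conv_m (\<mu> \<circ> \<rho>) M"
    by (auto simp: comp_def id_def)
  interpret M: real_distribution M by fact
  define \<sigma> where "\<sigma> = distr (density M (\<lambda>_. ennreal r)) circle_space cis"
  have cis_meas: "cis \<in> borel \<rightarrow>\<^sub>M circle_space"
    unfolding circle_space_def
    by (intro measurable_restrict_space2 borel_measurable_continuous_onI continuous_on_cis continuous_on_id) auto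
  have "finite_measure (density M (\<lambda>_. ennreal r))"
    by (intro finite_measureI) (simp add: emeasure_density M.emeasure_space_1 ennreal_mult_eq_top_iff)
  hence circ: "circle_measure \<sigma>"
    unfolding circle_measure_def circle_measure_axioms_def \<sigma>_def
    using cis_meas by (auto intro!: finite_measure.finite_measure_distr)
  show ?thesis
  proof (rule that[OF circ])
    fix n
    have powi_meas: "(\<lambda>z::complex. z powi (- n)) \<in> borel_measurable circle_space"
      unfolding circle_space_def by (intro borel_measurable_continuous_on_restrict continuous_on_powi)
    have iexp_powi: "iexp (- of_int n * x) = cis x powi (- n)" for x :: real
      by (simp only: Complex.cis_power_int cis_conv_exp[symmetric] of_int_minus)
    have "(\<lambda>k. char ((\<mu> \<circ> \<rho>) k) (- of_int n)) \<longlonglongrightarrow> char M (- of_int n)"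
      using real_dist M by (intro levy_continuity1) (simp_all only: comp_def)
    moreover have "char (\<mu> N) (- of_int n) = (LINT z|circle_lebesgue. z powi (- n) * complex_of_real (cesaro N z)) / of_real r" for N
    proof -
      have "char (\<mu> N) (- of_int n) = (LINT t|?L. iexp (- of_int n * (2 * pi * t)) * complex_of_real (w N t))"
        unfolding char_def by (rule \<mu>_integral) measurable
      also have "\<dots> = (LINT t|?L. ?e t powi (- n) * complex_of_real (w N t))"
        by (simp only: iexp_powi)
      finally show ?thesis by (simp only: w_integral[OF powi_meas])
    qed
    ultimately have "(\<lambda>k. (LINT z|circle_lebesgue. z powi (- n) * complex_of_real (cesaro (\<rho> k) z)) / of_real r) \<longlonglongrightarrow> char M (- of_int n)"
      by (simp add: comp_def)
    moreover have "(\<lambda>k. (LINT z|circle_lebesgue. z powi (- n) * complex_of_real (cesaro (\<rho> k) z)) / of_real r) \<longlonglongrightarrow> c n / of_real r"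
      using LIMSEQ_subseq_LIMSEQ[OF tendsto_moment M(1)] r
      by (intro tendsto_divide tendsto_const) (simp_all add: comp_def)
    ultimately have "char M (- of_int n) = c n / of_real r" by (rule LIMSEQ_unique)
    moreover have "(LINT z|\<sigma>. z powi (- n)) = of_real r * char M (- of_int n)"
    proof -
      have "(LINT z|\<sigma>. z powi (- n)) = (LINT x|density M (\<lambda>_. ennreal r). cis x powi (- n))"
        unfolding \<sigma>_def using cis_meas by (intro integral_distr powi_meas) auto
      also have "\<dots> = (LINT x|M. r *\<^sub>R cis x powi (- n))"
        using r measurable_compose[OF cis_meas powi_meas] by (intro integral_density) auto
      also have "\<dots> = of_real r * (LINT x|M. cis x powi (- n))" by (simp add: scaleR_conv_of_real)
      also have "(LINT x|M. cis x powi (- n)) = char M (- of_int n)"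
        unfolding char_def by (simp only: iexp_powi)
      finally show ?thesis .
    qed
    ultimately show "(LINT z|\<sigma>. z powi (- n)) = c n" using r by simp
  qed
qed

end

section \<open>The rank one transformation\<close>

locale rank_one =
  fixes p :: "nat \<Rightarrow> nat" and a :: "nat \<Rightarrow> nat \<Rightarrow> nat" and b :: "nat \<Rightarrow> nat \<Rightarrow> real" and T :: "real \<Rightarrow> real"
  assumes columns: "\<And>k. p k \<ge> 2"
    and transformation: "rank_one_transformation p a b T"
begin

abbreviation "h \<equiv> height p a"
abbreviation "lev \<equiv> level p b"
abbreviation "M \<equiv> rank_one_space p a b"

definition X :: "real set" where
  "X = (\<Union>k. \<Union>i<h k. lev k i)"

definition pos :: "nat \<Rightarrow> nat \<Rightarrow> nat \<Rightarrow> nat" where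
  "pos k j i = j * h k + spacer_sum a k j + i"

text \<open>
  The points of stack \<open>k\<close> on which \<open>T\<close> is determined by stack \<open>k\<close>.
\<close>

definition below_top :: "nat \<Rightarrow> real \<Rightarrow> bool" where
  "below_top k x \<longleftrightarrow> (\<exists>i. Suc i < h k \<and> x \<in> lev k i)"

lemma p_pos: "0 < p k"
  using columns[of k] by simp

lemma h_pos: "0 < h k"
  using height_gt[of p k a] columns by simp

lemma width_pos': "0 < width p k"
  by (rule width_pos) (rule p_pos)

lemma cutting: "cutting_and_stacking p a b"
  using transformation by (simp add: rank_one_transformation_def)

lemma T_level: "Suc i < h k \<Longrightarrow> x \<in> lev k i \<Longrightarrow> T x = x + (b k (Suc i) - b k i)"
  using transformation by (simp add: rank_one_transformation_def)

lemma b_pos: "j < p k \<Longrightarrow> i < h k \<Longrightarrow> b (Suc k) (pos k j i) = b k i + real j * width p (Suc k)"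
  using cutting unfolding cutting_and_stacking_def pos_def by blast

lemma level_unique: "x \<in> lev k i \<Longrightarrow> x \<in> lev k i' \<Longrightarrow> i < h k \<Longrightarrow> i' < h k \<Longrightarrow> i = i'"
  using cutting unfolding cutting_and_stacking_def disjoint_family_on_def by blast

lemma h_Suc: "h (Suc k) = p k * h k + spacer_sum a k (p k)"
  by (simp add: spacer_sum_def)

lemma pos_less: "j < p k \<Longrightarrow> i < h k \<Longrightarrow> pos k j i < h (Suc k)"
proof -
  assume "j < p k" "i < h k"
  hence "Suc j * h k \<le> p k * h k" "spacer_sum a k j \<le> spacer_sum a k (p k)"
    by (intro mult_le_mono1 spacer_sum_mono, simp)+
  thus ?thesis using \<open>i < h k\<close> unfolding h_Suc pos_def by simp
qed

lemma level_split: "i < h k \<Longrightarrow> lev k i = (\<Union>j<p k. lev (Suc k) (pos k j i))"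
proof (intro equalityI subsetI)
  define v where "v = width p (Suc k)"
  have v: "v > 0" unfolding v_def by (rule width_pos')
  have pv: "width p k = real (p k) * v" using p_pos[of k] by (simp add: v_def width_Suc)
  fix x assume i: "i < h k"
  {
    assume "x \<in> lev k i"
    hence x: "0 \<le> (x - b k i) / v" "(x - b k i) / v < real (p k)"
      using v by (auto simp: level_def pv divide_simps)
    define j where "j = nat \<lfloor>(x - b k i) / v\<rfloor>"
    have j: "j < p k" "real j \<le> (x - b k i) / v" "(x - b k i) / v < real j + 1"
      using x unfolding j_def by linarith+
    hence "x \<in> lev (Suc k) (pos k j i)"
      unfolding level_def b_pos[OF j(1) i] v_def[symmetric] using v by (auto simp: field_simps)
    thus "x \<in> (\<Union>j<p k. lev (Suc k) (pos k j i))" using j(1) by blast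
  next
    assume "x \<in> (\<Union>j<p k. lev (Suc k) (pos k j i))"
    then obtain j where j: "j < p k" "x \<in> lev (Suc k) (pos k j i)" by blast
    hence x: "b k i + real j * v \<le> x" "x < b k i + real j * v + v"
      by (auto simp: level_def b_pos[OF j(1) i] v_def)
    have "(real j + 1) * v \<le> real (p k) * v" using j v by (intro mult_right_mono) auto
    moreover have "0 \<le> real j * v" using v by simp
    ultimately have "b k i \<le> x" "x < b k i + real (p k) * v" using x unfolding distrib_right mult_1 by linarith+
    thus "x \<in> lev k i" unfolding level_def pv by simp
  }
qed

lemma below_top_Suc: "below_top k x \<Longrightarrow> below_top (Suc k) x"
proof -
  assume "below_top k x"
  then obtain i where i: "Suc i < h k" "x \<in> lev k i" unfolding below_top_def by blast
  then obtain j where j: "j < p k" "x \<in> lev (Suc k) (pos k j i)" using level_split[of i k] by auto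
  have "pos k j (Suc i) < h (Suc k)" using j i by (intro pos_less)
  thus ?thesis unfolding below_top_def using j by (intro exI[of _ "pos k j i"]) (simp add: pos_def)
qed

lemma below_top_mono: "k \<le> k' \<Longrightarrow> below_top k x \<Longrightarrow> below_top k' x"
  by (induction k' rule: dec_induct) (auto intro: below_top_Suc)

definition stack :: "nat \<Rightarrow> real set" where
  "stack k = (\<Union>i<h k. lev k i)"

lemma X_stack: "X = (\<Union>k. stack k)"
  by (simp add: X_def stack_def)

lemma incseq_stack: "incseq stack"
proof (rule incseq_SucI)
  fix k show "stack k \<subseteq> stack (Suc k)"
  proof
    fix x assume "x \<in> stack k"
    then obtain i where i: "i < h k" "x \<in> lev k i" unfolding stack_def by blast
    then obtain j where "j < p k" "x \<in> lev (Suc k) (pos k j i)" using level_split[of i k] by auto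
    thus "x \<in> stack (Suc k)" unfolding stack_def using pos_less i by blast
  qed
qed

lemma stack_mono: "k \<le> k' \<Longrightarrow> stack k \<subseteq> stack k'"
  using incseq_stack by (simp add: incseq_def)

lemma width_le: "width p k \<le> (1 / 2) ^ k"
proof (induction k)
  case (Suc k)
  have "width p (Suc k) \<le> width p k / 2"
    unfolding width_Suc using columns[of k] width_pos'[of k] by (intro divide_left_mono) auto
  then show ?case using Suc by simp
qed (simp add: width_def)

lemma width_small: "0 < e \<Longrightarrow> \<exists>k\<ge>k0. width p k < e"
proof -
  assume "0 < e"
  then obtain n where n: "(1 / 2) ^ n < e" using real_arch_pow_inv[of e "1 / 2"] by auto
  have "width p (max k0 n) \<le> (1 / 2) ^ max k0 n" by (rule width_le)
  also have "\<dots> \<le> (1 / 2) ^ n" by (intro power_decreasing) auto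
  finally show ?thesis using n by (intro exI[of _ "max k0 n"]) auto
qed

lemma b_0: "b k 0 = 0"
proof (induction k)
  case 0
  show ?case using cutting unfolding cutting_and_stacking_def by blast
next
  case (Suc k)
  have "b (Suc k) (pos k 0 0) = b k 0 + real 0 * width p (Suc k)"
    by (intro b_pos p_pos h_pos)
  moreover have "pos k 0 0 = 0" by (simp add: pos_def spacer_sum_def)
  ultimately show ?case using Suc by simp
qed

lemma zero_in_base: "0 \<in> lev k 0"
  using width_pos'[of k] by (simp add: level_def b_0)

text \<open>
  A point that lies in the top level of every stack from some stage on is always in the last column
  and never under a spacer; the right endpoint of the top level then never changes while the widths
  shrink to 0, which is impossible for half-open levels.
\<close>

lemma below_top_exists:
  assumes "x \<in> X"
  shows "\<exists>k. below_top k x"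
proof (rule ccontr)
  assume none: "\<nexists>k. below_top k x"
  obtain k i where ki: "i < h k" "x \<in> lev k i" using assms unfolding X_def by blast
  hence "i = h k - 1" using none unfolding below_top_def by (metis Suc_lessI diff_Suc_1)
  define r where "r = b k (h k - 1) + width p k"
  have top: "x \<in> lev (k + n) (h (k + n) - 1) \<and> b (k + n) (h (k + n) - 1) + width p (k + n) = r" for n
  proof (induction n)
    case 0
    show ?case using ki \<open>i = h k - 1\<close> by (simp add: r_def)
  next
    case (Suc n)
    define l where "l = k + n"
    have t: "h l - 1 < h l" using h_pos[of l] by simp
    obtain j where j: "j < p l" "x \<in> lev (Suc l) (pos l j (h l - 1))"
      using Suc level_split[OF t] by (auto simp: l_def)
    have P: "pos l j (h l - 1) < h (Suc l)" by (rule pos_less[OF j(1) t])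
    have "\<not> Suc (pos l j (h l - 1)) < h (Suc l)" using none j unfolding below_top_def by blast
    hence top: "pos l j (h l - 1) = h (Suc l) - 1" using P by simp
    have eq: "Suc j * h l + spacer_sum a l j = p l * h l + spacer_sum a l (p l)"
      using top P h_pos[of l] unfolding pos_def h_Suc by simp
    have "Suc j = p l"
    proof (rule ccontr)
      assume "Suc j \<noteq> p l"
      hence "Suc (Suc j) * h l \<le> p l * h l" using j by (intro mult_le_mono1) simp
      thus False using eq spacer_sum_mono[of j "p l" a l] j h_pos[of l] by simp
    qed
    hence "b (Suc l) (pos l j (h l - 1)) + width p (Suc l) = b l (h l - 1) + real (p l) * width p (Suc l)"
      using b_pos[OF j(1) t] by (simp add: algebra_simps flip: \<open>Suc j = p l\<close>)
    also have "real (p l) * width p (Suc l) = width p l" using p_pos[of l] by (simp add: width_Suc)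
    finally show ?case using Suc j unfolding top by (simp add: l_def)
  qed
  have "x < r" using top[of 0] by (auto simp: level_def)
  then obtain k' where "k' \<ge> k" "width p k' < r - x" using width_small[of "r - x" k] by auto
  moreover obtain n where "k' = k + n" using \<open>k' \<ge> k\<close> le_Suc_ex by blast
  ultimately show False using top[of n] by (auto simp: level_def)
qed

text \<open>
  The bases are the intervals from 0 to the width, which shrink to \<open>{0}\<close>.
\<close>

lemma above_base_exists:
  assumes "x \<in> X" "x \<noteq> 0"
  shows "\<exists>k i. Suc i < h k \<and> x \<in> lev k (Suc i)"
proof -
  obtain k i where ki: "i < h k" "x \<in> lev k i" using assms unfolding X_def by blast
  show ?thesis
  proof (cases i)
    case (Suc i')
    then show ?thesis using ki by blast
  next
    case 0
    hence "0 < x" using ki assms(2) by (simp add: level_def b_0)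
    then obtain k' where k': "k' \<ge> k" "width p k' < x" using width_small by blast
    have "x \<in> stack k'" using ki stack_mono[OF k'(1)] unfolding stack_def by blast
    then obtain i' where i': "i' < h k'" "x \<in> lev k' i'" unfolding stack_def by blast
    have "i' \<noteq> 0"
    proof
      assume "i' = 0"
      thus False using i' k' by (simp add: level_def b_0)
    qed
    then show ?thesis using i' by (cases i') auto
  qed
qed

lemma T_level_image: "Suc i < h k \<Longrightarrow> x \<in> lev k i \<Longrightarrow> T x \<in> lev k (Suc i)"
  using T_level[of i k x] by (auto simp: level_def)

lemma level_subset_X: "i < h k \<Longrightarrow> lev k i \<subseteq> X"
  unfolding X_def by blast

lemma T_in_X: "x \<in> X \<Longrightarrow> T x \<in> X"
  using below_top_exists[of x] T_level_image level_subset_X unfolding below_top_def by blast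

lemma T_nonzero: "x \<in> X \<Longrightarrow> T x \<noteq> 0"
proof
  assume "x \<in> X" "T x = 0"
  then obtain k i where "Suc i < h k" "x \<in> lev k i"
    using below_top_exists[of x] unfolding below_top_def by blast
  hence "0 \<in> lev k (Suc i)" "Suc i < h k" using T_level_image[of i k x] \<open>T x = 0\<close> by auto
  thus False using level_unique[OF zero_in_base, of k "Suc i"] h_pos[of k] by simp
qed

lemma T_inj: "inj_on T X"
proof (rule inj_onI)
  fix x y assume x: "x \<in> X" and y: "y \<in> X" and eq: "T x = T y"
  obtain k k' where "below_top k x" "below_top k' y" using below_top_exists x y by blast
  hence "below_top (max k k') x" "below_top (max k k') y"
    using below_top_mono[of k "max k k'"] below_top_mono[of k' "max k k'"] by auto
  then obtain i i' where i: "Suc i < h (max k k')" "x \<in> lev (max k k') i"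
    and i': "Suc i' < h (max k k')" "y \<in> lev (max k k') i'"
    unfolding below_top_def by blast
  have "T y \<in> lev (max k k') (Suc i)" using T_level_image[OF i] eq by simp
  hence "Suc i = Suc i'" using T_level_image[OF i'] i(1) i'(1) by (rule level_unique)
  hence "x + (b (max k k') (Suc i) - b (max k k') i) = y + (b (max k k') (Suc i) - b (max k k') i)"
    using T_level[OF i] T_level[OF i'] eq by (simp only: nat.inject)
  thus "x = y" by (simp only: add_right_cancel)
qed

lemma T_surj: "x \<in> X \<Longrightarrow> x \<noteq> 0 \<Longrightarrow> \<exists>y\<in>X. T y = x"
proof -
  assume "x \<in> X" "x \<noteq> 0"
  then obtain k i where ki: "Suc i < h k" "x \<in> lev k (Suc i)" using above_base_exists by blast
  define y where "y = x - (b k (Suc i) - b k i)"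
  have y: "y \<in> lev k i" using ki by (auto simp: y_def level_def)
  hence "T y = x" using T_level[OF ki(1)] by (simp add: y_def)
  thus ?thesis using y level_subset_X[of i k] ki by auto
qed

lemma space_M: "space M = X"
  by (simp add: rank_one_space_def X_def space_restrict_space)

lemma sets_level: "lev k i \<in> sets borel"
  by (simp add: level_def)

lemma sets_X: "X \<in> sets borel"
  unfolding X_def by (intro sets.countable_UN image_subsetI sets.finite_UN sets_level finite_lessThan)

lemma M_restrict: "M = restrict_space lborel X"
  by (simp add: rank_one_space_def X_def)

lemma sets_M_iff: "A \<in> sets M \<longleftrightarrow> A \<subseteq> X \<and> A \<in> sets borel"
  unfolding M_restrict using sets_X by (subst sets_restrict_space_iff) auto

lemma emeasure_M: "A \<in> sets M \<Longrightarrow> emeasure M A = emeasure lborel A"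
  unfolding M_restrict using sets_X
  by (intro emeasure_restrict_space) (auto simp: sets_restrict_space)

lemma measurable_M_by_pieces:
  assumes "countable I" "\<And>A. A \<in> I \<Longrightarrow> A \<in> sets borel" "X \<subseteq> \<Union>I"
    and "\<And>A. A \<in> I \<Longrightarrow> \<exists>c. \<forall>x\<in>A. f x = x + c" and "\<And>x. x \<in> X \<Longrightarrow> f x \<in> X"
  shows "f \<in> M \<rightarrow>\<^sub>M M"
proof -
  have "f \<in> borel_measurable M"
  proof (rule measurable_piecewise_restrict[OF assms(1)])
    fix A assume A: "A \<in> I"
    show "A \<inter> space M \<in> sets M"
      using assms(2)[OF A] sets_X by (auto simp: sets_M_iff space_M)
    obtain c where c: "\<forall>x\<in>A. f x = x + c" using assms(4)[OF A] by blast
    have "(\<lambda>x. x + c) \<in> borel_measurable (restrict_space M A)"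
      unfolding M_restrict by (intro measurable_restrict_space1) simp
    thus "f \<in> borel_measurable (restrict_space M A)"
      by (rule measurable_cong[THEN iffD1, rotated]) (use c in \<open>simp add: space_restrict_space\<close>)
  qed (use assms(3) in \<open>simp add: space_M\<close>)
  hence "f \<in> M \<rightarrow>\<^sub>M restrict_space borel X"
    by (intro measurable_restrict_space2) (auto simp: space_M assms(5))
  thus ?thesis
    by (subst (2) M_restrict) (simp add: measurable_cong_sets[OF refl sets_restrict_space_cong[of borel lborel X]])
qed

lemma T_measurable: "T \<in> M \<rightarrow>\<^sub>M M"
proof (rule measurable_M_by_pieces)
  let ?I = "(\<lambda>(k, i). lev k i) ` {(k, i). Suc i < h k}"
  show "countable ?I" by simp
  show "A \<in> sets borel" if "A \<in> ?I" for A using that sets_level by auto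
  show "X \<subseteq> \<Union>?I"
    using below_top_exists unfolding below_top_def by fastforce
  show "\<exists>c. \<forall>x\<in>A. T x = x + c" if "A \<in> ?I" for A
  proof -
    obtain k i where "Suc i < h k" "A = lev k i" using \<open>A \<in> ?I\<close> by auto
    thus ?thesis using T_level[of i k] by blast
  qed
qed (rule T_in_X)

text \<open>
  A measurable left inverse of \<open>T\<close>. At 0, the only point that is not in the image of \<open>T\<close>, the value is
  chosen within the space.
\<close>

definition S :: "real \<Rightarrow> real" where
  "S x = (if x = 0 then 0 else inv_into X T x)"

lemma S_T: "x \<in> X \<Longrightarrow> S (T x) = x"
  using T_nonzero[of x] by (simp add: S_def inv_into_f_f[OF T_inj])

lemma zero_in_X: "0 \<in> X"
  using zero_in_base[of 0] level_subset_X[OF h_pos[of 0]] by blast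

lemma S_measurable: "S \<in> M \<rightarrow>\<^sub>M M"
proof (rule measurable_M_by_pieces)
  let ?I = "insert {0} ((\<lambda>(k, i). lev k (Suc i)) ` {(k, i). Suc i < h k})"
  show "countable ?I" by simp
  show "A \<in> sets borel" if "A \<in> ?I" for A using that sets_level by auto
  show "X \<subseteq> \<Union>?I"
    using above_base_exists by fastforce
  show "\<exists>c. \<forall>x\<in>A. S x = x + c" if A: "A \<in> ?I" for A
  proof (cases "A = {0}")
    case True
    then show ?thesis by (auto simp: S_def)
  next
    case False
    then obtain k i where ki: "Suc i < h k" "A = lev k (Suc i)" using A by blast
    have "S x = x + (b k i - b k (Suc i))" if x: "x \<in> A" for x
    proof -
      define y where "y = x - (b k (Suc i) - b k i)"
      have y: "y \<in> lev k i" using x ki by (auto simp: y_def level_def)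
      hence "T y = x" using T_level[OF ki(1)] by (simp add: y_def)
      moreover have "y \<in> X" using y level_subset_X[of i k] ki by auto
      ultimately show ?thesis using S_T[of y] by (simp add: y_def)
    qed
    thus ?thesis by blast
  qed
  show "S x \<in> X" if x: "x \<in> X" for x
  proof (cases "x = 0")
    case True
    then show ?thesis using zero_in_X by (simp add: S_def)
  next
    case False
    then obtain y where "y \<in> X" "T y = x" using T_surj[OF x] by blast
    then show ?thesis using S_T[of y] by simp
  qed
qed

text \<open>
  \<open>T\<close> translates the non-top levels of stack \<open>k\<close> onto its non-base levels. The former exhaust the space
  as \<open>k\<close> grows, and the latter exhaust it up to the point 0.
\<close>

lemma T_preserving: "distr M M T = M"
proof (rule measure_eqI)
  fix A assume "A \<in> sets (distr M M T)"
  hence A: "A \<in> sets M" "A \<in> sets borel" "A \<subseteq> X" by (auto simp: sets_M_iff)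
  define B where "B k = (\<Union>i<h k - 1. lev k i)" for k
  define C where "C k = (\<Union>i<h k - 1. lev k (Suc i))" for k
  define D where "D = T -` A \<inter> X"
  have D: "D \<in> sets M" "D \<in> sets borel" "D \<subseteq> X"
    using measurable_sets[OF T_measurable A(1)] by (auto simp: D_def space_M sets_M_iff)
  have B_iff: "x \<in> B k \<longleftrightarrow> below_top k x" for x k
    by (auto simp: B_def below_top_def less_diff_conv)
  have inc_B: "incseq (\<lambda>k. D \<inter> B k)"
  proof (rule incseq_SucI)
    show "D \<inter> B k \<subseteq> D \<inter> B (Suc k)" for k
      using B_iff[of _ k] B_iff[of _ "Suc k"] below_top_Suc[of k] by blast
  qed
  have UN_B: "(\<Union>k. D \<inter> B k) = D"
    using D(3) below_top_exists by (auto simp: B_iff)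
  have C_image: "C k = T ` B k" for k
  proof (intro equalityI subsetI)
    fix x assume "x \<in> C k"
    then obtain i where i: "Suc i < h k" "x \<in> lev k (Suc i)"
      unfolding C_def by (metis UN_E lessThan_iff less_diff_conv Suc_eq_plus1)
    have y: "x - (b k (Suc i) - b k i) \<in> lev k i" using i by (auto simp: level_def)
    hence "T (x - (b k (Suc i) - b k i)) = x" using T_level[OF i(1)] by simp
    moreover have "x - (b k (Suc i) - b k i) \<in> B k" using y i by (auto simp: B_def)
    ultimately show "x \<in> T ` B k" by (metis image_eqI)
  next
    fix x assume "x \<in> T ` B k"
    then obtain y where y: "x = T y" "y \<in> B k" by blast
    then obtain i where i: "Suc i < h k" "y \<in> lev k i" unfolding B_iff below_top_def by blast
    hence "x \<in> lev k (Suc i)" "i < h k - 1" using T_level_image[of i k y] y by auto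
    thus "x \<in> C k" by (auto simp: C_def)
  qed
  have inc_C: "incseq (\<lambda>k. A \<inter> C k)"
  proof (rule incseq_SucI)
    show "A \<inter> C k \<subseteq> A \<inter> C (Suc k)" for k
      unfolding C_image using B_iff[of _ k] B_iff[of _ "Suc k"] below_top_Suc[of k] by blast
  qed
  have UN_C: "(\<Union>k. A \<inter> C k) = A - {0}"
  proof (intro equalityI subsetI)
    fix x assume "x \<in> (\<Union>k. A \<inter> C k)"
    then obtain k where "x \<in> A" "x \<in> T ` B k" unfolding C_image by blast
    then obtain y where y: "x \<in> A" "x = T y" "y \<in> B k" by blast
    hence "below_top k y" by (simp only: B_iff)
    then obtain i where "Suc i < h k" "y \<in> lev k i" unfolding below_top_def by blast
    hence "y \<in> X" using level_subset_X[of i k] by auto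
    thus "x \<in> A - {0}" using y T_nonzero[of y] by simp
  next
    fix x assume "x \<in> A - {0}"
    then obtain y where y: "y \<in> X" "T y = x" using T_surj[of x] A(3) by blast
    then obtain k where "y \<in> B k" unfolding B_iff using below_top_exists[of y] by auto
    hence "x \<in> C k" unfolding C_image y(2)[symmetric] by (rule imageI)
    thus "x \<in> (\<Union>k. A \<inter> C k)" using \<open>x \<in> A - {0}\<close> by blast
  qed
  have piece: "emeasure lborel (D \<inter> lev k i) = emeasure lborel (A \<inter> lev k (Suc i))" if "Suc i < h k" for k i
  proof -
    define c where "c = b k (Suc i) - b k i"
    have T_c: "T x = c + x" if "x \<in> lev k i" for x
      using T_level[OF \<open>Suc i < h k\<close> that] by (simp add: c_def)
    have lev_c: "c + x \<in> lev k (Suc i) \<longleftrightarrow> x \<in> lev k i" for x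
      by (auto simp: level_def c_def)
    have "lev k i \<subseteq> X" using that by (intro level_subset_X) simp
    hence "D \<inter> lev k i = (\<lambda>x. c + x) -` (A \<inter> lev k (Suc i))"
      using T_c unfolding D_def by (auto simp: lev_c)
    hence "emeasure lborel (D \<inter> lev k i) = emeasure (distr lborel borel (\<lambda>x. c + x)) (A \<inter> lev k (Suc i))"
      using A sets_level by (subst emeasure_distr) auto
    thus ?thesis by (simp add: lborel_distr_plus)
  qed
  have stage: "emeasure lborel (D \<inter> B k) = emeasure lborel (A \<inter> C k)" for k
  proof -
    have dB: "disjoint_family_on (\<lambda>i. D \<inter> lev k i) {..<h k - 1}"
      and dC: "disjoint_family_on (\<lambda>i. A \<inter> lev k (Suc i)) {..<h k - 1}"
      unfolding disjoint_family_on_def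
    proof (safe)
      fix i i' x assume "i < h k - 1" "i' < h k - 1" "i \<noteq> i'" "x \<in> lev k i" "x \<in> lev k i'"
      thus "x \<in> {}" using level_unique[of x k i i'] by linarith
    next
      fix i i' x assume "i < h k - 1" "i' < h k - 1" "i \<noteq> i'" "x \<in> lev k (Suc i)" "x \<in> lev k (Suc i')"
      thus "x \<in> {}" using level_unique[of x k "Suc i" "Suc i'"] by linarith
    qed
    have "emeasure lborel (D \<inter> B k) = (\<Sum>i<h k - 1. emeasure lborel (D \<inter> lev k i))"
      using dB D(2) sets_level unfolding B_def by (subst sum_emeasure) auto
    also have "\<dots> = (\<Sum>i<h k - 1. emeasure lborel (A \<inter> lev k (Suc i)))"
      by (intro sum.cong refl piece) auto
    also have "\<dots> = emeasure lborel (A \<inter> C k)"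
      using dC A(2) sets_level unfolding C_def by (subst sum_emeasure) auto
    finally show ?thesis .
  qed
  have B_sets: "B k \<in> sets borel" and C_sets: "C k \<in> sets borel" for k
    unfolding B_def C_def by (intro sets.finite_UN sets_level finite_lessThan)+
  have "emeasure lborel D = (SUP k. emeasure lborel (D \<inter> B k))"
    by (rule SUP_emeasure_incseq[OF _ inc_B, unfolded UN_B, symmetric]) (use D(2) B_sets in auto)
  also have "\<dots> = emeasure lborel (A - {0})"
    unfolding stage
    by (rule SUP_emeasure_incseq[OF _ inc_C, unfolded UN_C]) (use A(2) C_sets in auto)
  also have "\<dots> = emeasure lborel A"
    using A(2) by (intro emeasure_Diff_null_set) auto
  finally show "emeasure (distr M M T) A = emeasure M A"
    using A D by (simp add: emeasure_distr T_measurable emeasure_M space_M flip: D_def)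
qed simp

end

section \<open>Correlations and spectral measures\<close>

text \<open>
  A substitute for the equality of \<open>\<mu>\<close> and the measure with density \<open>w\<close> with respect to \<open>\<nu>\<close>.
\<close>

lemma trig_integral_transfer:
  assumes \<mu>: "circle_measure \<mu>" and \<nu>: "circle_measure \<nu>" and w: "continuous_on unit_circle w"
    and moments: "\<And>n. (LINT z|\<mu>. z powi n) = (LINT z|\<nu>. z powi n * w z)"
    and F: "trig UNIV F"
  shows "(LINT z|\<mu>. F z) = (LINT z|\<nu>. F z * w z)"
  using F
proof (induction rule: trig.induct)
  interpret \<mu>: circle_measure \<mu> by fact
  interpret \<nu>: circle_measure \<nu> by fact
  {
    case (trig_zero F)
    have "(LINT z|\<mu>. F z) = (LINT z|\<mu>. 0)"
      by (rule \<mu>.integral_cong_circle) (simp only: trig_zero)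
    moreover have "(LINT z|\<nu>. F z * w z) = (LINT z|\<nu>. 0)"
      by (rule \<nu>.integral_cong_circle) (simp only: trig_zero mult_zero_left)
    ultimately show ?case by simp
  next
    case (trig_step H n F c)
    have cH: "continuous_on unit_circle H" by (rule trig_continuous[OF trig_step.hyps(1)])
    have i: "integrable \<mu> H" "integrable \<mu> (\<lambda>z. z powi n)"
      "integrable \<nu> (\<lambda>z. H z * w z)" "integrable \<nu> (\<lambda>z. z powi n * w z)"
      by (intro \<mu>.continuous_integrable \<nu>.continuous_integrable continuous_on_mult cH w continuous_on_powi)+
    have "(LINT z|\<mu>. F z) = (LINT z|\<mu>. H z + c * z powi n)"
      by (rule \<mu>.integral_cong_circle) (simp only: trig_step.hyps(3))
    also have "\<dots> = (LINT z|\<mu>. H z) + c * (LINT z|\<mu>. z powi n)" using i by simp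
    also have "\<dots> = (LINT z|\<nu>. H z * w z) + c * (LINT z|\<nu>. z powi n * w z)"
      by (simp only: trig_step.IH moments)
    also have "\<dots> = (LINT z|\<nu>. H z * w z + c * (z powi n * w z))" using i by simp
    also have "\<dots> = (LINT z|\<nu>. F z * w z)"
      by (rule \<nu>.integral_cong_circle) (simp only: trig_step.hyps(3) distrib_right mult.assoc)
    finally show ?case .
  }
qed

lemma trig_real_integral_transfer:
  assumes "circle_measure \<mu>" "circle_measure \<nu>" "continuous_on unit_circle w"
    and "\<And>n. (LINT z|\<mu>. z powi n) = (LINT z|\<nu>. z powi n * complex_of_real (w z))"
    and "trig UNIV (\<lambda>z. complex_of_real (g z))"
  shows "(LINT z|\<mu>. g z) = (LINT z|\<nu>. g z * w z)"
proof -
  have "(LINT z|\<mu>. complex_of_real (g z)) = (LINT z|\<nu>. complex_of_real (g z) * complex_of_real (w z))"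
    by (rule trig_integral_transfer[OF assms(1,2) _ assms(4,5)]) (intro continuous_on_of_real assms(3))
  hence "complex_of_real (LINT z|\<mu>. g z) = complex_of_real (LINT z|\<nu>. g z * w z)"
    by (simp only: of_real_mult[symmetric] integral_complex_of_real)
  thus ?thesis by (simp only: of_real_eq_iff)
qed

lemma cnj_measurable [measurable]: "cnj \<in> borel_measurable borel"
  by (intro borel_measurable_continuous_onI continuous_on_cnj continuous_on_id)

lemma norm_add_sq_le: "(cmod (u + v))\<^sup>2 \<le> 2 * (cmod u)\<^sup>2 + 2 * (cmod v)\<^sup>2"
proof -
  have "(cmod (u + v))\<^sup>2 \<le> (cmod u + cmod v)\<^sup>2"
    by (intro power_mono norm_triangle_ineq) simp
  thus ?thesis using sum_squares_bound[of "cmod u" "cmod v"] by (simp add: power2_sum)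
qed

lemma mult_cnj_measurable:
  fixes f g :: "'a \<Rightarrow> complex"
  assumes "f \<in> borel_measurable N" "g \<in> borel_measurable N"
  shows "(\<lambda>x. f x * cnj (g x)) \<in> borel_measurable N"
  by (intro borel_measurable_times assms measurable_compose[OF assms(2) cnj_measurable])

context rank_one
begin

definition corr :: "(real \<Rightarrow> complex) \<Rightarrow> int \<Rightarrow> complex" where
  "corr f n = (LINT x|M. f (int_iterate M T n x) * cnj (f x))"

lemma T_pow_measurable: "(T ^^ n) \<in> M \<rightarrow>\<^sub>M M"
proof (induction n)
  case 0
  show ?case by (simp add: id_def)
next
  case (Suc n)
  show ?case using measurable_comp[OF Suc T_measurable] by (simp add: comp_def)
qed

lemma T_pow_preserving: "distr M M (T ^^ n) = M"
proof (induction n)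
  case 0
  show ?case by (simp add: distr_id2)
next
  case (Suc n)
  have "distr M M (T ^^ Suc n) = distr (distr M M (T ^^ n)) M T"
    by (subst distr_distr[OF T_measurable T_pow_measurable]) (simp only: funpow.simps)
  then show ?case by (simp only: Suc T_preserving)
qed

lemma T_pow_X: "x \<in> X \<Longrightarrow> (T ^^ n) x \<in> X"
  by (induction n) (auto intro: T_in_X)

lemma integral_T_pow:
  fixes F :: "real \<Rightarrow> 'b :: {banach, second_countable_topology}"
  shows "F \<in> borel_measurable M \<Longrightarrow> (LINT x|M. F ((T ^^ n) x)) = (LINT x|M. F x)"
  using integral_distr[OF T_pow_measurable[of n], of F] by (simp add: T_pow_preserving)

lemma integrable_T_pow:
  fixes F :: "real \<Rightarrow> 'b :: {banach, second_countable_topology}"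
  shows "F \<in> borel_measurable M \<Longrightarrow> integrable M (\<lambda>x. F ((T ^^ n) x)) \<longleftrightarrow> integrable M F"
  using integrable_distr_eq[OF T_pow_measurable[of n], of F] by (simp add: T_pow_preserving)

abbreviation "L2 \<equiv> L2_function M"

lemma L2_measurable: "L2 f \<Longrightarrow> f \<in> borel_measurable M"
  by (simp add: L2_function_def)

lemma L2_integrable: "L2 f \<Longrightarrow> integrable M (\<lambda>x. (cmod (f x))\<^sup>2)"
  by (simp add: L2_function_def)

lemma L2_T_pow: "L2 f \<Longrightarrow> L2 (\<lambda>x. f ((T ^^ n) x))"
proof -
  assume f: "L2 f"
  note [measurable] = L2_measurable[OF f] T_pow_measurable
  have "integrable M (\<lambda>x. (cmod (f ((T ^^ n) x)))\<^sup>2)"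
    using integrable_T_pow[of "\<lambda>x. (cmod (f x))\<^sup>2" n] L2_integrable[OF f] by simp
  thus ?thesis unfolding L2_function_def by (intro conjI) measurable
qed

lemma L2_product: "L2 f \<Longrightarrow> L2 g \<Longrightarrow> integrable M (\<lambda>x. f x * cnj (g x))"
proof (rule Bochner_Integration.integrable_bound[where f = "\<lambda>x. (cmod (f x))\<^sup>2 + (cmod (g x))\<^sup>2"])
  assume f: "L2 f" and g: "L2 g"
  show "integrable M (\<lambda>x. (cmod (f x))\<^sup>2 + (cmod (g x))\<^sup>2)" using f g by (simp add: L2_integrable)
  show "(\<lambda>x. f x * cnj (g x)) \<in> borel_measurable M"
    by (intro mult_cnj_measurable L2_measurable f g)
  have "cmod (f x) * cmod (g x) \<le> (cmod (f x))\<^sup>2 + (cmod (g x))\<^sup>2" for x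
    using sum_squares_bound[of "cmod (f x)" "cmod (g x)"] by (simp add: mult_nonneg_nonneg order_trans[rotated])
  thus "AE x in M. norm (f x * cnj (g x)) \<le> norm ((cmod (f x))\<^sup>2 + (cmod (g x))\<^sup>2)"
    by (simp add: norm_mult)
qed

lemma L2_cmult: "L2 f \<Longrightarrow> L2 (\<lambda>x. c * f x)"
  unfolding L2_function_def by (auto simp: norm_mult power_mult_distrib)

lemma L2_add: "L2 f \<Longrightarrow> L2 g \<Longrightarrow> L2 (\<lambda>x. f x + g x)"
proof -
  assume f: "L2 f" and g: "L2 g"
  have m: "(\<lambda>x. f x + g x) \<in> borel_measurable M"
    using L2_measurable[OF f] L2_measurable[OF g] by measurable
  have "integrable M (\<lambda>x. (cmod (f x + g x))\<^sup>2)"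
  proof (rule Bochner_Integration.integrable_bound[where f = "\<lambda>x. 2 * (cmod (f x))\<^sup>2 + 2 * (cmod (g x))\<^sup>2"])
    show "integrable M (\<lambda>x. 2 * (cmod (f x))\<^sup>2 + 2 * (cmod (g x))\<^sup>2)" using f g by (simp add: L2_integrable)
    show "(\<lambda>x. (cmod (f x + g x))\<^sup>2) \<in> borel_measurable M" using m by measurable
    show "AE x in M. norm ((cmod (f x + g x))\<^sup>2) \<le> norm (2 * (cmod (f x))\<^sup>2 + 2 * (cmod (g x))\<^sup>2)"
      using norm_add_sq_le[of "f _" "g _"] by (intro AE_I2) simp
  qed
  thus ?thesis using m by (simp add: L2_function_def)
qed

lemma L2_diff: "L2 f \<Longrightarrow> L2 g \<Longrightarrow> L2 (\<lambda>x. f x - g x)"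
  using L2_add[of f "\<lambda>x. - 1 * g x"] L2_cmult[of g "- 1"] by simp

lemma L2_sum: "(\<And>i. i \<in> I \<Longrightarrow> L2 (F i)) \<Longrightarrow> L2 (\<lambda>x. \<Sum>i\<in>I. F i x)"
  by (induction I rule: infinite_finite_induct) (auto simp: L2_function_def[of _ "\<lambda>_. 0"] intro: L2_add)

lemma L2_cong: "(\<And>x. x \<in> X \<Longrightarrow> f x = g x) \<Longrightarrow> L2 f \<longleftrightarrow> L2 g"
  unfolding L2_function_def
  by (intro conj_cong measurable_cong Bochner_Integration.integrable_cong) (auto simp: space_M)

lemma corr_nat: "corr f (int n) = (LINT x|M. f ((T ^^ n) x) * cnj (f x))"
  by (simp add: corr_def int_iterate_def)

lemma S_T_pow: "x \<in> X \<Longrightarrow> (S ^^ n) ((T ^^ n) x) = x"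
proof (induction n)
  case (Suc n)
  have "(S ^^ Suc n) ((T ^^ Suc n) x) = (S ^^ n) (S (T ((T ^^ n) x)))" by (simp add: funpow_swap1)
  then show ?case using Suc by (simp add: S_T T_pow_X)
qed simp

lemma inv_pow_eq_S_pow:
  "x \<in> X \<Longrightarrow> x \<notin> (\<lambda>j. (T ^^ j) 0) ` {..<n} \<Longrightarrow> (inv_into X T ^^ n) x = (S ^^ n) x"
proof (induction n arbitrary: x)
  case (Suc n)
  have "(T ^^ 0) 0 \<in> (\<lambda>j. (T ^^ j) 0) ` {..<Suc n}" by (rule imageI) simp
  hence x0: "x \<noteq> 0" using Suc.prems by auto
  then obtain y where y: "y \<in> X" "T y = x" using T_surj Suc.prems by blast
  have Sx: "inv_into X T x = y" "S x = y" using S_T[OF y(1)] y x0 by (auto simp: S_def)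
  have "y \<notin> (\<lambda>j. (T ^^ j) 0) ` {..<n}"
  proof
    assume "y \<in> (\<lambda>j. (T ^^ j) 0) ` {..<n}"
    then obtain j where "j < n" "y = (T ^^ j) 0" by auto
    hence "x = (T ^^ Suc j) 0" "Suc j < Suc n" using y by auto
    thus False using Suc.prems(2) by blast
  qed
  hence "(inv_into X T ^^ n) y = (S ^^ n) y" by (rule Suc.IH[OF y(1)])
  thus ?case by (simp add: funpow_swap1 Sx)
qed simp

lemma S_pow_measurable: "(S ^^ n) \<in> M \<rightarrow>\<^sub>M M"
proof (induction n)
  case 0
  show ?case by (simp add: id_def)
next
  case (Suc n)
  show ?case using measurable_comp[OF Suc S_measurable] by (simp add: comp_def)
qed

text \<open>
  The arbitrary values of \<open>inv_into\<close> only affect the points \<open>T\<^sup>j 0\<close> with \<open>j < n\<close>, a finite set; elsewhere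
  \<open>inv_into\<close> may be replaced by \<open>S\<close>, and then \<open>x = T\<^sup>n y\<close> is substituted.
\<close>

lemma corr_neg_nat:
  assumes f: "L2 f"
  shows "corr f (- int n) = cnj (corr f (int n))"
proof (cases "n = 0")
  case True
  have "corr f 0 = (LINT x|M. complex_of_real ((cmod (f x))\<^sup>2))"
    using corr_nat[of f 0] by (simp only: complex_norm_square) simp
  thus ?thesis using True by (simp only: integral_complex_of_real) simp
next
  case False
  let ?N = "(\<lambda>j. (T ^^ j) 0) ` {..<n}"
  have N_X: "?N \<subseteq> X" using T_pow_X[OF zero_in_X] by blast
  have "corr f (- int n) = (LINT x|M. f ((inv_into X T ^^ n) x) * cnj (f x))"
    using False by (simp add: corr_def int_iterate_def space_M)
  also have "\<dots> = (LINT x|M. f ((S ^^ n) x) * cnj (f x))"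
  proof (rule integral_discrete_difference[of ?N])
    show "{x} \<in> sets M" if "x \<in> ?N" for x
      using that N_X by (auto simp: sets_M_iff)
    thus "emeasure M {x} = 0" if "x \<in> ?N" for x
      using that by (simp add: emeasure_M)
    show "f ((inv_into X T ^^ n) x) * cnj (f x) = f ((S ^^ n) x) * cnj (f x)"
      if "x \<in> space M" "x \<notin> ?N" for x
      using inv_pow_eq_S_pow[of x n] that by (simp add: space_M)
  qed simp
  also have "\<dots> = (LINT x|M. f ((S ^^ n) ((T ^^ n) x)) * cnj (f ((T ^^ n) x)))"
    by (intro integral_T_pow[symmetric] mult_cnj_measurable L2_measurable[OF f]
        measurable_compose[OF S_pow_measurable L2_measurable[OF f]])
  also have "\<dots> = (LINT x|M. cnj (f ((T ^^ n) x) * cnj (f x)))"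
    by (rule Bochner_Integration.integral_cong) (auto simp: S_T_pow space_M)
  also have "\<dots> = cnj (corr f (int n))"
    unfolding corr_nat by (rule Bochner_Integration.integral_cnj)
  finally show ?thesis .
qed

lemma corr_uminus: "L2 f \<Longrightarrow> corr f (- n) = cnj (corr f n)"
  using corr_neg_nat[of f "nat \<bar>n\<bar>"] by (cases "n \<ge> 0") auto

lemma inner_shift:
  assumes f: "L2 f"
  shows "(LINT x|M. f ((T ^^ i) x) * cnj (f ((T ^^ j) x))) = corr f (int i - int j)"
proof -
  have *: "(LINT x|M. f ((T ^^ (n + j)) x) * cnj (f ((T ^^ j) x))) = corr f (int n)" for n j
  proof -
    have "(LINT x|M. f ((T ^^ n) ((T ^^ j) x)) * cnj (f ((T ^^ j) x))) = corr f (int n)"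
      unfolding corr_nat
      by (intro integral_T_pow mult_cnj_measurable L2_measurable L2_T_pow f)
    thus ?thesis by (simp add: funpow_add)
  qed
  show ?thesis
  proof (cases "j \<le> i")
    case True
    then show ?thesis using *[of "i - j" j] by simp
  next
    case False
    have "(LINT x|M. f ((T ^^ i) x) * cnj (f ((T ^^ j) x))) = (LINT x|M. cnj (f ((T ^^ j) x) * cnj (f ((T ^^ i) x))))"
      by (simp add: mult.commute)
    also have "\<dots> = cnj (corr f (int (j - i)))"
      unfolding Bochner_Integration.integral_cnj using *[of "j - i" i] False by simp
    also have "\<dots> = corr f (int i - int j)"
      using corr_uminus[OF f, of "int (j - i)"] False by simp
    finally show ?thesis .
  qed
qed

lemma corr_cong: "L2 f \<Longrightarrow> (\<And>x. x \<in> X \<Longrightarrow> f x = g x) \<Longrightarrow> corr f n = corr g n"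
proof -
  assume f: "L2 f" and eq: "\<And>x. x \<in> X \<Longrightarrow> f x = g x"
  hence g: "L2 g" using L2_cong[of f g] by blast
  have nat: "corr f (int n) = corr g (int n)" for n
    unfolding corr_nat by (rule Bochner_Integration.integral_cong) (auto simp: eq space_M T_pow_X)
  show ?thesis
  proof (cases "n \<ge> 0")
    case True
    then show ?thesis using nat[of "nat n"] by simp
  next
    case False
    then show ?thesis using nat[of "nat (- n)"] corr_uminus[OF f, of "- n"] corr_uminus[OF g, of "- n"] by simp
  qed
qed

definition comb :: "(nat \<Rightarrow> complex) \<Rightarrow> (nat \<Rightarrow> nat) \<Rightarrow> nat \<Rightarrow> (real \<Rightarrow> complex) \<Rightarrow> real \<Rightarrow> complex" where
  "comb \<alpha> e N f x = (\<Sum>i<N. \<alpha> i * f ((T ^^ e i) x))"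

lemma L2_comb: "L2 f \<Longrightarrow> L2 (comb \<alpha> e N f)"
  unfolding comb_def[abs_def] by (intro L2_sum L2_cmult L2_T_pow)

text \<open>
  Both sides are sesquilinear; for \<open>n \<ge> 0\<close> each term is an inner product of iterates of \<open>f\<close>, and negative
  \<open>n\<close> follow by conjugation.
\<close>

lemma corr_comb:
  assumes f: "L2 f"
  shows "corr (comb \<alpha> e N f) n = (\<Sum>i<N. \<Sum>j<N. \<alpha> i * cnj (\<alpha> j) * corr f (n + int (e i) - int (e j)))"
proof -
  have nat: "corr (comb \<alpha> e N f) (int m)
      = (\<Sum>i<N. \<Sum>j<N. \<alpha> i * cnj (\<alpha> j) * corr f (int m + int (e i) - int (e j)))" for m
  proof -
    have i: "integrable M (\<lambda>x. f ((T ^^ (e i + m)) x) * cnj (f ((T ^^ e j) x)))" for i j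
      by (intro L2_product L2_T_pow f)
    have "corr (comb \<alpha> e N f) (int m) = (LINT x|M. (\<Sum>i<N. \<Sum>j<N.
        \<alpha> i * cnj (\<alpha> j) * (f ((T ^^ (e i + m)) x) * cnj (f ((T ^^ e j) x)))))"
      unfolding corr_nat comb_def funpow_add comp_def cnj_sum sum_product
      by (intro Bochner_Integration.integral_cong refl sum.cong) simp
    also have "\<dots> = (\<Sum>i<N. \<Sum>j<N. \<alpha> i * cnj (\<alpha> j) * (LINT x|M. f ((T ^^ (e i + m)) x) * cnj (f ((T ^^ e j) x))))"
      using i by (simp add: integrable_sum)
    also have "\<dots> = (\<Sum>i<N. \<Sum>j<N. \<alpha> i * cnj (\<alpha> j) * corr f (int m + int (e i) - int (e j)))"
      unfolding inner_shift[OF f] by (simp add: add.commute)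
    finally show ?thesis .
  qed
  show ?thesis
  proof (cases "n \<ge> 0")
    case True
    then show ?thesis using nat[of "nat n"] by simp
  next
    case False
    define m where "m = nat (- n)"
    have n: "n = - int m" using False by (simp add: m_def)
    have "corr (comb \<alpha> e N f) n = cnj (corr (comb \<alpha> e N f) (int m))"
      unfolding n by (rule corr_uminus[OF L2_comb[OF f]])
    also have "\<dots> = (\<Sum>i<N. \<Sum>j<N. cnj (\<alpha> i) * \<alpha> j * corr f (n + int (e j) - int (e i)))"
      unfolding nat cnj_sum complex_cnj_mult complex_cnj_cnj corr_uminus[OF f, symmetric]
      by (intro sum.cong refl arg_cong2[where f = "(*)"] arg_cong[where f = "corr f"]) (simp add: n)
    also have "\<dots> = (\<Sum>i<N. \<Sum>j<N. \<alpha> i * cnj (\<alpha> j) * corr f (n + int (e i) - int (e j)))"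
      by (subst sum.swap) (simp add: mult.commute)
    finally show ?thesis .
  qed
qed

lemma corr_zero: "corr f 0 = complex_of_real (LINT x|M. (cmod (f x))\<^sup>2)"
proof -
  have "corr f 0 = (LINT x|M. complex_of_real ((cmod (f x))\<^sup>2))"
    using corr_nat[of f 0] by (simp only: complex_norm_square) simp
  thus ?thesis by (simp only: integral_complex_of_real)
qed

lemma corr_T_pow: "L2 f \<Longrightarrow> corr (\<lambda>x. f ((T ^^ m) x)) n = corr f n"
  using corr_comb[of f "\<lambda>_. 1" "\<lambda>_. m" 1 n] by (simp add: comb_def[abs_def])

definition spectral :: "complex measure \<Rightarrow> (real \<Rightarrow> complex) \<Rightarrow> bool" where
  "spectral \<sigma> f \<longleftrightarrow> circle_measure \<sigma> \<and> (\<forall>n. (LINT z|\<sigma>. z powi (- n)) = corr f n)"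

text \<open>
  The quadratic form of the correlations of \<open>f\<close> is the square of the norm of a linear combination of
  iterates of \<open>f\<close>.
\<close>

lemma spectral_exists:
  assumes f: "L2 f"
  obtains \<sigma> where "spectral \<sigma> f"
proof -
  interpret positive_definite "corr f"
  proof
    fix N and u :: "nat \<Rightarrow> complex"
    have "(\<Sum>i<N. \<Sum>j<N. u i * cnj (u j) * corr f (int i - int j))
        = complex_of_real (LINT x|M. (cmod (comb u id N f x))\<^sup>2)"
      using corr_comb[OF f, of u id N 0] by (simp add: corr_zero)
    thus "0 \<le> Re (\<Sum>i<N. \<Sum>j<N. u i * cnj (u j) * corr f (int i - int j))" by simp
  qed (rule corr_uminus[OF f])
  obtain \<sigma> where "circle_measure \<sigma>" "\<And>n. (LINT z|\<sigma>. z powi (- n)) = corr f n"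
    using circle_measure_exists by blast
  thus ?thesis by (intro that[of \<sigma>]) (simp add: spectral_def)
qed

lemma spectral_is_spectral_measure: "spectral \<sigma> f \<Longrightarrow> is_spectral_measure M T f \<sigma>"
  unfolding spectral_def is_spectral_measure_def corr_def circle_measure_def circle_measure_axioms_def
  by blast

lemma spectral_moment: "spectral \<sigma> f \<Longrightarrow> (LINT z|\<sigma>. z powi n) = corr f (- n)"
  unfolding spectral_def by (metis minus_minus)

lemma spectral_mass: "spectral \<sigma> f \<Longrightarrow> measure \<sigma> (space \<sigma>) = (LINT x|M. (cmod (f x))\<^sup>2)"
proof -
  assume s: "spectral \<sigma> f"
  then interpret circle_measure \<sigma> by (simp add: spectral_def)
  have "complex_of_real (measure \<sigma> (space \<sigma>)) = (LINT z|\<sigma>. z powi 0)"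
    by (simp add: scaleR_conv_of_real)
  also have "\<dots> = complex_of_real (LINT x|M. (cmod (f x))\<^sup>2)"
    using spectral_moment[OF s, of 0] by (simp only: minus_zero corr_zero)
  finally show ?thesis by (simp only: of_real_eq_iff)
qed

text \<open>
  If \<open>F = A(U) f\<close> for a polynomial \<open>A\<close> in the Koopman operator \<open>U\<close>, then \<open>\<bar>A\<bar>\<^sup>2\<close> is the density of the
  spectral measure of \<open>F\<close> with respect to that of \<open>f\<close>. Only the correlations of \<open>F\<close> matter. The
  coefficients are conjugated since the Fourier coefficients of a measure are taken with \<open>z powi (- n)\<close>.
\<close>

lemma spectral_combination:
  assumes f: "L2 f" and \<sigma>: "spectral \<sigma> F" and \<tau>: "spectral \<tau> f"
    and F: "\<And>n. corr F n = corr (comb \<alpha> e N f) n"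
    and g: "trig UNIV (\<lambda>z. complex_of_real (g z))"
  shows "(LINT z|\<sigma>. g z) = (LINT z|\<tau>. g z * (cmod (\<Sum>i<N. cnj (\<alpha> i) * z ^ e i))\<^sup>2)"
proof (rule trig_real_integral_transfer[OF _ _ _ _ g])
  interpret \<tau>: circle_measure \<tau> using \<tau> by (simp add: spectral_def)
  show "circle_measure \<sigma>" "circle_measure \<tau>" using \<sigma> \<tau> by (simp_all add: spectral_def)
  show "continuous_on unit_circle (\<lambda>z. (cmod (\<Sum>i<N. cnj (\<alpha> i) * z ^ e i))\<^sup>2)"
    by (intro continuous_intros)
  fix n
  have "(LINT z|\<tau>. z powi n * complex_of_real ((cmod (\<Sum>i<N. cnj (\<alpha> i) * z ^ e i))\<^sup>2))
      = (LINT z|\<tau>. (\<Sum>i<N. \<Sum>j<N. cnj (\<alpha> i) * \<alpha> j * z powi (n + int (e i) - int (e j))))"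
  proof (rule \<tau>.integral_cong_circle)
    fix z :: complex assume z: "z \<in> unit_circle"
    have e: "z powi (n + int (e i) - int (e j)) = z powi n * (z ^ e i * cnj (z ^ e j))" for i j
      using circle_powi_add[OF z, of "n + int (e i)" "- int (e j)"] circle_powi_add[OF z, of n "int (e i)"]
      by (simp only: cnj_powi[OF z, of "int (e j)", symmetric] power_int_of_nat diff_conv_add_uminus mult.assoc)
    show "z powi n * complex_of_real ((cmod (\<Sum>i<N. cnj (\<alpha> i) * z ^ e i))\<^sup>2)
        = (\<Sum>i<N. \<Sum>j<N. cnj (\<alpha> i) * \<alpha> j * z powi (n + int (e i) - int (e j)))"
      unfolding complex_norm_square cnj_sum sum_product unfolding sum_distrib_left e
      by (intro sum.cong refl) (simp add: mult_ac)
  qed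
  also have "\<dots> = (\<Sum>i<N. \<Sum>j<N. cnj (\<alpha> i) * \<alpha> j * corr f (- (n + int (e i) - int (e j))))"
    unfolding spectral_moment[OF \<tau>, symmetric]
    by (simp add: \<tau>.continuous_integrable continuous_on_sum continuous_on_mult continuous_on_const continuous_on_powi)
  also have "\<dots> = (\<Sum>i<N. \<Sum>j<N. cnj (\<alpha> j) * \<alpha> i * corr f (- (n + int (e j) - int (e i))))"
    by (rule sum.swap)
  also have "\<dots> = (LINT z|\<sigma>. z powi n)"
    unfolding spectral_moment[OF \<sigma>] F corr_comb[OF f]
    by (intro sum.cong refl) (simp add: algebra_simps)
  finally show "(LINT z|\<sigma>. z powi n)
      = (LINT z|\<tau>. z powi n * complex_of_real ((cmod (\<Sum>i<N. cnj (\<alpha> i) * z ^ e i))\<^sup>2))" ..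
qed

lemma corr_parallelogram:
  assumes f: "L2 f" and g: "L2 g"
  shows "corr (\<lambda>x. f x + g x) n + corr (\<lambda>x. f x - g x) n = 2 * corr f n + 2 * corr g n"
proof -
  have nat: "corr (\<lambda>x. f x + g x) (int m) + corr (\<lambda>x. f x - g x) (int m) = 2 * corr f (int m) + 2 * corr g (int m)" for m
  proof -
    let ?I = "\<lambda>u v. (\<lambda>x. u ((T ^^ m) x) * cnj (v x))"
    have i: "integrable M (?I f f)" "integrable M (?I g g)" "integrable M (?I f g)" "integrable M (?I g f)"
      by (intro L2_product L2_T_pow f g)+
    have "(LINT x|M. (f ((T ^^ m) x) + g ((T ^^ m) x)) * cnj (f x + g x))
        = (LINT x|M. ?I f f x + ?I f g x + ?I g f x + ?I g g x)"
      by (simp add: algebra_simps)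
    also have "\<dots> = (LINT x|M. ?I f f x) + (LINT x|M. ?I f g x) + (LINT x|M. ?I g f x) + (LINT x|M. ?I g g x)"
      using i by simp
    finally have 1: "(LINT x|M. (f ((T ^^ m) x) + g ((T ^^ m) x)) * cnj (f x + g x)) =
      (LINT x|M. ?I f f x) + (LINT x|M. ?I f g x) + (LINT x|M. ?I g f x) + (LINT x|M. ?I g g x)" .
    have "(LINT x|M. (f ((T ^^ m) x) - g ((T ^^ m) x)) * cnj (f x - g x))
        = (LINT x|M. ?I f f x - ?I f g x - ?I g f x + ?I g g x)"
      by (simp add: algebra_simps)
    also have "\<dots> = (LINT x|M. ?I f f x) - (LINT x|M. ?I f g x) - (LINT x|M. ?I g f x) + (LINT x|M. ?I g g x)"
      using i by simp
    finally have 2: "(LINT x|M. (f ((T ^^ m) x) - g ((T ^^ m) x)) * cnj (f x - g x)) =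
      (LINT x|M. ?I f f x) - (LINT x|M. ?I f g x) - (LINT x|M. ?I g f x) + (LINT x|M. ?I g g x)" .
    show ?thesis unfolding corr_nat 1 2 by simp
  qed
  show ?thesis
  proof (cases "n \<ge> 0")
    case True
    then show ?thesis using nat[of "nat n"] by simp
  next
    case False
    define m where "m = nat (- n)"
    have n: "n = - int m" using False by (simp add: m_def)
    show ?thesis
      unfolding n corr_uminus[OF f] corr_uminus[OF g] corr_uminus[OF L2_add[OF f g]] corr_uminus[OF L2_diff[OF f g]]
      using arg_cong[OF nat[of m], of cnj] by simp
  qed
qed

text \<open>
  The parallelogram law holds for spectral measures, because it holds for correlations.
\<close>

lemma spectral_sum_bound:
  assumes fu: "L2 f" "L2 u"
    and \<sigma>: "spectral \<sigma> (\<lambda>x. f x + u x)" and \<sigma>f: "spectral \<sigma>f f" and \<sigma>u: "spectral \<sigma>u u"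
    and g: "trig UNIV (\<lambda>z. complex_of_real (g z))" and g0: "\<And>z. z \<in> unit_circle \<Longrightarrow> 0 \<le> g z"
  shows "(LINT z|\<sigma>. g z) \<le> 2 * (LINT z|\<sigma>f. g z) + 2 * (LINT z|\<sigma>u. g z)"
proof -
  obtain \<sigma>' where \<sigma>': "spectral \<sigma>' (\<lambda>x. f x - u x)" using spectral_exists[OF L2_diff[OF fu]] .
  interpret \<sigma>: circle_measure \<sigma> using \<sigma> by (simp add: spectral_def)
  interpret \<sigma>': circle_measure \<sigma>' using \<sigma>' by (simp add: spectral_def)
  interpret \<sigma>f: circle_measure \<sigma>f using \<sigma>f by (simp add: spectral_def)
  interpret \<sigma>u: circle_measure \<sigma>u using \<sigma>u by (simp add: spectral_def)
  have "(LINT z|\<sigma>. F z) + (LINT z|\<sigma>'. F z) = 2 * (LINT z|\<sigma>f. F z) + 2 * (LINT z|\<sigma>u. F z)"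
    if "trig UNIV F" for F
    using that
  proof (induction rule: trig.induct)
    case (trig_zero F)
    have "(LINT z|\<sigma>. F z) = (LINT z|\<sigma>. 0)" by (rule \<sigma>.integral_cong_circle) (simp only: trig_zero)
    moreover have "(LINT z|\<sigma>'. F z) = (LINT z|\<sigma>'. 0)" by (rule \<sigma>'.integral_cong_circle) (simp only: trig_zero)
    moreover have "(LINT z|\<sigma>f. F z) = (LINT z|\<sigma>f. 0)" by (rule \<sigma>f.integral_cong_circle) (simp only: trig_zero)
    moreover have "(LINT z|\<sigma>u. F z) = (LINT z|\<sigma>u. 0)" by (rule \<sigma>u.integral_cong_circle) (simp only: trig_zero)
    ultimately show ?case by simp
  next
    case (trig_step H n F c)
    note cH = trig_continuous[OF trig_step.hyps(1)]
    have step: "(LINT z|\<mu>. F z) = (LINT z|\<mu>. H z) + c * (LINT z|\<mu>. z powi n)" if "circle_measure \<mu>" for \<mu>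
    proof -
      interpret \<mu>: circle_measure \<mu> by fact
      have "(LINT z|\<mu>. F z) = (LINT z|\<mu>. H z + c * z powi n)"
        by (rule \<mu>.integral_cong_circle) (simp only: trig_step.hyps(3))
      thus ?thesis
        using \<mu>.continuous_integrable[OF cH] \<mu>.continuous_integrable[OF continuous_on_powi[of n]] by simp
    qed
    have "c * (corr (\<lambda>x. f x + u x) (- n) + corr (\<lambda>x. f x - u x) (- n)) = c * (2 * corr f (- n) + 2 * corr u (- n))"
      by (simp only: corr_parallelogram[OF fu])
    thus ?case
      using trig_step.IH
      unfolding step[OF \<sigma>.circle_measure_axioms] step[OF \<sigma>'.circle_measure_axioms]
        step[OF \<sigma>f.circle_measure_axioms] step[OF \<sigma>u.circle_measure_axioms]
        spectral_moment[OF \<sigma>] spectral_moment[OF \<sigma>'] spectral_moment[OF \<sigma>f] spectral_moment[OF \<sigma>u]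
      by (simp add: algebra_simps)
  qed
  from this[OF g] have "complex_of_real ((LINT z|\<sigma>. g z) + (LINT z|\<sigma>'. g z))
      = complex_of_real (2 * (LINT z|\<sigma>f. g z) + 2 * (LINT z|\<sigma>u. g z))"
    by (simp add: integral_complex_of_real)
  hence "(LINT z|\<sigma>. g z) + (LINT z|\<sigma>'. g z) = 2 * (LINT z|\<sigma>f. g z) + 2 * (LINT z|\<sigma>u. g z)"
    by (simp only: of_real_eq_iff)
  moreover have "0 \<le> (LINT z|\<sigma>'. g z)"
    by (rule integral_nonneg_AE) (auto intro!: AE_I2 g0 simp: \<sigma>'.space_circle)
  ultimately show ?thesis by linarith
qed

end

section \<open>Functions constant on the levels are dense\<close>

context rank_one
begin

text \<open>
  Phrased without coefficients, so that passing to a later stack is immediate.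
\<close>

definition stack_const :: "nat \<Rightarrow> (real \<Rightarrow> complex) \<Rightarrow> bool" where
  "stack_const k F \<longleftrightarrow> (\<forall>i<h k. \<exists>c. \<forall>x\<in>lev k i. F x = c) \<and> (\<forall>x\<in>X - stack k. F x = 0)"

lemma level_in_or_off_stack:
  assumes "i' < h (Suc k)"
  shows "(\<exists>i<h k. lev (Suc k) i' \<subseteq> lev k i) \<or> lev (Suc k) i' \<inter> stack k = {}"
proof (cases "lev (Suc k) i' \<inter> stack k = {}")
  case False
  then obtain x i where x: "x \<in> lev (Suc k) i'" "i < h k" "x \<in> lev k i" unfolding stack_def by blast
  then obtain j where j: "j < p k" "x \<in> lev (Suc k) (pos k j i)" using level_split[of i k] by auto
  have "i' = pos k j i" using level_unique[OF x(1) j(2) assms pos_less[OF j(1) x(2)]] .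
  hence "lev (Suc k) i' \<subseteq> lev k i" using level_split[OF x(2)] j by auto
  thus ?thesis using x by blast
qed simp

lemma stack_const_Suc: "stack_const k F \<Longrightarrow> stack_const (Suc k) F"
  unfolding stack_const_def
proof (elim conjE, intro conjI allI impI ballI)
  assume const: "\<forall>i<h k. \<exists>c. \<forall>x\<in>lev k i. F x = c" and off: "\<forall>x\<in>X - stack k. F x = 0"
  show "\<exists>c. \<forall>x\<in>lev (Suc k) i. F x = c" if i: "i < h (Suc k)" for i
  proof (cases "lev (Suc k) i \<inter> stack k = {}")
    case True
    then show ?thesis using off level_subset_X[OF i] by (intro exI[of _ 0]) auto
  next
    case False
    then obtain i0 where "i0 < h k" "lev (Suc k) i \<subseteq> lev k i0" using level_in_or_off_stack[OF i] by blast
    then show ?thesis using const by (meson subsetD)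
  qed
  show "F x = 0" if "x \<in> X - stack (Suc k)" for x
    using that off stack_mono[of k "Suc k"] by auto
qed

lemma stack_const_mono: "k \<le> k' \<Longrightarrow> stack_const k F \<Longrightarrow> stack_const k' F"
  by (induction k' rule: dec_induct) (auto intro: stack_const_Suc)

lemma stack_const_add: "stack_const k F \<Longrightarrow> stack_const k G \<Longrightarrow> stack_const k (\<lambda>x. F x + G x)"
  unfolding stack_const_def by (metis add.right_neutral)

lemma stack_const_cmult: "stack_const k F \<Longrightarrow> stack_const k (\<lambda>x. c * F x)"
  unfolding stack_const_def by (metis mult_zero_right)

lemma stack_const_sum_levels:
  assumes "stack_const k F"
  obtains \<alpha> where "\<And>x. x \<in> X \<Longrightarrow> F x = (\<Sum>i<h k. \<alpha> i * indicator (lev k i) x)"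
proof -
  obtain \<alpha> where \<alpha>: "\<And>i x. i < h k \<Longrightarrow> x \<in> lev k i \<Longrightarrow> F x = \<alpha> i"
    using assms unfolding stack_const_def by metis
  have "F x = (\<Sum>i<h k. \<alpha> i * indicator (lev k i) x)" if x: "x \<in> X" for x
  proof (cases "x \<in> stack k")
    case True
    then obtain i where i: "i < h k" "x \<in> lev k i" unfolding stack_def by blast
    have "(\<Sum>i'<h k. \<alpha> i' * indicator (lev k i') x) = (\<Sum>i'<h k. if i' = i then \<alpha> i else 0)"
      using i level_unique[of x k] by (intro sum.cong refl) (auto simp: indicator_def)
    also have "\<dots> = F x" using i \<alpha> by simp
    finally show ?thesis by simp
  next
    case False
    hence "(\<Sum>i<h k. \<alpha> i * indicator (lev k i) x) = 0"
      unfolding stack_def by (intro sum.neutral) auto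
    then show ?thesis using assms x False unfolding stack_const_def by auto
  qed
  thus ?thesis by (rule that)
qed

definition approximable :: "(real \<Rightarrow> complex) \<Rightarrow> bool" where
  "approximable f \<longleftrightarrow> L2 f \<and> (\<forall>\<epsilon>>0. \<exists>k F. L2 F \<and> stack_const k F \<and> (LINT x|M. (cmod (f x - F x))\<^sup>2) < \<epsilon>)"

lemma L2_norm_add:
  assumes "L2 f" "L2 g"
  shows "(LINT x|M. (cmod (f x + g x))\<^sup>2) \<le> 2 * (LINT x|M. (cmod (f x))\<^sup>2) + 2 * (LINT x|M. (cmod (g x))\<^sup>2)"
proof -
  have "(LINT x|M. (cmod (f x + g x))\<^sup>2) \<le> (LINT x|M. 2 * (cmod (f x))\<^sup>2 + 2 * (cmod (g x))\<^sup>2)"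
    using L2_integrable[OF assms(1)] L2_integrable[OF assms(2)] L2_integrable[OF L2_add[OF assms]]
    by (intro integral_mono norm_add_sq_le) auto
  thus ?thesis using assms by (simp add: L2_integrable)
qed

lemma approximable_limit:
  assumes f: "L2 f" and lim: "\<And>\<epsilon>. \<epsilon> > 0 \<Longrightarrow> \<exists>g. approximable g \<and> (LINT x|M. (cmod (f x - g x))\<^sup>2) < \<epsilon>"
  shows "approximable f"
  unfolding approximable_def
proof (intro conjI allI impI f)
  fix \<epsilon> :: real assume e: "\<epsilon> > 0"
  obtain g where g: "approximable g" "(LINT x|M. (cmod (f x - g x))\<^sup>2) < \<epsilon> / 4" using lim[of "\<epsilon> / 4"] e by auto
  obtain k F where F: "L2 F" "stack_const k F" "(LINT x|M. (cmod (g x - F x))\<^sup>2) < \<epsilon> / 4"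
    using g(1) e unfolding approximable_def by (metis divide_pos_pos zero_less_numeral)
  have "L2 g" using g(1) by (simp add: approximable_def)
  hence "(LINT x|M. (cmod ((f x - g x) + (g x - F x)))\<^sup>2) < \<epsilon>"
    using L2_norm_add[OF L2_diff[OF f \<open>L2 g\<close>] L2_diff[OF \<open>L2 g\<close> F(1)]] g(2) F(3) by linarith
  thus "\<exists>k F. L2 F \<and> stack_const k F \<and> (LINT x|M. (cmod (f x - F x))\<^sup>2) < \<epsilon>"
    using F by auto
qed

lemma approximable_add:
  assumes "approximable f" "approximable g"
  shows "approximable (\<lambda>x. f x + g x)"
  unfolding approximable_def
proof (intro conjI allI impI)
  have f: "L2 f" and g: "L2 g" using assms by (simp_all add: approximable_def)
  show "L2 (\<lambda>x. f x + g x)" by (rule L2_add[OF f g])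
  fix \<epsilon> :: real assume e: "\<epsilon> > 0"
  obtain k F where F: "L2 F" "stack_const k F" "(LINT x|M. (cmod (f x - F x))\<^sup>2) < \<epsilon> / 4"
    using assms(1) e unfolding approximable_def by (metis divide_pos_pos zero_less_numeral)
  obtain l G where G: "L2 G" "stack_const l G" "(LINT x|M. (cmod (g x - G x))\<^sup>2) < \<epsilon> / 4"
    using assms(2) e unfolding approximable_def by (metis divide_pos_pos zero_less_numeral)
  have "(LINT x|M. (cmod ((f x - F x) + (g x - G x)))\<^sup>2) < \<epsilon>"
    using L2_norm_add[OF L2_diff[OF f F(1)] L2_diff[OF g G(1)]] F(3) G(3) by linarith
  moreover have "(f x - F x) + (g x - G x) = f x + g x - (F x + G x)" for x by simp
  ultimately have "(LINT x|M. (cmod (f x + g x - (F x + G x)))\<^sup>2) < \<epsilon>" by simp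
  moreover have "stack_const (max k l) (\<lambda>x. F x + G x)"
    using stack_const_mono[OF _ F(2), of "max k l"] stack_const_mono[OF _ G(2), of "max k l"]
    by (intro stack_const_add) auto
  ultimately show "\<exists>k F. L2 F \<and> stack_const k F \<and> (LINT x|M. (cmod (f x + g x - F x))\<^sup>2) < \<epsilon>"
    using L2_add[OF F(1) G(1)] by blast
qed

lemma approximable_zero: "approximable (\<lambda>_. 0)"
  unfolding approximable_def
  by (intro conjI allI impI exI[of _ "0::nat"] exI[of _ "\<lambda>_. 0"]) (auto simp: L2_function_def stack_const_def)

lemma approximable_cmult:
  assumes "approximable f"
  shows "approximable (\<lambda>x. c * f x)"
proof (cases "c = 0")
  case True
  then show ?thesis using approximable_zero by simp
next
  case False
  show ?thesis
    unfolding approximable_def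
  proof (intro conjI allI impI)
    show "L2 (\<lambda>x. c * f x)" using assms by (intro L2_cmult) (simp add: approximable_def)
    fix \<epsilon> :: real assume e: "\<epsilon> > 0"
    have c: "(cmod c)\<^sup>2 > 0" using False by simp
    have "\<epsilon> / (cmod c)\<^sup>2 > 0" using e c by simp
    then obtain k F where F: "L2 F" "stack_const k F" "(LINT x|M. (cmod (f x - F x))\<^sup>2) < \<epsilon> / (cmod c)\<^sup>2"
      using assms unfolding approximable_def by blast
    have "(LINT x|M. (cmod (c * f x - c * F x))\<^sup>2) = (cmod c)\<^sup>2 * (LINT x|M. (cmod (f x - F x))\<^sup>2)"
      by (simp add: norm_mult power_mult_distrib flip: right_diff_distrib)
    also have "\<dots> < \<epsilon>" using F(3) c by (simp add: field_simps)
    finally show "\<exists>k F. L2 F \<and> stack_const k F \<and> (LINT x|M. (cmod (c * f x - F x))\<^sup>2) < \<epsilon>"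
      using L2_cmult[OF F(1), of c] stack_const_cmult[OF F(2), of c] by blast
  qed
qed

lemma approximable_sum: "(\<And>i. i \<in> I \<Longrightarrow> approximable (F i)) \<Longrightarrow> approximable (\<lambda>x. \<Sum>i\<in>I. F i x)"
proof (induction I rule: infinite_finite_induct)
  case (insert i I)
  show ?case
    unfolding sum.insert[OF insert.hyps] by (intro approximable_add insert.IH insert.prems) auto
qed (simp_all add: approximable_zero)

lemma L2_indicator:
  assumes "A \<in> sets M" "emeasure M A < \<infinity>"
  shows "L2 (indicator A)"
proof -
  have "integrable M (\<lambda>x. indicat_real A x)" using assms by (intro integrable_real_indicator)
  moreover have "(cmod (indicator A x))\<^sup>2 = indicat_real A x" for x by (simp add: indicator_def)
  ultimately show ?thesis using assms(1) unfolding L2_function_def by simp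
qed

text \<open>
  Enclose \<open>A\<close> in an open set \<open>U\<close> of nearly the same measure. The union of the levels of stack \<open>k\<close> that
  lie in \<open>U\<close> increases with \<open>k\<close> to the trace of \<open>U\<close> on the space, as the widths of the levels tend to 0.
\<close>

lemma approximable_indicator:
  assumes A: "A \<in> sets M" and fin: "emeasure M A < \<infinity>"
  shows "approximable (indicator A)"
  unfolding approximable_def
proof (intro conjI allI impI L2_indicator A fin)
  fix \<epsilon> :: real assume e: "\<epsilon> > 0"
  have A': "A \<in> sets borel" "A \<subseteq> X" using A by (auto simp: sets_M_iff)
  obtain U where U: "open U" "A \<subseteq> U" "emeasure lebesgue (U - A) < ennreal (\<epsilon> / 2)"
  proof (rule sets_lebesgue_outer_open[of A "\<epsilon> / 2"])
    show "A \<in> sets lebesgue" using A'(1) by (intro sets_completionI_sets) simp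
    show "0 < \<epsilon> / 2" using e by simp
  qed
  have U_borel: "U \<in> sets borel" using U by simp
  define Y where "Y = U \<inter> X"
  have Y: "Y \<in> sets M" "A \<subseteq> Y" using U_borel sets_X A' U by (auto simp: Y_def sets_M_iff)
  have diff: "emeasure M (Y - A) < ennreal (\<epsilon> / 2)"
  proof -
    have "emeasure M (Y - A) = emeasure lborel (Y - A)" using A Y by (intro emeasure_M) auto
    also have "\<dots> \<le> emeasure lborel (U - A)" using U_borel A' by (intro emeasure_mono) (auto simp: Y_def)
    also have "\<dots> = emeasure lebesgue (U - A)" using U_borel A' by simp
    also have "\<dots> < ennreal (\<epsilon> / 2)" by (rule U(3))
    finally show ?thesis .
  qed
  have finY: "emeasure M Y < \<infinity>"
  proof -
    have "emeasure M Y \<le> emeasure M A + emeasure M (Y - A)"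
      using A Y emeasure_subadditive[of A M "Y - A"] by (simp add: Un_absorb1)
    also have "\<dots> < \<infinity>" using fin less_trans[OF diff ennreal_less_top] by (simp add: less_top)
    finally show ?thesis .
  qed
  define V where "V k = (\<Union>i\<in>{i. i < h k \<and> lev k i \<subseteq> U}. lev k i)" for k
  have V_borel: "V k \<in> sets borel" for k unfolding V_def by (intro sets.finite_UN sets_level) auto
  have V_sub: "V k \<subseteq> Y" for k using level_subset_X unfolding V_def Y_def by blast
  have V_M: "V k \<in> sets M" for k using V_borel V_sub[of k] by (auto simp: sets_M_iff Y_def)
  have inc: "incseq V"
  proof (rule incseq_SucI)
    fix k show "V k \<subseteq> V (Suc k)"
    proof
      fix x assume "x \<in> V k"
      then obtain i where i: "i < h k" "lev k i \<subseteq> U" "x \<in> lev k i" unfolding V_def by blast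
      then obtain j where j: "j < p k" "x \<in> lev (Suc k) (pos k j i)" using level_split[of i k] by auto
      have "lev (Suc k) (pos k j i) \<subseteq> U" using level_split[OF i(1)] j i by auto
      thus "x \<in> V (Suc k)" using pos_less[OF j(1) i(1)] j unfolding V_def by blast
    qed
  qed
  have "(\<Union>k. V k) = Y"
  proof (intro equalityI subsetI)
    fix x assume x: "x \<in> Y"
    then obtain r where r: "r > 0" "\<And>y. dist y x < r \<Longrightarrow> y \<in> U"
      using U(1) unfolding Y_def open_dist by blast
    obtain k0 where k0: "x \<in> stack k0" using x unfolding Y_def X_stack by blast
    obtain k where k: "k \<ge> k0" "width p k < r" using width_small[OF r(1)] by blast
    obtain i where i: "i < h k" "x \<in> lev k i" using stack_mono[OF k(1)] k0 unfolding stack_def by blast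
    have "lev k i \<subseteq> U"
    proof
      fix y assume "y \<in> lev k i"
      hence "dist y x < r" using i k by (auto simp: level_def dist_real_def)
      thus "y \<in> U" by (rule r(2))
    qed
    thus "x \<in> (\<Union>k. V k)" using i unfolding V_def by blast
  qed (use V_sub in blast)
  hence "(\<lambda>k. measure M (V k)) \<longlonglongrightarrow> measure M Y"
    using Lim_measure_incseq[of V M] V_M inc finY by (auto simp: image_subset_iff)
  hence "\<forall>\<^sub>F k in sequentially. dist (measure M (V k)) (measure M Y) < \<epsilon> / 2"
    using e by (intro tendstoD) auto
  then obtain k where k: "dist (measure M (V k)) (measure M Y) < \<epsilon> / 2"
    using eventually_happens by fastforce
  have finV: "emeasure M (V k) < \<infinity>"
    using finY emeasure_mono[OF V_sub Y(1), of k] by (rule le_less_trans[rotated])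
  have YV: "measure M (Y - V k) < \<epsilon> / 2"
  proof -
    have "measure M (Y - V k) = measure M Y - measure M (V k)"
      using V_sub V_M Y finY by (intro measure_Diff) (auto simp: less_top)
    thus ?thesis using k unfolding dist_real_def by linarith
  qed
  have YA: "measure M (Y - A) < \<epsilon> / 2"
  proof -
    have "emeasure M (Y - A) \<noteq> \<infinity>" using diff by auto
    hence "ennreal (measure M (Y - A)) < ennreal (\<epsilon> / 2)"
      using diff by (simp add: emeasure_eq_ennreal_measure)
    thus ?thesis by (simp add: ennreal_less_iff)
  qed
  have Int_X: "(Y - B) \<inter> X = Y - B" for B by (auto simp: Y_def)
  have "(LINT x|M. (cmod (indicator A x - indicator (V k) x))\<^sup>2) \<le> (LINT x|M. indicat_real (Y - V k) x + indicat_real (Y - A) x)"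
  proof (rule integral_mono)
    have iYV: "integrable M (indicat_real (Y - V k))" and iYA: "integrable M (indicat_real (Y - A))"
      using Y V_M A finY emeasure_mono[of "Y - V k" Y M] emeasure_mono[of "Y - A" Y M]
      by (auto intro!: integrable_real_indicator intro: le_less_trans)
    thus "integrable M (\<lambda>x. indicat_real (Y - V k) x + indicat_real (Y - A) x)" by simp
    show "integrable M (\<lambda>x. (cmod (indicator A x - indicator (V k) x))\<^sup>2)"
      by (intro L2_integrable L2_diff L2_indicator A fin V_M finV)
    show "(cmod (indicator A x - indicator (V k) x))\<^sup>2 \<le> indicat_real (Y - V k) x + indicat_real (Y - A) x" for x
      using Y(2) V_sub[of k] by (auto simp: indicator_def)
  qed
  also have "(LINT x|M. indicat_real (Y - V k) x + indicat_real (Y - A) x) = measure M (Y - V k) + measure M (Y - A)"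
    using Y V_M A finY emeasure_mono[of "Y - V k" Y M] emeasure_mono[of "Y - A" Y M]
    by (subst Bochner_Integration.integral_add) (auto intro!: integrable_real_indicator intro: le_less_trans simp: space_M sets_M_iff Int_X)
  also have "\<dots> < \<epsilon>" using YV YA by simp
  finally have "(LINT x|M. (cmod (indicator A x - indicator (V k) x))\<^sup>2) < \<epsilon>" .
  moreover have "stack_const k (indicator (V k))"
    unfolding stack_const_def
  proof (intro conjI allI impI ballI)
    fix i assume i: "i < h k"
    show "\<exists>c. \<forall>x\<in>lev k i. indicator (V k) x = c"
    proof (cases "lev k i \<subseteq> U")
      case True
      hence "x \<in> V k" if "x \<in> lev k i" for x using i that unfolding V_def by blast
      then show ?thesis by (intro exI[of _ 1]) simp
    next
      case False
      have "x \<notin> V k" if "x \<in> lev k i" for x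
        using level_unique[OF that _ i] False unfolding V_def by blast
      then show ?thesis by (intro exI[of _ 0]) auto
    qed
  next
    fix x assume "x \<in> X - stack k"
    hence "x \<notin> V k" unfolding V_def stack_def by blast
    thus "indicator (V k) x = 0" by simp
  qed
  ultimately show "\<exists>k F. L2 F \<and> stack_const k F \<and> (LINT x|M. (cmod (indicator A x - F x))\<^sup>2) < \<epsilon>"
    using L2_indicator[OF V_M finV] by blast
qed

lemma L2_approximable:
  assumes f: "L2 f"
  shows "approximable f"
proof -
  obtain s where s: "\<And>i. simple_function M (s i)" "\<And>x. x \<in> space M \<Longrightarrow> (\<lambda>i. s i x) \<longlonglongrightarrow> f x"
    "\<And>i x. x \<in> space M \<Longrightarrow> dist (s i x) 0 \<le> 2 * dist (f x) 0"
    using borel_measurable_implies_sequence_metric[OF L2_measurable[OF f], of 0] by blast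
  have s_meas: "s i \<in> borel_measurable M" for i using s(1) by (rule borel_measurable_simple_function)
  have s_sq: "(cmod (s i x))\<^sup>2 \<le> 4 * (cmod (f x))\<^sup>2" if "x \<in> space M" for i x
    using power_mono[OF s(3)[OF that, of i], of 2] by (simp add: power_mult_distrib)
  have s_L2: "L2 (s i)" for i
  proof -
    have "integrable M (\<lambda>x. (cmod (s i x))\<^sup>2)"
    proof (rule Bochner_Integration.integrable_bound[where f = "\<lambda>x. 4 * (cmod (f x))\<^sup>2"])
      show "integrable M (\<lambda>x. 4 * (cmod (f x))\<^sup>2)" using L2_integrable[OF f] by simp
      show "(\<lambda>x. (cmod (s i x))\<^sup>2) \<in> borel_measurable M" using s_meas[of i] by measurable
      show "AE x in M. norm ((cmod (s i x))\<^sup>2) \<le> norm (4 * (cmod (f x))\<^sup>2)"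
        using s_sq by (intro AE_I2) simp
    qed
    thus ?thesis using s_meas by (simp add: L2_function_def)
  qed
  have s_approx: "approximable (s i)" for i
  proof -
    let ?A = "\<lambda>c. s i -` {c} \<inter> space M"
    have sum: "s i x = (\<Sum>c\<in>s i ` space M - {0}. c * indicator (?A c) x)" if "x \<in> X" for x
    proof (cases "s i x = 0")
      case True
      hence "(\<Sum>c\<in>s i ` space M - {0}. c * indicator (?A c) x) = 0"
        by (intro sum.neutral) (auto simp: indicator_def)
      then show ?thesis using True by simp
    next
      case False
      have "(\<Sum>c\<in>s i ` space M - {0}. c * indicator (?A c) x) = (\<Sum>c\<in>s i ` space M - {0}. if c = s i x then c else 0)"
        using that by (intro sum.cong refl) (auto simp: indicator_def space_M)
      also have "\<dots> = s i x" using simple_functionD(1)[OF s(1)] that False by (simp add: sum.delta space_M)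
      finally show ?thesis by simp
    qed
    let ?S = "\<lambda>x. \<Sum>c\<in>s i ` space M - {0}. c * indicator (?A c) x"
    have "approximable ?S"
    proof (intro approximable_sum approximable_cmult approximable_indicator)
      fix c assume c: "c \<in> s i ` space M - {0}"
      show A: "?A c \<in> sets M" using simple_functionD(2)[OF s(1)] .
      have "integrable M (indicat_real (?A c))"
      proof (rule Bochner_Integration.integrable_bound[where f = "\<lambda>x. (cmod (s i x))\<^sup>2 / (cmod c)\<^sup>2"])
        show "integrable M (\<lambda>x. (cmod (s i x))\<^sup>2 / (cmod c)\<^sup>2)" using L2_integrable[OF s_L2] by simp
        show "indicat_real (?A c) \<in> borel_measurable M" using A by simp
        show "AE x in M. norm (indicat_real (?A c) x) \<le> norm ((cmod (s i x))\<^sup>2 / (cmod c)\<^sup>2)"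
          using c by (intro AE_I2) (auto simp: indicator_def)
      qed
      thus "emeasure M (?A c) < \<infinity>" using A by (simp add: integrable_indicator_iff)
    qed
    hence a: "approximable ?S" .
    have "(LINT x|M. (cmod (s i x - F x))\<^sup>2) = (LINT x|M. (cmod (?S x - F x))\<^sup>2)" for F
      by (rule Bochner_Integration.integral_cong) (simp_all only: space_M sum)
    thus ?thesis using a s_L2 unfolding approximable_def by simp
  qed
  have "(\<lambda>i. LINT x|M. (cmod (f x - s i x))\<^sup>2) \<longlonglongrightarrow> (LINT x|M. 0)"
  proof (rule integral_dominated_convergence[where w = "\<lambda>x. 10 * (cmod (f x))\<^sup>2"])
    show "(\<lambda>x. (cmod (f x - s i x))\<^sup>2) \<in> borel_measurable M" for i
      using s_meas[of i] L2_measurable[OF f] by measurable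
    show "integrable M (\<lambda>x. 10 * (cmod (f x))\<^sup>2)" using L2_integrable[OF f] by simp
    show "AE x in M. (\<lambda>i. (cmod (f x - s i x))\<^sup>2) \<longlonglongrightarrow> 0"
    proof (rule AE_I2)
      fix x assume "x \<in> space M"
      hence "(\<lambda>i. (cmod (f x - s i x))\<^sup>2) \<longlonglongrightarrow> (cmod (f x - f x))\<^sup>2" by (intro tendsto_intros s(2))
      thus "(\<lambda>i. (cmod (f x - s i x))\<^sup>2) \<longlonglongrightarrow> 0" by simp
    qed
    show "AE x in M. norm ((cmod (f x - s i x))\<^sup>2) \<le> 10 * (cmod (f x))\<^sup>2" for i
    proof (rule AE_I2)
      fix x assume "x \<in> space M"
      thus "norm ((cmod (f x - s i x))\<^sup>2) \<le> 10 * (cmod (f x))\<^sup>2"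
        using norm_add_sq_le[of "f x" "- s i x"] s_sq[of x i] by simp
    qed
  qed simp
  hence lim: "(\<lambda>i. LINT x|M. (cmod (f x - s i x))\<^sup>2) \<longlonglongrightarrow> 0" by simp
  show ?thesis
  proof (rule approximable_limit[OF f])
    fix \<epsilon> :: real assume "\<epsilon> > 0"
    then obtain i where "(LINT x|M. (cmod (f x - s i x))\<^sup>2) < \<epsilon>"
      using order_tendstoD(2)[OF lim] eventually_happens by fastforce
    thus "\<exists>g. approximable g \<and> (LINT x|M. (cmod (f x - g x))\<^sup>2) < \<epsilon>" using s_approx by blast
  qed
qed

end

section \<open>The spectral measure of a base as a Riesz product\<close>

context rank_one
begin

definition base :: "nat \<Rightarrow> real \<Rightarrow> complex" where
  "base k = indicator (lev k 0)"

lemma emeasure_level: "i < h k \<Longrightarrow> emeasure M (lev k i) = ennreal (width p k)"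
proof -
  assume i: "i < h k"
  have "lev k i \<in> sets M" using level_subset_X[OF i] sets_level by (auto simp: sets_M_iff)
  moreover have "emeasure lborel (lev k i) = ennreal (width p k)"
    unfolding level_def using width_pos'[of k] by simp
  ultimately show ?thesis by (simp add: emeasure_M)
qed

lemma L2_level: "i < h k \<Longrightarrow> L2 (indicator (lev k i))"
  using level_subset_X[of i k] sets_level
  by (intro L2_indicator) (auto simp: sets_M_iff emeasure_level)

lemma L2_base: "L2 (base k)"
  unfolding base_def by (rule L2_level[OF h_pos])

lemma base_norm: "(LINT x|M. (cmod (base k x))\<^sup>2) = width p k"
proof -
  have "(cmod (base k x))\<^sup>2 = indicat_real (lev k 0) x" for x by (simp add: base_def indicator_def)
  hence "(LINT x|M. (cmod (base k x))\<^sup>2) = measure M (lev k 0 \<inter> space M)" by simp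
  also have "lev k 0 \<inter> space M = lev k 0" using level_subset_X[OF h_pos] by (auto simp: space_M)
  also have "measure M (lev k 0) = width p k"
    using emeasure_level[OF h_pos] width_pos'[of k] by (simp add: measure_def)
  finally show ?thesis .
qed

lemma T_pow_level: "x \<in> X \<Longrightarrow> i < h k \<Longrightarrow> (T ^^ i) x \<in> lev k i \<longleftrightarrow> x \<in> lev k 0"
proof (induction i)
  case (Suc i)
  have "(T ^^ Suc i) x \<in> lev k (Suc i) \<longleftrightarrow> (T ^^ i) x \<in> lev k i"
  proof
    assume "(T ^^ i) x \<in> lev k i"
    thus "(T ^^ Suc i) x \<in> lev k (Suc i)" using T_level_image[of i k] Suc.prems by simp
  next
    assume *: "(T ^^ Suc i) x \<in> lev k (Suc i)"
    define y where "y = (T ^^ Suc i) x - (b k (Suc i) - b k i)"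
    have y: "y \<in> lev k i" using * by (auto simp: y_def level_def)
    have "T y = T ((T ^^ i) x)" using T_level[OF Suc.prems(2) y] by (simp add: y_def)
    moreover have "y \<in> X" using level_subset_X[of i k] Suc.prems y by auto
    ultimately have "y = (T ^^ i) x" using T_inj T_pow_X[OF Suc.prems(1)] by (simp add: inj_onD)
    thus "(T ^^ i) x \<in> lev k i" using y by simp
  qed
  thus ?case using Suc by simp
qed simp

text \<open>
  Moved up by \<open>h k - 1\<close> steps, all levels become preimages of the base under nonnegative powers of \<open>T\<close>;
  negative powers, which are defined only almost everywhere, are thus avoided.
\<close>

lemma step_function_shift:
  assumes x: "x \<in> X"
  shows "(\<Sum>i<h k. \<alpha> i * indicator (lev k i) ((T ^^ (h k - 1)) x))
       = comb \<alpha> (\<lambda>i. h k - 1 - i) (h k) (base k) x"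
  unfolding comb_def base_def
proof (intro sum.cong refl)
  fix i assume "i \<in> {..<h k}"
  hence i: "i < h k" by simp
  hence "h k - 1 = i + (h k - 1 - i)" by simp
  hence "(T ^^ (h k - 1)) x = (T ^^ i) ((T ^^ (h k - 1 - i)) x)" by (metis comp_apply funpow_add)
  thus "\<alpha> i * indicator (lev k i) ((T ^^ (h k - 1)) x) = \<alpha> i * indicator (lev k 0) ((T ^^ (h k - 1 - i)) x)"
    using T_pow_level[OF T_pow_X[OF x] i] by (simp add: indicator_def)
qed

lemma base_split:
  assumes x: "x \<in> X"
  shows "base k x = (\<Sum>j<p k. indicator (lev (Suc k) (pos k j 0)) x)"
proof (cases "x \<in> lev k 0")
  case True
  then obtain j where j: "j < p k" "x \<in> lev (Suc k) (pos k j 0)" using level_split[OF h_pos] by auto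
  have "j' = j" if "j' < p k" "x \<in> lev (Suc k) (pos k j' 0)" for j'
  proof (rule ccontr)
    assume "j' \<noteq> j"
    have *: "pos k i 0 < pos k i' 0" if "i < i'" "i' < p k" for i i'
    proof -
      have "Suc i * h k \<le> i' * h k" using that by (intro mult_le_mono1) simp
      thus ?thesis using spacer_sum_mono[of i i' a k] that h_pos[of k] by (simp add: pos_def)
    qed
    have "pos k j' 0 = pos k j 0"
      using level_unique[OF that(2) j(2) pos_less[OF that(1) h_pos] pos_less[OF j(1) h_pos]] .
    thus False using *[of j j'] *[of j' j] that(1) j(1) \<open>j' \<noteq> j\<close> by (metis linorder_neqE_nat less_irrefl)
  qed
  hence "(\<Sum>j'<p k. indicator (lev (Suc k) (pos k j' 0)) x) = (\<Sum>j'<p k. if j' = j then (1::complex) else 0)"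
    using j(2) by (intro sum.cong refl) (metis indicator_simps lessThan_iff)
  thus ?thesis using j True by (simp add: base_def)
next
  case False
  hence "x \<notin> lev (Suc k) (pos k j 0)" if "j < p k" for j using level_split[OF h_pos, of k] that by blast
  hence "(\<Sum>j<p k. indicator (lev (Suc k) (pos k j 0)) x) = (0::complex)" by (intro sum.neutral) simp
  thus ?thesis using False by (simp add: base_def)
qed

definition base_spectrum :: "nat \<Rightarrow> complex measure" where
  "base_spectrum k = (SOME \<sigma>. spectral \<sigma> (base k))"

lemma spectral_base: "spectral (base_spectrum k) (base k)"
  unfolding base_spectrum_def using spectral_exists[OF L2_base[of k]] by (metis someI_ex)

lemma circle_measure_base: "circle_measure (base_spectrum k)"
  using spectral_base[of k] by (simp add: spectral_def)

lemma base_mass: "measure (base_spectrum k) (space (base_spectrum k)) = width p k"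
  using spectral_mass[OF spectral_base] by (simp add: base_norm)

text \<open>
  On the circle, reversing the exponents amounts to conjugation and multiplication by a unimodular
  monomial.
\<close>

lemma cmod_sum_reflect:
  assumes z: "z \<in> unit_circle" and e: "\<And>i. i < N \<Longrightarrow> e i \<le> E"
  shows "cmod (\<Sum>i<N. \<alpha> i * z ^ (E - e i)) = cmod (\<Sum>i<N. cnj (\<alpha> i) * z ^ e i)"
proof -
  have "(\<Sum>i<N. \<alpha> i * z ^ (E - e i)) = z ^ E * cnj (\<Sum>i<N. cnj (\<alpha> i) * z ^ e i)"
    unfolding cnj_sum sum_distrib_left
  proof (intro sum.cong refl)
    fix i assume "i \<in> {..<N}"
    hence "int (E - e i) = int E + - int (e i)" using e by simp
    hence "z ^ (E - e i) = z ^ E * cnj (z ^ e i)"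
      using circle_powi_add[OF z, of "int E" "- int (e i)"] cnj_powi[OF z, of "int (e i)"]
      by (metis power_int_of_nat)
    thus "\<alpha> i * z ^ (E - e i) = z ^ E * cnj (cnj (\<alpha> i) * z ^ e i)" by simp
  qed
  moreover have "cmod (z ^ E) = 1" using circle_norm_powi[OF z, of "int E"] by simp
  ultimately show ?thesis by (simp only: norm_mult complex_mod_cnj mult_1)
qed

lemma step_function_spectrum:
  assumes F: "L2 F" "\<And>x. x \<in> X \<Longrightarrow> F x = (\<Sum>i<h k. \<alpha> i * indicator (lev k i) x)"
    and \<sigma>: "spectral \<sigma> F" and g: "trig UNIV (\<lambda>z. complex_of_real (g z))"
  shows "(LINT z|\<sigma>. g z) = (LINT z|base_spectrum k. g z * (cmod (\<Sum>i<h k. \<alpha> i * z ^ i))\<^sup>2)"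
proof -
  interpret B: circle_measure "base_spectrum k" by (rule circle_measure_base)
  have "corr F n = corr (comb \<alpha> (\<lambda>i. h k - 1 - i) (h k) (base k)) n" for n
  proof -
    have "corr F n = corr (\<lambda>x. F ((T ^^ (h k - 1)) x)) n" by (rule corr_T_pow[OF F(1), symmetric])
    also have "\<dots> = corr (comb \<alpha> (\<lambda>i. h k - 1 - i) (h k) (base k)) n"
      by (rule corr_cong[OF L2_T_pow[OF F(1)]]) (simp only: F(2) T_pow_X step_function_shift)
    finally show ?thesis .
  qed
  from spectral_combination[OF L2_base \<sigma> spectral_base this g]
  have "(LINT z|\<sigma>. g z) = (LINT z|base_spectrum k. g z * (cmod (\<Sum>i<h k. cnj (\<alpha> i) * z ^ (h k - 1 - i)))\<^sup>2)" .
  also have "\<dots> = (LINT z|base_spectrum k. g z * (cmod (\<Sum>i<h k. \<alpha> i * z ^ i))\<^sup>2)"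
  proof (rule B.integral_cong_circle)
    fix z :: complex assume "z \<in> unit_circle"
    from cmod_sum_reflect[OF this, of "h k" "\<lambda>i. i" "h k - 1" "\<lambda>i. cnj (\<alpha> i)"]
    show "g z * (cmod (\<Sum>i<h k. cnj (\<alpha> i) * z ^ (h k - 1 - i)))\<^sup>2 = g z * (cmod (\<Sum>i<h k. \<alpha> i * z ^ i))\<^sup>2"
      by fastforce
  qed
  finally show ?thesis .
qed

text \<open>
  The base of stack \<open>k\<close> is the union of those levels of the next stack that are the bottoms of the
  columns, so this is the spectrum of a step function with coefficients 0 and 1.
\<close>

lemma base_spectrum_Suc:
  assumes g: "trig UNIV (\<lambda>z. complex_of_real (g z))"
  shows "(LINT z|base_spectrum k. g z) = p k * (LINT z|base_spectrum (Suc k). g z * (cmod (riesz p a k z))\<^sup>2)"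
proof -
  interpret B: circle_measure "base_spectrum (Suc k)" by (rule circle_measure_base)
  define \<alpha> where "\<alpha> i = (if i \<in> (\<lambda>j. pos k j 0) ` {..<p k} then 1 else 0 :: complex)" for i
  have inj: "inj_on (\<lambda>j. pos k j 0) {..<p k}"
  proof (rule linorder_inj_onI')
    fix i i' assume "i \<in> {..<p k}" "i' \<in> {..<p k}" "i < i'"
    hence "Suc i * h k \<le> i' * h k" by (intro mult_le_mono1) simp
    thus "pos k i 0 \<noteq> pos k i' 0"
      using spacer_sum_mono[of i i' a k] \<open>i < i'\<close> h_pos[of k] by (simp add: pos_def)
  qed
  have sum: "(\<Sum>i<h (Suc k). \<alpha> i * G i) = (\<Sum>j<p k. G (pos k j 0))" for G :: "nat \<Rightarrow> complex"
  proof -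
    have "(\<Sum>i<h (Suc k). \<alpha> i * G i) = (\<Sum>i\<in>(\<lambda>j. pos k j 0) ` {..<p k}. G i)"
      using pos_less[OF _ h_pos] by (intro sum.mono_neutral_cong_right) (auto simp: \<alpha>_def)
    also have "\<dots> = (\<Sum>j<p k. G (pos k j 0))" by (simp only: sum.reindex[OF inj] comp_def)
    finally show ?thesis .
  qed
  have "(LINT z|base_spectrum k. g z)
      = (LINT z|base_spectrum (Suc k). g z * (cmod (\<Sum>i<h (Suc k). \<alpha> i * z ^ i))\<^sup>2)"
    by (rule step_function_spectrum[OF L2_base _ spectral_base g]) (simp only: base_split sum)
  also have "\<dots> = (LINT z|base_spectrum (Suc k). p k * (g z * (cmod (riesz p a k z))\<^sup>2))"
    using p_pos[of k] unfolding sum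
    by (intro B.integral_cong_circle) (simp add: riesz_def norm_divide power_divide pos_def)
  finally show ?thesis by simp
qed

lemma trig_riesz_sq: "trig UNIV (\<lambda>z. complex_of_real ((cmod (riesz p a k z))\<^sup>2))"
proof -
  have "trig UNIV (\<lambda>z. z powi int n)" for n using trig_monom[of "int n" UNIV 1] by simp
  hence "trig UNIV (\<lambda>z. z ^ n)" for n by simp
  hence r: "trig UNIV (riesz p a k)"
    unfolding riesz_def[abs_def] divide_inverse
    by (subst mult.commute) (intro trig_cmult trig_sum)
  show ?thesis
    unfolding complex_norm_square by (intro trig_UNIV_mult r trig_cnj[OF r]) auto
qed

definition riesz_product :: "nat set \<Rightarrow> complex \<Rightarrow> real" where
  "riesz_product J z = (\<Prod>k\<in>J. (cmod (riesz p a k z))\<^sup>2)"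

lemma trig_riesz_product: "trig UNIV (\<lambda>z. complex_of_real (riesz_product J z))"
  unfolding riesz_product_def of_real_prod
  by (induction J rule: infinite_finite_induct)
     (simp_all add: trig_const trig_UNIV_mult trig_riesz_sq del: of_real_power)

lemma riesz_product_nonneg: "0 \<le> riesz_product J z"
  unfolding riesz_product_def by (intro prod_nonneg) auto

lemma continuous_riesz_product: "continuous_on unit_circle (riesz_product J)"
  using continuous_on_Re[OF trig_continuous[OF trig_riesz_product[of J]]] by simp

lemma base_spectrum_product:
  assumes g: "trig UNIV (\<lambda>z. complex_of_real (g z))" and mn: "m \<le> n"
  shows "(LINT z|base_spectrum m. g z)
    = (\<Prod>k\<in>{m..<n}. real (p k)) * (LINT z|base_spectrum n. g z * riesz_product {m..<n} z)"
  using mn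
proof (induction n rule: dec_induct)
  case base
  show ?case by (simp add: riesz_product_def)
next
  case (step n)
  have "trig UNIV (\<lambda>z. complex_of_real (g z * riesz_product {m..<n} z))"
    unfolding of_real_mult by (intro trig_UNIV_mult g trig_riesz_product)
  from base_spectrum_Suc[OF this, of n]
  have "(LINT z|base_spectrum n. g z * riesz_product {m..<n} z)
      = p n * (LINT z|base_spectrum (Suc n). g z * riesz_product {m..<Suc n} z)"
    using step.hyps by (simp add: riesz_product_def prod.atLeastLessThan_Suc mult.assoc)
  thus ?case using step by (simp add: prod.atLeastLessThan_Suc)
qed

lemma corr_base_nonneg: "0 \<le> Re (corr (base k) n)"
proof -
  have nat: "0 \<le> Re (corr (base k) (int m))" for m
  proof -
    have "base k ((T ^^ m) x) * cnj (base k x) = complex_of_real (indicat_real (lev k 0) ((T ^^ m) x) * indicat_real (lev k 0) x)" for x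
      by (simp add: base_def indicator_def)
    hence "corr (base k) (int m) = complex_of_real (LINT x|M. indicat_real (lev k 0) ((T ^^ m) x) * indicat_real (lev k 0) x)"
      by (simp only: corr_nat integral_complex_of_real)
    thus ?thesis by simp
  qed
  show ?thesis
  proof (cases "n \<ge> 0")
    case True
    then show ?thesis using nat[of "nat n"] by simp
  next
    case False
    then show ?thesis using nat[of "nat (- n)"] corr_uminus[OF L2_base, of k "- n"] by simp
  qed
qed

lemma riesz_product_moment_insert:
  assumes "finite J" "k \<notin> J"
  shows "(LINT z|base_spectrum N. z powi n * complex_of_real (riesz_product (insert k J) z))
    = (\<Sum>i<p k. \<Sum>j<p k. (LINT z|base_spectrum N.
        z powi (n + int (pos k i 0) - int (pos k j 0)) * complex_of_real (riesz_product J z))) / p k"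
proof -
  interpret B: circle_measure "base_spectrum N" by (rule circle_measure_base)
  have "(LINT z|base_spectrum N. z powi n * complex_of_real (riesz_product (insert k J) z))
    = (LINT z|base_spectrum N. (\<Sum>i<p k. \<Sum>j<p k.
        z powi (n + int (pos k i 0) - int (pos k j 0)) * complex_of_real (riesz_product J z)) / p k)"
  proof (rule B.integral_cong_circle)
    fix z :: complex assume z: "z \<in> unit_circle"
    have riesz: "(cmod (riesz p a k z))\<^sup>2 = (cmod (\<Sum>j<p k. z powi int (pos k j 0)))\<^sup>2 / p k"
      unfolding power_int_of_nat by (simp add: riesz_def pos_def norm_divide power_divide)
    have "complex_of_real ((cmod (riesz p a k z))\<^sup>2)
        = (\<Sum>i<p k. \<Sum>j<p k. z powi (int (pos k i 0) - int (pos k j 0))) / p k"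
      unfolding riesz of_real_divide circle_norm_sum_sq[OF z] by simp
    moreover have "z powi (n + int (pos k i 0) - int (pos k j 0)) = z powi n * z powi (int (pos k i 0) - int (pos k j 0))" for i j
      by (simp only: circle_powi_add[OF z, symmetric] add_diff_eq)
    ultimately show "z powi n * complex_of_real (riesz_product (insert k J) z) = (\<Sum>i<p k. \<Sum>j<p k.
        z powi (n + int (pos k i 0) - int (pos k j 0)) * complex_of_real (riesz_product J z)) / p k"
      using assms unfolding riesz_product_def
      by (simp add: sum_distrib_left sum_distrib_right mult.assoc mult.left_commute mult.commute)
  qed
  also have "\<dots> = (\<Sum>i<p k. \<Sum>j<p k. (LINT z|base_spectrum N.
        z powi (n + int (pos k i 0) - int (pos k j 0)) * complex_of_real (riesz_product J z))) / p k"
    by (simp add: B.continuous_integrable continuous_on_sum continuous_on_mult continuous_on_powi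
        continuous_on_of_real continuous_riesz_product)
  finally show ?thesis .
qed

text \<open>
  The correlations of an indicator function are nonnegative, and a factor \<open>\<bar>P\<^sub>k\<bar>\<^sup>2\<close> replaces a moment by a
  combination of moments with positive coefficients.
\<close>

lemma riesz_product_moment_nonneg:
  assumes "finite J"
  shows "0 \<le> Re (LINT z|base_spectrum N. z powi n * complex_of_real (riesz_product J z))"
  using assms
proof (induction J arbitrary: n)
  case empty
  show ?case
    using corr_base_nonneg[of N "- n"] spectral_moment[OF spectral_base] by (simp add: riesz_product_def)
next
  case (insert k J)
  then show ?case
    unfolding riesz_product_moment_insert[OF insert.hyps]
    by (simp add: sum_nonneg)
qed

text \<open>
  Keep only the diagonal terms in the expansion of the new factor: they reproduce the old mass, and
  the others are nonnegative.
\<close>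

lemma riesz_product_mass_insert:
  assumes J: "finite J" "k \<notin> J"
  shows "(LINT z|base_spectrum N. riesz_product J z) \<le> (LINT z|base_spectrum N. riesz_product (insert k J) z)"
proof -
  define c where "c J n = Re (LINT z|base_spectrum N. z powi n * complex_of_real (riesz_product J z))" for J n
  have mass: "(LINT z|base_spectrum N. riesz_product J z) = c J 0" for J
    by (simp add: c_def integral_complex_of_real)
  have nonneg: "0 \<le> c J n" for n unfolding c_def by (rule riesz_product_moment_nonneg[OF J(1)])
  have "p k * c J 0 = (\<Sum>i<p k. c J (0 + int (pos k i 0) - int (pos k i 0)))" by simp
  also have "\<dots> \<le> (\<Sum>i<p k. \<Sum>j<p k. c J (0 + int (pos k i 0) - int (pos k j 0)))"
    by (intro sum_mono member_le_sum[where f = "\<lambda>j. c J (0 + int (pos k _ 0) - int (pos k j 0))"] nonneg) auto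
  also have "\<dots> = p k * c (insert k J) 0"
    unfolding c_def riesz_product_moment_insert[OF J] using p_pos[of k] by simp
  finally show ?thesis unfolding mass using p_pos[of k] by simp
qed

lemma riesz_product_mass_mono:
  assumes "finite L" "J \<subseteq> L"
  shows "(LINT z|base_spectrum N. riesz_product J z) \<le> (LINT z|base_spectrum N. riesz_product L z)"
proof -
  have "(LINT z|base_spectrum N. riesz_product J z) \<le> (LINT z|base_spectrum N. riesz_product (J \<union> D) z)"
    if "finite D" "D \<inter> J = {}" for D
    using that
  proof (induction D)
    case (insert k D)
    have "(LINT z|base_spectrum N. riesz_product (J \<union> D) z) \<le> (LINT z|base_spectrum N. riesz_product (insert k (J \<union> D)) z)"
      using insert.hyps insert.prems finite_subset[OF assms(2,1)] by (intro riesz_product_mass_insert) auto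
    then show ?case using insert by simp
  qed simp
  moreover have "(L - J) \<inter> J = {}" "J \<union> (L - J) = L" using assms by blast+
  ultimately show ?thesis using assms(1) by (metis finite_Diff)
qed

text \<open>
  Write the spectral measure of the base of stack \<open>m\<close> as the Riesz product over \<open>{m..<n}\<close> times that of the
  base of stack \<open>n\<close>. The factors in \<open>K\<close> are absorbed by \<open>g\<close>, and the product of those outside
  \<open>K\<close> has at most the mass of the full product, which, together with the normalizing constant, is the
  measure of the base of stack \<open>m\<close>, at most 1.
\<close>

lemma base_spectrum_bound:
  assumes g: "trig UNIV (\<lambda>z. complex_of_real (g z))"
    and K: "finite K" "K \<subseteq> {m..}" and C: "0 \<le> C"
    and bound: "\<And>z. z \<in> unit_circle \<Longrightarrow> g z * riesz_product K z \<le> C"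
  shows "(LINT z|base_spectrum m. g z) \<le> C"
proof -
  obtain n where n: "m \<le> n" "K \<subseteq> {m..<n}"
  proof
    show "m \<le> Suc (Max (insert m K))" using K by (auto intro: le_SucI Max_ge)
    show "K \<subseteq> {m..<Suc (Max (insert m K))}" using K by (auto simp: less_Suc_eq_le intro: Max_ge)
  qed
  interpret B: circle_measure "base_spectrum n" by (rule circle_measure_base)
  define R where "R = (\<Prod>k\<in>{m..<n}. real (p k))"
  have R: "0 \<le> R" unfolding R_def by (intro prod_nonneg) auto
  have cg: "continuous_on unit_circle g" using continuous_on_Re[OF trig_continuous[OF g]] by simp
  have split: "riesz_product {m..<n} z = riesz_product K z * riesz_product ({m..<n} - K) z" for z
    unfolding riesz_product_def using prod.subset_diff[OF n(2), of "\<lambda>k. (cmod (riesz p a k z))\<^sup>2"]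
    by (simp add: mult.commute)
  have mass: "R * (LINT z|base_spectrum n. riesz_product {m..<n} z) = width p m"
  proof -
    interpret Bm: circle_measure "base_spectrum m" by (rule circle_measure_base)
    show ?thesis
      using base_spectrum_product[of "\<lambda>_. 1", OF _ n(1)] base_mass[of m] by (simp add: R_def trig_const)
  qed
  have "(LINT z|base_spectrum m. g z) = R * (LINT z|base_spectrum n. g z * riesz_product {m..<n} z)"
    unfolding R_def by (rule base_spectrum_product[OF g n(1)])
  also have "\<dots> \<le> R * (LINT z|base_spectrum n. C * riesz_product ({m..<n} - K) z)"
  proof (intro mult_left_mono R integral_mono B.continuous_integrable continuous_intros cg continuous_riesz_product)
    fix z assume "z \<in> space (base_spectrum n)"
    hence "g z * riesz_product K z * riesz_product ({m..<n} - K) z \<le> C * riesz_product ({m..<n} - K) z"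
      by (intro mult_right_mono bound riesz_product_nonneg) (simp only: B.space_circle)
    thus "g z * riesz_product {m..<n} z \<le> C * riesz_product ({m..<n} - K) z"
      unfolding split by (simp only: mult.assoc)
  qed
  also have "\<dots> = C * (R * (LINT z|base_spectrum n. riesz_product ({m..<n} - K) z))" by simp
  also have "\<dots> \<le> C * (R * (LINT z|base_spectrum n. riesz_product {m..<n} z))"
    by (intro mult_left_mono C R riesz_product_mass_mono) auto
  also have "\<dots> \<le> C * 1"
    unfolding mass using order_trans[OF width_le[of m]] by (intro mult_left_mono C) (simp add: power_le_one)
  finally show ?thesis by simp
qed

end

section \<open>Singularity\<close>

text \<open>
  The sets \<open>{g \<ge> 1/2}\<close> have small measure for \<open>\<sigma>\<close>, and their complements have small Lebesgue measure. By
  the Borel-Cantelli lemma, the limit superior of such sets with summable errors separates the two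
  measures.
\<close>

lemma mutually_singular_by_test_functions:
  assumes \<sigma>: "circle_measure \<sigma>"
    and test: "\<And>\<epsilon>. \<epsilon> > 0 \<Longrightarrow> \<exists>g. continuous_on unit_circle g \<and> (\<forall>z\<in>unit_circle. 0 \<le> g z)
      \<and> (LINT z|\<sigma>. g z) \<le> \<epsilon> \<and> measure circle_lebesgue {z \<in> unit_circle. g z < 1 / 2} \<le> \<epsilon>"
  shows "mutually_singular \<sigma> circle_lebesgue"
proof -
  interpret circle_measure \<sigma> by fact
  have "\<exists>A\<in>sets \<sigma>. measure \<sigma> A \<le> \<epsilon> \<and> measure circle_lebesgue (unit_circle - A) \<le> \<epsilon>" if \<epsilon>: "\<epsilon> > 0" for \<epsilon>
  proof -
    obtain g where g: "continuous_on unit_circle g" "\<And>z. z \<in> unit_circle \<Longrightarrow> 0 \<le> g z"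
      "(LINT z|\<sigma>. g z) \<le> \<epsilon> / 2" "measure circle_lebesgue {z \<in> unit_circle. g z < 1 / 2} \<le> \<epsilon> / 2"
      using test[of "\<epsilon> / 2"] \<epsilon> by auto
    have i: "integrable \<sigma> g" by (rule continuous_integrable[OF g(1)])
    define A where "A = {z \<in> space \<sigma>. g z \<ge> 1 / 2}"
    have A: "A \<in> sets \<sigma>" unfolding A_def using borel_measurable_integrable[OF i] by measurable
    have "measure \<sigma> A \<le> (LINT z|\<sigma>. g z) / (1 / 2)"
      unfolding A_def using i g(2)
      by (intro integral_Markov_inequality_measure[where A = "{}"]) (auto intro!: AE_I2 simp: space_circle)
    hence "measure \<sigma> A \<le> \<epsilon>" using g(3) by simp
    moreover have "unit_circle - A = {z \<in> unit_circle. g z < 1 / 2}" by (auto simp: A_def space_circle)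
    hence "measure circle_lebesgue (unit_circle - A) \<le> \<epsilon>" using g(4) \<epsilon> by simp
    ultimately show ?thesis using A by blast
  qed
  hence "\<exists>A. \<forall>n. A n \<in> sets \<sigma> \<and> measure \<sigma> (A n) \<le> (1 / 2) ^ n
      \<and> measure circle_lebesgue (unit_circle - A n) \<le> (1 / 2) ^ n"
    by (intro choice allI) (meson zero_less_power half_gt_zero zero_less_one)
  then obtain A :: "nat \<Rightarrow> complex set" where A: "\<And>n. A n \<in> sets \<sigma>" "\<And>n. measure \<sigma> (A n) \<le> (1 / 2) ^ n"
    "\<And>n. measure circle_lebesgue (unit_circle - A n) \<le> (1 / 2) ^ n" by blast
  have sets_eq: "sets \<sigma> = sets circle_lebesgue" by (simp add: sets_circle Leb.sets_circle)
  have summ: "summable (\<lambda>n. (1 / 2) ^ n :: real)" by (rule summable_geometric) simp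
  have 1: "limsup A \<in> null_sets \<sigma>"
    using A summ by (intro borel_cantelli_limsup1)
      (auto intro!: summable_comparison_test'[OF summ, of 0] simp: less_top[symmetric])
  have 2: "limsup (\<lambda>n. unit_circle - A n) \<in> null_sets circle_lebesgue"
  proof (rule borel_cantelli_limsup1)
    show "unit_circle - A n \<in> sets circle_lebesgue" for n
      using sets.compl_sets[OF A(1)[of n]] by (simp add: space_circle sets_eq)
    show "summable (\<lambda>n. measure circle_lebesgue (unit_circle - A n))"
      using A(3) by (intro summable_comparison_test'[OF summ, of 0]) auto
  qed (simp add: less_top[symmetric])
  have "space circle_lebesgue - limsup A \<subseteq> limsup (\<lambda>n. unit_circle - A n)"
  proof
    fix z assume z: "z \<in> space circle_lebesgue - limsup A"
    then obtain n where n: "\<And>k. k \<ge> n \<Longrightarrow> z \<notin> A k" unfolding limsup_INF_SUP by auto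
    have "z \<in> unit_circle" using z by (simp only: Leb.space_circle Diff_iff)
    hence "\<exists>k\<in>{m..}. z \<in> unit_circle - A k" for m
      using n[of "max m n"] by (intro bexI[of _ "max m n"]) auto
    thus "z \<in> limsup (\<lambda>n. unit_circle - A n)" unfolding limsup_INF_SUP by blast
  qed
  hence "emeasure circle_lebesgue (space circle_lebesgue - limsup A) = 0"
    using 2 emeasure_mono[of _ "limsup (\<lambda>n. unit_circle - A n)" circle_lebesgue] by (auto simp: null_sets_def)
  thus ?thesis
    unfolding mutually_singular_def using sets_eq 1 by (auto simp: null_sets_def)
qed

locale lacunary_rank_one = rank_one p a b T + lacunary_spacers p a for p a b T
begin

text \<open>
  The test function approximates \<open>\<psi>\<close>, which is at least \<open>3/4\<close> where the product \<open>Q\<close> of moduli is less than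
  \<open>\<delta>\<close> and vanishes where \<open>Q \<ge> 4 * \<delta>\<close>. So \<open>g * Q\<^sup>2\<close> is at most \<open>16 * \<delta>\<^sup>2\<close>, plus \<open>2 * \<delta>\<^sup>2\<close> for the error of
  approximation.
\<close>

lemma base_spectrum_test_function:
  assumes \<epsilon>: "\<epsilon> > 0"
  obtains g where "trig UNIV (\<lambda>z. complex_of_real (g z))" "\<And>z. z \<in> unit_circle \<Longrightarrow> 0 \<le> g z \<and> g z \<le> 2"
    "(LINT z|base_spectrum m. g z) \<le> \<epsilon>" "measure circle_lebesgue {z \<in> unit_circle. g z < 1 / 2} \<le> \<epsilon>"
proof -
  define \<delta> where "\<delta> = sqrt (\<epsilon> / 18)"
  have \<delta>: "\<delta> > 0" "18 * \<delta>\<^sup>2 = \<epsilon>" using \<epsilon> by (simp_all add: \<delta>_def)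
  obtain K where K: "finite K" "K \<subseteq> {m..}"
    "(LINT z|circle_lebesgue. (\<Prod>k\<in>K. cmod (riesz p a k z))) < \<epsilon> * \<delta>"
    using riesz_products_vanish[of "\<epsilon> * \<delta>" m] \<epsilon> \<delta> by auto
  define Q where "Q z = (\<Prod>k\<in>K. cmod (riesz p a k z))" for z
  have Q0: "0 \<le> Q z" for z unfolding Q_def by (intro prod_nonneg) auto
  have cQ: "continuous_on unit_circle Q" unfolding Q_def by (intro continuous_intros continuous_riesz)
  have Q_sq: "riesz_product K z = (Q z)\<^sup>2" for z
    by (simp add: riesz_product_def Q_def prod_power_distrib)
  obtain B where B: "\<And>z. z \<in> unit_circle \<Longrightarrow> (Q z)\<^sup>2 \<le> B"
  proof -
    have "compact ((\<lambda>z. (Q z)\<^sup>2) ` unit_circle)"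
      by (intro compact_continuous_image compact_sphere continuous_intros cQ)
    from compact_imp_bounded[OF this] obtain B where "\<forall>x\<in>(\<lambda>z. (Q z)\<^sup>2) ` unit_circle. norm x \<le> B"
      unfolding bounded_iff by blast
    hence "(Q z)\<^sup>2 \<le> B" if "z \<in> unit_circle" for z using that by force
    thus ?thesis by (rule that)
  qed
  have B0: "0 \<le> B" using B[of 1] order_trans[OF zero_le_power2[of "Q 1"]] by simp
  define \<psi> where "\<psi> z = max 0 (1 - Q z / (4 * \<delta>))" for z
  have c\<psi>: "continuous_on unit_circle \<psi>"
    unfolding \<psi>_def using \<delta> by (intro continuous_intros cQ) auto
  define \<eta> where "\<eta> = min (1 / 8) (\<delta>\<^sup>2 / (B + 1))"
  have \<eta>: "\<eta> > 0" "\<eta> \<le> 1 / 8" "\<eta> * B \<le> \<delta>\<^sup>2"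
  proof -
    show "\<eta> > 0" using \<delta> B0 by (simp add: \<eta>_def add_nonneg_pos)
    show "\<eta> \<le> 1 / 8" unfolding \<eta>_def by (rule min.cobounded1)
    have "\<eta> * B \<le> \<delta>\<^sup>2 / (B + 1) * B" using B0 by (intro mult_right_mono) (auto simp: \<eta>_def)
    also have "\<dots> \<le> \<delta>\<^sup>2" using B0 \<delta> by (simp add: divide_simps mult_left_mono)
    finally show "\<eta> * B \<le> \<delta>\<^sup>2" .
  qed
  obtain f where f: "trig UNIV (\<lambda>z. complex_of_real (f z))" "\<And>z. z \<in> unit_circle \<Longrightarrow> \<bar>\<psi> z - f z\<bar> < \<eta>"
    using trig_approximation[OF c\<psi> \<eta>(1)] by blast
  define g where "g z = f z + \<eta>" for z
  have g: "\<psi> z \<le> g z" "g z \<le> \<psi> z + 2 * \<eta>" if "z \<in> unit_circle" for z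
    using f(2)[OF that] unfolding g_def abs_less_iff by linarith+
  have \<psi>: "0 \<le> \<psi> z" "\<psi> z \<le> 1" for z using Q0[of z] \<delta> by (auto simp: \<psi>_def)
  show ?thesis
  proof (rule that[of g])
    show tg: "trig UNIV (\<lambda>z. complex_of_real (g z))"
      unfolding g_def of_real_add by (intro trig_add f trig_const) auto
    show "0 \<le> g z \<and> g z \<le> 2" if "z \<in> unit_circle" for z
      using g[OF that] \<psi>[of z] \<eta> by linarith
    show "(LINT z|base_spectrum m. g z) \<le> \<epsilon>"
    proof (rule base_spectrum_bound[OF tg K(1,2)])
      show "0 \<le> \<epsilon>" using \<epsilon> by simp
      fix z :: complex assume z: "z \<in> unit_circle"
      have "\<psi> z * (Q z)\<^sup>2 \<le> 16 * \<delta>\<^sup>2"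
      proof (cases "Q z \<le> 4 * \<delta>")
        case True
        have "\<psi> z * (Q z)\<^sup>2 \<le> 1 * (4 * \<delta>)\<^sup>2"
          using True Q0[of z] \<psi>[of z] by (intro mult_mono power_mono) auto
        thus ?thesis by (simp add: power_mult_distrib)
      next
        case False
        hence "\<psi> z = 0" using \<delta> by (simp add: \<psi>_def)
        thus ?thesis by simp
      qed
      moreover have "2 * \<eta> * (Q z)\<^sup>2 \<le> 2 * (\<eta> * B)" using B[OF z] \<eta>(1) by simp
      moreover have "g z * (Q z)\<^sup>2 \<le> (\<psi> z + 2 * \<eta>) * (Q z)\<^sup>2" using g(2)[OF z] by (intro mult_right_mono) auto
      ultimately show "g z * riesz_product K z \<le> \<epsilon>"
        unfolding Q_sq \<delta>(2)[symmetric] using \<eta>(3) by (simp only: distrib_right)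
    qed
    have iQ: "integrable circle_lebesgue Q" by (rule Leb.continuous_integrable[OF cQ])
    have "{z \<in> unit_circle. g z < 1 / 2} \<subseteq> {z \<in> space circle_lebesgue. Q z \<ge> \<delta>}"
    proof
      fix z assume "z \<in> {z \<in> unit_circle. g z < 1 / 2}"
      hence z: "z \<in> unit_circle" "g z < 1 / 2" by simp_all
      hence "1 - Q z / (4 * \<delta>) < 1 / 2" using g(1)[OF z(1)] unfolding \<psi>_def by linarith
      hence "Q z \<ge> \<delta>" using \<delta> by (simp add: field_simps)
      thus "z \<in> {z \<in> space circle_lebesgue. Q z \<ge> \<delta>}" using z by (simp only: Leb.space_circle mem_Collect_eq)
    qed
    hence "measure circle_lebesgue {z \<in> unit_circle. g z < 1 / 2} \<le> measure circle_lebesgue {z \<in> space circle_lebesgue. Q z \<ge> \<delta>}"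
      using borel_measurable_integrable[OF iQ] by (intro Leb.finite_measure_mono) measurable
    also have "\<dots> \<le> (LINT z|circle_lebesgue. Q z) / \<delta>"
      using iQ \<delta> Q0 by (intro integral_Markov_inequality_measure[where A = "{}"]) auto
    also have "\<dots> \<le> \<epsilon>" using K(3) \<delta> unfolding Q_def[symmetric] by (simp add: divide_le_eq)
    finally show "measure circle_lebesgue {z \<in> unit_circle. g z < 1 / 2} \<le> \<epsilon>" .
  qed
qed

text \<open>
  Split \<open>f\<close> into a step function \<open>F\<close> of some stack and a small rest. The test function for the base of
  that stack is also small for \<open>F\<close>, whose spectral density with respect to the base is bounded, and the
  rest has a spectral measure of small mass.
\<close>

lemma spectrum_test_function:
  assumes f: "L2 f" and \<sigma>: "spectral \<sigma> f" and \<epsilon>: "\<epsilon> > 0"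
  shows "\<exists>g. continuous_on unit_circle g \<and> (\<forall>z\<in>unit_circle. 0 \<le> g z)
      \<and> (LINT z|\<sigma>. g z) \<le> \<epsilon> \<and> measure circle_lebesgue {z \<in> unit_circle. g z < 1 / 2} \<le> \<epsilon>"
proof -
  obtain k F where F: "L2 F" "stack_const k F" "(LINT x|M. (cmod (f x - F x))\<^sup>2) < \<epsilon> / 8"
    using L2_approximable[OF f] \<epsilon> unfolding approximable_def by (metis divide_pos_pos zero_less_numeral)
  obtain \<alpha> where \<alpha>: "\<And>x. x \<in> X \<Longrightarrow> F x = (\<Sum>i<h k. \<alpha> i * indicator (lev k i) x)"
    using stack_const_sum_levels[OF F(2)] by blast
  have u: "L2 (\<lambda>x. f x - F x)" by (rule L2_diff[OF f F(1)])
  obtain \<sigma>F \<sigma>u where \<sigma>F: "spectral \<sigma>F F" and \<sigma>u: "spectral \<sigma>u (\<lambda>x. f x - F x)"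
    using spectral_exists[OF F(1)] spectral_exists[OF u] by metis
  interpret B: circle_measure "base_spectrum k" by (rule circle_measure_base)
  interpret U: circle_measure \<sigma>u using \<sigma>u by (simp add: spectral_def)
  define c where "c = (\<Sum>i<h k. cmod (\<alpha> i))\<^sup>2"
  have c: "0 \<le> c" by (simp add: c_def)
  \<comment> \<open>small enough to outweigh the bound \<open>c\<close> for the spectral density of \<open>F\<close>\<close>
  define \<epsilon>' where "\<epsilon>' = min \<epsilon> (\<epsilon> / (4 * (c + 1)))"
  have \<epsilon>': "\<epsilon>' > 0" "\<epsilon>' \<le> \<epsilon>" using \<epsilon> c by (auto simp: \<epsilon>'_def intro!: divide_pos_pos add_nonneg_pos)
  have c\<epsilon>': "c * \<epsilon>' \<le> \<epsilon> / 4"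
  proof -
    have "c * \<epsilon>' \<le> c * (\<epsilon> / (4 * (c + 1)))" using c by (intro mult_left_mono) (auto simp: \<epsilon>'_def)
    also have "\<dots> \<le> \<epsilon> / 4" using c \<epsilon> by (simp add: divide_simps)
    finally show ?thesis .
  qed
  obtain g where g: "trig UNIV (\<lambda>z. complex_of_real (g z))" "\<And>z. z \<in> unit_circle \<Longrightarrow> 0 \<le> g z \<and> g z \<le> 2"
    "(LINT z|base_spectrum k. g z) \<le> \<epsilon>'" "measure circle_lebesgue {z \<in> unit_circle. g z < 1 / 2} \<le> \<epsilon>'"
    using base_spectrum_test_function[OF \<epsilon>'(1), of k] by blast
  have cg: "continuous_on unit_circle g" using continuous_on_Re[OF trig_continuous[OF g(1)]] by simp
  have "(LINT z|\<sigma>F. g z) = (LINT z|base_spectrum k. g z * (cmod (\<Sum>i<h k. \<alpha> i * z ^ i))\<^sup>2)"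
    by (rule step_function_spectrum[OF F(1) \<alpha> \<sigma>F g(1)])
  also have "\<dots> \<le> (LINT z|base_spectrum k. g z * c)"
  proof (intro integral_mono B.continuous_integrable continuous_intros cg mult_left_mono)
    fix z assume "z \<in> space (base_spectrum k)"
    hence z: "z \<in> unit_circle" by (simp only: B.space_circle)
    have "cmod (\<Sum>i<h k. \<alpha> i * z ^ i) \<le> (\<Sum>i<h k. cmod (\<alpha> i))"
      by (intro order_trans[OF norm_sum] sum_mono) (use z in \<open>simp add: norm_mult norm_power\<close>)
    thus "(cmod (\<Sum>i<h k. \<alpha> i * z ^ i))\<^sup>2 \<le> c" unfolding c_def by (intro power_mono) auto
    show "0 \<le> g z" using g(2)[OF z] by simp
  qed
  also have "\<dots> = c * (LINT z|base_spectrum k. g z)" by simp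
  also have "\<dots> \<le> c * \<epsilon>'" by (intro mult_left_mono g c)
  finally have gF: "(LINT z|\<sigma>F. g z) \<le> \<epsilon> / 4" using c\<epsilon>' by linarith
  have "(LINT z|\<sigma>u. g z) \<le> (LINT z|\<sigma>u. 2)"
    using g(2) by (intro integral_mono U.continuous_integrable cg continuous_on_const) (simp only: U.space_circle)
  also have "\<dots> = 2 * (LINT x|M. (cmod (f x - F x))\<^sup>2)"
    using spectral_mass[OF \<sigma>u] by simp
  finally have gu: "(LINT z|\<sigma>u. g z) \<le> \<epsilon> / 4" using F(3) by linarith
  have "(LINT z|\<sigma>. g z) \<le> 2 * (LINT z|\<sigma>F. g z) + 2 * (LINT z|\<sigma>u. g z)"
    using \<sigma> g by (intro spectral_sum_bound[OF F(1) u _ \<sigma>F \<sigma>u]) auto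
  hence "(LINT z|\<sigma>. g z) \<le> \<epsilon>" using gF gu by linarith
  thus ?thesis using g cg \<epsilon>' by (intro exI[of _ g]) auto
qed

lemma singular: "singular_spectrum M T"
  unfolding singular_spectrum_def
proof (intro allI impI)
  fix f assume f: "L2 f"
  obtain \<sigma> where \<sigma>: "spectral \<sigma> f" using spectral_exists[OF f] .
  have "mutually_singular \<sigma> circle_lebesgue"
    using \<sigma> spectrum_test_function[OF f \<sigma>]
    by (intro mutually_singular_by_test_functions) (simp_all add: spectral_def)
  thus "\<exists>\<sigma>. is_spectral_measure M T f \<sigma> \<and> mutually_singular \<sigma> circle_lebesgue"
    using spectral_is_spectral_measure[OF \<sigma>] by blast
qed

end

theorem theorem2p1:
  fixes p :: "nat \<Rightarrow> nat" and a :: "nat \<Rightarrow> nat \<Rightarrow> nat"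
    and b :: "nat \<Rightarrow> nat \<Rightarrow> real" and T :: "real \<Rightarrow> real"
  assumes "\<And>k. p k \<ge> 2"
    and "rank_one_transformation p a b T"
    and "\<And>k j. j < p k \<Longrightarrow> a k (j + 1) \<ge> 2 * spacer_sum a k j"
    and "\<And>k. real (spacer_sum a k (p k)) / real (height p a k) < 1 / 2"
  shows "singular_spectrum (rank_one_space p a b) T"
proof -
  interpret lacunary_rank_one p a b T
    by unfold_locales (fact assms)+
  show ?thesis by (rule singular)
qed

end
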